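(* Let $G=(V,E)$ be an msp-digraph. Then the oriented chromatic number $\chi_o(G)$ can be computed in linear time, i.e. in time $O(|V|+|E|)$.
   Context: A source is a vertex of indegree $0$, a sink a vertex of outdegree $0$. For vertex-disjoint digraphs $G_1=(V_1,E_1)$, $G_2=(V_2,E_2)$, let $O_1$ be the set of sinks of $G_1$ and $I_2$ the set of sources of $G_2$. The parallel composition is $G_1\cup G_2=(V_1\cup V_2,E_1\cup E_2)$; the series composition is $G_1\times G_2=(V_1\cup V_2,E_1\cup E_2\cup\{(v,w)\mid v\in O_1, w\in I_2\})$. Msp-digraphs are defined recursively: every single-vertex digraph is an msp-digraph, and if $G_1,G_2$ are vertex-disjoint msp-digraphs then $G_1\cup G_2$ and $G_1\times G_2$ are msp-digraphs. An oriented $r$-coloring of an oriented graph $G=(V,E)$ is a map $c:V\to\{1,\dots,r\}$ with $c(u)\neq c(v)$ for every $(u,v)\in E$, and $c(u)\neq c(y)$ for every two arcs $(u,v),(x,y)\in E$ with $c(v)=c(x)$; $\chi_o(G)$ is the smallest such $r$. *)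

theory Defs
  imports "Graph_Theory.Pair_Digraph"
begin

section \<open>Msp-digraphs\<close>

definition sources :: "'a pair_pre_digraph \<Rightarrow> 'a set" where
  "sources G = {v \<in> pverts G. in_degree (with_proj G) v = 0}"

definition sinks :: "'a pair_pre_digraph \<Rightarrow> 'a set" where
  "sinks G = {v \<in> pverts G. out_degree (with_proj G) v = 0}"

definition parallel_comp ::
  "'a pair_pre_digraph \<Rightarrow> 'a pair_pre_digraph \<Rightarrow> 'a pair_pre_digraph" where
  "parallel_comp G1 G2 =
     \<lparr>pverts = pverts G1 \<union> pverts G2, parcs = parcs G1 \<union> parcs G2\<rparr>"

definition series_comp ::
  "'a pair_pre_digraph \<Rightarrow> 'a pair_pre_digraph \<Rightarrow> 'a pair_pre_digraph" where
  "series_comp G1 G2 =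
     \<lparr>pverts = pverts G1 \<union> pverts G2,
      parcs = parcs G1 \<union> parcs G2 \<union> sinks G1 \<times> sources G2\<rparr>"

inductive msp_digraph :: "'a pair_pre_digraph \<Rightarrow> bool" where
  single: "msp_digraph \<lparr>pverts = {v}, parcs = {}\<rparr>"
| parallel: "\<lbrakk>msp_digraph G1; msp_digraph G2; pverts G1 \<inter> pverts G2 = {}\<rbrakk>
    \<Longrightarrow> msp_digraph (parallel_comp G1 G2)"
| series: "\<lbrakk>msp_digraph G1; msp_digraph G2; pverts G1 \<inter> pverts G2 = {}\<rbrakk>
    \<Longrightarrow> msp_digraph (series_comp G1 G2)"

section \<open>Oriented chromatic number\<close>

definition oriented_coloring :: "'a pair_pre_digraph \<Rightarrow> nat \<Rightarrow> ('a \<Rightarrow> nat) \<Rightarrow> bool" where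
  "oriented_coloring G r c \<longleftrightarrow>
     c \<in> pverts G \<rightarrow> {1..r} \<and>
     (\<forall>(u, v) \<in> parcs G. c u \<noteq> c v) \<and>
     (\<forall>(u, v) \<in> parcs G. \<forall>(x, y) \<in> parcs G. c v = c x \<longrightarrow> c u \<noteq> c y)"

text \<open>
  This is meant for finite oriented graphs only, which always have an oriented coloring
  (color the vertices injectively); otherwise the value of LEAST is arbitrary.
\<close>

definition oriented_chromatic_number :: "'a pair_pre_digraph \<Rightarrow> nat" where
  "oriented_chromatic_number G = (LEAST r. \<exists>c. oriented_coloring G r c)"

section \<open>The machine model\<close>

text \<open>
  Running time is measured on a word RAM, presented as a structured imperative language. A
  program has finitely many scalar variables and finitely many one-dimensional arrays,
  indexed by natural numbers and accessed in constant time. (A RAM with a single memory holds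
  the arrays of a fixed program by interleaving them, at constant overhead.) The only
  arithmetic is addition and truncated subtraction.
\<close>

type_synonym vname = string
type_synonym aname = string
type_synonym state = "(vname \<Rightarrow> nat) \<times> (aname \<Rightarrow> nat \<Rightarrow> nat)"

datatype aexp =
    N nat
  | V vname
  | Get aname aexp
  | Plus aexp aexp
  | Minus aexp aexp

datatype bexp =
    Less aexp aexp
  | Neg bexp
  | Conj bexp bexp

datatype com =
    Skip
  | Assign vname aexp
  | Put aname aexp aexp
  | Seq com com
  | Cond bexp com com
  | While bexp com

fun aval :: "aexp \<Rightarrow> state \<Rightarrow> nat" where
  "aval (N k) s = k"
| "aval (V x) s = fst s x"
| "aval (Get a e) s = snd s a (aval e s)"
| "aval (Plus e1 e2) s = aval e1 s + aval e2 s"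
| "aval (Minus e1 e2) s = aval e1 s - aval e2 s"

fun bval :: "bexp \<Rightarrow> state \<Rightarrow> bool" where
  "bval (Less e1 e2) s = (aval e1 s < aval e2 s)"
| "bval (Neg b) s = (\<not> bval b s)"
| "bval (Conj b1 b2) s = (bval b1 s \<and> bval b2 s)"

fun acost :: "aexp \<Rightarrow> nat" where
  "acost (N k) = 1"
| "acost (V x) = 1"
| "acost (Get a e) = 1 + acost e"
| "acost (Plus e1 e2) = 1 + acost e1 + acost e2"
| "acost (Minus e1 e2) = 1 + acost e1 + acost e2"

fun bcost :: "bexp \<Rightarrow> nat" where
  "bcost (Less e1 e2) = 1 + acost e1 + acost e2"
| "bcost (Neg b) = 1 + bcost b"
| "bcost (Conj b1 b2) = 1 + bcost b1 + bcost b2"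

text \<open>
  \<open>exec W p s t s'\<close>: program \<open>p\<close>, started in \<open>s\<close>, halts in \<open>s'\<close> after \<open>t\<close> elementary operations,
  and neither a stored value nor the address of a write ever exceeds the largest machine word
  \<open>W\<close>; a program that overflows is stuck. Without this restriction, unit-cost addition would
  build numbers of linearly many bits in linear time. Intermediate results inside an
  expression exceed \<open>W\<close> by at most a factor that depends on the program only.
\<close>

inductive exec :: "nat \<Rightarrow> com \<Rightarrow> state \<Rightarrow> nat \<Rightarrow> state \<Rightarrow> bool" for W :: nat where
  Skip: "exec W Skip s 1 s"
| Assign: "aval e s \<le> W \<Longrightarrow>
    exec W (Assign x e) s (1 + acost e) ((fst s)(x := aval e s), snd s)"
| Put: "\<lbrakk>aval i s \<le> W; aval e s \<le> W\<rbrakk> \<Longrightarrow>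
    exec W (Put a i e) s (1 + acost i + acost e)
      (fst s, (snd s)(a := (snd s a)(aval i s := aval e s)))"
| Seq: "\<lbrakk>exec W p1 s1 t1 s2; exec W p2 s2 t2 s3\<rbrakk> \<Longrightarrow>
    exec W (Seq p1 p2) s1 (t1 + t2) s3"
| CondTrue: "\<lbrakk>bval b s; exec W p1 s t s'\<rbrakk> \<Longrightarrow>
    exec W (Cond b p1 p2) s (1 + bcost b + t) s'"
| CondFalse: "\<lbrakk>\<not> bval b s; exec W p2 s t s'\<rbrakk> \<Longrightarrow>
    exec W (Cond b p1 p2) s (1 + bcost b + t) s'"
| WhileFalse: "\<not> bval b s \<Longrightarrow> exec W (While b p) s (1 + bcost b) s"
| WhileTrue: "\<lbrakk>bval b s1; exec W p s1 t1 s2; exec W (While b p) s2 t2 s3\<rbrakk> \<Longrightarrow>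
    exec W (While b p) s1 (1 + bcost b + t1 + t2) s3"

lemma exec_deterministic:
  "exec W p s t s' \<Longrightarrow> exec W p s u s'' \<Longrightarrow> u = t \<and> s'' = s'"
proof (induction arbitrary: u s'' rule: exec.induct)
  case (Skip s)
  then show ?case by (auto elim: exec.cases)
next
  case (Assign e s x)
  from Assign.prems show ?case by (cases rule: exec.cases) auto
next
  case (Put i s e a)
  from Put.prems show ?case by (cases rule: exec.cases) auto
next
  case (Seq p1 s1 t1 s2 p2 t2 s3)
  from Seq.prems show ?case by (cases rule: exec.cases) (use Seq.IH in blast)
next
  case (CondTrue b s p1 t s' p2)
  from CondTrue.prems show ?case
    by (cases rule: exec.cases) (use CondTrue.IH CondTrue.hyps in blast)+
next
  case (CondFalse b s p2 t s' p1)
  from CondFalse.prems show ?case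
    by (cases rule: exec.cases) (use CondFalse.IH CondFalse.hyps in blast)+
next
  case (WhileFalse b s p)
  from WhileFalse.prems show ?case
    by (cases rule: exec.cases) (use WhileFalse.hyps in blast)+
next
  case (WhileTrue b s1 p t1 s2 t2 s3)
  from WhileTrue.prems show ?case
    by (cases rule: exec.cases) (use WhileTrue.IH WhileTrue.hyps in blast)+
qed

section \<open>Graph problems solvable in linear time\<close>

text \<open>
  A graph is given to a program by its number \<open>n\<close> of vertices, which are named
  \<open>0, \<dots>, n - 1\<close> in an arbitrary way, and a list of its arcs in arbitrary order and without
  repetitions. (Adjacency lists can be obtained from this in linear time.)
\<close>

definition represents :: "nat \<Rightarrow> (nat \<times> nat) list \<Rightarrow> 'a pair_pre_digraph \<Rightarrow> bool" where
  "represents n es G \<longleftrightarrow>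
     (\<exists>f. bij_betw f (pverts G) {0..<n} \<and> distinct es \<and>
          set es = (\<lambda>(u, v). (f u, f v)) ` parcs G)"

text \<open>All memory that does not hold the input is initially zero.\<close>

definition input_state :: "nat \<Rightarrow> (nat \<times> nat) list \<Rightarrow> state" where
  "input_state n es =
     ((\<lambda>_. 0)(''n'' := n, ''m'' := length es),
      (\<lambda>_ _. 0)(''tail'' := (\<lambda>i. if i < length es then fst (es ! i) else 0),
                ''head'' := (\<lambda>i. if i < length es then snd (es ! i) else 0)))"

text \<open>
  The function \<open>f\<close> is computable in time \<open>O(|V| + |E|)\<close> on the graphs of class \<open>K\<close>: one program
  handles all of them, and it uses words of \<open>O(log (|V| + |E|))\<close> bits, as is usual for the word
  RAM. The output is left in the variable \<open>result\<close>. The program may rely on its input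
  representing a graph of the class.
\<close>

definition linear_time_computable ::
  "('a pair_pre_digraph \<Rightarrow> bool) \<Rightarrow> ('a pair_pre_digraph \<Rightarrow> nat) \<Rightarrow> bool" where
  "linear_time_computable K f \<longleftrightarrow>
     (\<exists>p c d k. \<forall>G n es. K G \<and> represents n es G \<longrightarrow>
        (\<exists>t s. exec (d * (card (pverts G) + card (parcs G)) ^ k) p (input_state n es) t s \<and>
               fst s ''result'' = f G \<and>
               t \<le> c * (card (pverts G) + card (parcs G))))"

end

theory Submission
  imports Defs "HOL-Library.Multiset"
begin

text \<open>
  An msp-digraph is the line digraph of a two-terminal series-parallel multigraph, and seven colors
  always suffice. Hence the chromatic number can be read off the set of all triples of an oriented
  graph \<open>H\<close> on at most seven vertices and of the images of the sources and of the sinks under a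
  homomorphism to \<open>H\<close>. These sets form a finite algebra, in which a composition of digraphs is
  evaluated in constant time.

  The decomposition itself is never built. The multigraph, with arcs labelled in the algebra, is
  shrunk by merging parallel arcs and contracting nodes with one arc in and one arc out, which does
  not change the label of the whole. If nodes are treated in topological order, the treated part
  always is a tree rooted at the source; this makes parallel arcs easy to find, and every
  contraction can be charged to a node.
\<close>

section \<open>Reducing two-terminal series-parallel multigraphs\<close>

text \<open>Oriented coloring is not local: a color pair on an arc of one component forbids the
  reversed pair in every other component, so the chromatic numbers of two factors do not determine
  that of their composition. Fixing the whole target \<open>H\<close> in advance removes this
  interaction. Finitely many targets suffice because of the seven colors. These come from the
  quadratic residue tournament on seven points, where every arc from i to k has a midpoint j with
  arcs from i to j and from j to k; this is what a series composition asks for.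

  The treated part is a tree for the following reason. Every node x other than the source is the
  sink of a component that contains all arcs into x. A component with more than one arc has two
  parallel arcs into its sink, or an arc into its sink from an inner node with a single outgoing
  arc. Hence merging and contracting around x until neither is possible leaves exactly one arc into
  x. Only the arcs into x are inspected for this, and a parallel arc is detected by a mark at its
  tail.\<close>

definition indeg :: "('v \<times> 'v \<times> 'l) multiset \<Rightarrow> 'v \<Rightarrow> nat" where
  "indeg X w = size {#e \<in># X. fst (snd e) = w#}"

definition outdeg :: "('v \<times> 'v \<times> 'l) multiset \<Rightarrow> 'v \<Rightarrow> nat" where
  "outdeg X w = size {#e \<in># X. fst e = w#}"

lemma indeg_simps [simp]:
  "indeg {#} w = 0"
  "indeg (add_mset e X) w = (if fst (snd e) = w then Suc (indeg X w) else indeg X w)"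
  "indeg (X + Y) w = indeg X w + indeg Y w"
  by (simp_all add: indeg_def)

lemma outdeg_simps [simp]:
  "outdeg {#} w = 0"
  "outdeg (add_mset e X) w = (if fst e = w then Suc (outdeg X w) else outdeg X w)"
  "outdeg (X + Y) w = outdeg X w + outdeg Y w"
  by (simp_all add: outdeg_def)

lemma indeg_eq_0_iff: "indeg X w = 0 \<longleftrightarrow> (\<forall>u l. (u, w, l) \<notin># X)"
  by (force simp: indeg_def dest!: arg_cong[where f = set_mset])

lemma outdeg_eq_0_iff: "outdeg X w = 0 \<longleftrightarrow> (\<forall>v l. (w, v, l) \<notin># X)"
  by (force simp: outdeg_def dest!: arg_cong[where f = set_mset])

section \<open>Series-parallel multigraphs with arcs labelled in an algebra\<close>

locale sp_algebra =
  fixes par ser :: "'l \<Rightarrow> 'l \<Rightarrow> 'l"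
  assumes par_assoc: "par (par k l) m = par k (par l m)"
    and par_commute: "par k l = par l k"
    and ser_assoc: "ser (ser k l) m = ser k (ser l m)"
begin

text \<open>\<open>J\<close> collects the inner nodes. The side conditions of \<open>ser\<close>
  prevent a terminal of the result from reappearing as an inner node of the opposite factor, which
  would create cycles. A multigraph may have many decompositions; the laws of the algebra allow the
  proofs below to regroup a given one.\<close>

inductive ttsp :: "('v \<times> 'v \<times> 'l) multiset \<Rightarrow> 'v set \<Rightarrow> 'v \<Rightarrow> 'v \<Rightarrow> 'l \<Rightarrow> bool" where
  edge: "a \<noteq> b \<Longrightarrow> ttsp {#(a, b, l)#} {} a b l"
| par: "\<lbrakk>ttsp X M a b k; ttsp Y J a b l; M \<inter> J = {}\<rbrakk> \<Longrightarrow> ttsp (X + Y) (M \<union> J) a b (par k l)"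
| ser: "\<lbrakk>ttsp X M a c k; ttsp Y J c b l; M \<inter> J = {}; a \<noteq> b; a \<notin> J; b \<notin> M\<rbrakk>
    \<Longrightarrow> ttsp (X + Y) (insert c (M \<union> J)) a b (ser k l)"

lemma ttsp_terminals: "ttsp X J a b l \<Longrightarrow> a \<noteq> b \<and> a \<notin> J \<and> b \<notin> J \<and> X \<noteq> {#}"
  by (induction rule: ttsp.induct) auto

lemma ttsp_edgeD:
  "ttsp X J a b l \<Longrightarrow> (u, v, k) \<in># X \<Longrightarrow> u \<in> insert a J \<and> v \<in> insert b J \<and> u \<noteq> v"
proof (induction rule: ttsp.induct)
  case (ser X M a c k Y J b l)
  then show ?case
    using ttsp_terminals[OF ser.hyps(1)] ttsp_terminals[OF ser.hyps(2)] by auto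
qed auto

lemma ttsp_indeg_pos: "ttsp X J a b l \<Longrightarrow> w = b \<or> w \<in> J \<Longrightarrow> indeg X w > 0"
proof (induction arbitrary: w rule: ttsp.induct)
  case (par X M a b k Y J l)
  show ?case using par.prems par.IH(1)[of w] par.IH(2)[of w] by auto
next
  case (ser X M a c k Y J b l)
  show ?case using ser.prems ser.IH(1)[of w] ser.IH(2)[of w] by auto
qed auto

lemma ttsp_outdeg_pos: "ttsp X J a b l \<Longrightarrow> w = a \<or> w \<in> J \<Longrightarrow> outdeg X w > 0"
proof (induction arbitrary: w rule: ttsp.induct)
  case (par X M a b k Y J l)
  show ?case using par.prems par.IH(1)[of w] par.IH(2)[of w] by auto
next
  case (ser X M a c k Y J b l)
  show ?case using ser.prems ser.IH(1)[of w] ser.IH(2)[of w] by auto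
qed auto

lemma ttsp_outdeg_0: "ttsp X J a b l \<Longrightarrow> w \<notin> insert a J \<Longrightarrow> outdeg X w = 0"
  by (auto simp: outdeg_eq_0_iff dest: ttsp_edgeD)

lemma ttsp_indeg_0: "ttsp X J a b l \<Longrightarrow> w \<notin> insert b J \<Longrightarrow> indeg X w = 0"
  by (auto simp: indeg_eq_0_iff dest: ttsp_edgeD)

section \<open>Merging parallel arcs\<close>

lemma ttsp_singleton:
  assumes "ttsp {#(u, v, k)#} J a b l"
  shows "u = a \<and> v = b \<and> J = {} \<and> l = k"
  using assms
  by (cases rule: ttsp.cases) (auto simp: single_is_union dest: ttsp_terminals)

lemma add_mset_eq_plusE:
  assumes "X + Y = add_mset e Z"
  obtains X' where "X = add_mset e X'" "Z = X' + Y"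
  | Y' where "Y = add_mset e Y'" "Z = X + Y'"
proof -
  have "e \<in># X \<or> e \<in># Y" using assms by (metis union_iff union_single_eq_member)
  then show thesis
  proof
    assume "e \<in># X"
    then obtain X' where "X = add_mset e X'" by (metis insert_DiffM)
    then show thesis using that(1) assms by simp
  next
    assume "e \<in># Y"
    then obtain Y' where "Y = add_mset e Y'" by (metis insert_DiffM)
    then show thesis using that(2) assms by simp
  qed
qed

text \<open>An arc from source to sink cannot lie inside a series composition, so the way down to it
  passes through parallel compositions only. Associativity and commutativity of \<open>par\<close>
  then bring its label to the front.\<close>

lemma ttsp_remove_direct:
  assumes "ttsp X J a b l" "X = add_mset (a, b, k) Z" "Z \<noteq> {#}"
  shows "\<exists>l'. ttsp Z J a b l' \<and> l = par k l'"
  using assms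
proof (induction arbitrary: Z rule: ttsp.induct)
  case (par X M a b k1 Y J l1)
  have *: "\<exists>l'. ttsp (X' + Y) (M \<union> J) a b l' \<and> par k1 l1 = par k l'"
    if IH: "\<And>Z. \<lbrakk>X = add_mset (a, b, k) Z; Z \<noteq> {#}\<rbrakk> \<Longrightarrow> \<exists>l'. ttsp Z M a b l' \<and> k1 = par k l'"
      and X: "ttsp X M a b k1" and Y: "ttsp Y J a b l1" and MJ: "M \<inter> J = {}"
      and X': "X = add_mset (a, b, k) X'" for X Y M J k1 l1 X'
  proof (cases "X' = {#}")
    case True
    with ttsp_singleton[of a b k] X X' have "M = {}" "k1 = k" by auto
    with Y True show ?thesis by auto
  next
    case False
    with IH X' obtain l' where l': "ttsp X' M a b l'" "k1 = par k l'" by blast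
    have "ttsp (X' + Y) (M \<union> J) a b (par l' l1)" using l'(1) Y MJ by (rule ttsp.par)
    then show ?thesis using l'(2) par_assoc by blast
  qed
  from par.prems(1) show ?case
  proof (cases rule: add_mset_eq_plusE)
    case (1 X')
    from *[OF par.IH(1) par.hyps(1-3) 1(1)] show ?thesis by (simp add: 1(2))
  next
    case (2 Y')
    have "J \<inter> M = {}" using par.hyps(3) by blast
    from *[OF par.IH(2) par.hyps(2,1) this 2(1)] show ?thesis
      unfolding 2(2) by (metis par_commute Un_commute add.commute)
  qed
next
  case (ser X M a c k1 Y J b l1)
  have "(a, b, k) \<in># X + Y" using ser.prems(1) by simp
  then show ?case
    using ttsp_edgeD[OF ser.hyps(1), of a b k] ttsp_edgeD[OF ser.hyps(2), of a b k] ser.hyps(3-6)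
      ttsp_terminals[OF ser.hyps(1)] ttsp_terminals[OF ser.hyps(2)] by auto
qed auto

lemma ttsp_relabel_direct:
  assumes "ttsp (add_mset (a, b, k) Z) J a b l"
  shows "ttsp (add_mset (a, b, par k' k) Z) J a b (par k' l)"
proof (cases "Z = {#}")
  case True
  with ttsp_singleton[of a b k] assms have "J = {}" "l = k" by auto
  then show ?thesis using True ttsp_terminals[OF assms] by (auto intro: ttsp.edge)
next
  case False
  from ttsp_remove_direct[OF assms refl False] obtain l'
    where l': "ttsp Z J a b l'" "l = par k l'" by blast
  have "ttsp {#(a, b, par k' k)#} {} a b (par k' k)"
    using ttsp_terminals[OF assms] by (simp add: ttsp.edge)
  from ttsp.par[OF this l'(1)] show ?thesis by (simp add: l' par_assoc)
qed

text \<open>The arc in the first factor absorbs the label \<open>k2\<close>, and the arc in the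
  second factor is deleted. If that arc was the whole second factor, nothing remains to be composed,
  hence the case distinction.\<close>

lemma ttsp_merge_across:
  assumes "ttsp (add_mset (a, b, k1) X) M a b l1" "ttsp (add_mset (a, b, k2) Y) J a b l2"
    and "M \<inter> J = {}"
  shows "ttsp (add_mset (a, b, par k1 k2) (X + Y)) (M \<union> J) a b (par l1 l2)"
proof -
  note X = ttsp_relabel_direct[OF assms(1), of k2]
  show ?thesis
  proof (cases "Y = {#}")
    case True
    with ttsp_singleton[of a b k2] assms have "J = {}" "l2 = k2" by auto
    with X True show ?thesis by (simp add: par_commute)
  next
    case False
    from ttsp_remove_direct[OF assms(2) refl False] obtain l'
      where l': "ttsp Y J a b l'" "l2 = par k2 l'" by blast
    have "par (par k2 l1) l' = par l1 l2" by (metis l'(2) par_assoc par_commute)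
    with ttsp.par[OF X l'(1) assms(3)] show ?thesis by (simp add: par_commute[of k1 k2])
  qed
qed

text \<open>If both arcs lie in one factor, induction applies. Otherwise both ends are shared by the
  factors; factors of a series composition share only one node, so the composition is parallel and
  the arcs join its terminals.\<close>

lemma ttsp_merge_parallel:
  assumes "ttsp X J a b l" "X = add_mset (u, v, k1) (add_mset (u, v, k2) Z)"
  shows "ttsp (add_mset (u, v, par k1 k2) Z) J a b l"
  using assms
proof (induction arbitrary: Z k1 k2 rule: ttsp.induct)
  case (par X M a b k Y J l)
  have ends: "u = a" "v = b" if "(u, v, k) \<in># X" "(u, v, k') \<in># Y" for k k'
    using ttsp_edgeD[OF par.hyps(1) that(1)] ttsp_edgeD[OF par.hyps(2) that(2)]
      ttsp_terminals[OF par.hyps(1)] ttsp_terminals[OF par.hyps(2)] par.hyps(3) by auto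
  from par.prems show ?case
  proof (cases rule: add_mset_eq_plusE)
    case (1 X')
    note X = 1(1)
    from 1(2)[symmetric] show ?thesis
    proof (cases rule: add_mset_eq_plusE)
      case (1 X'')
      then show ?thesis using ttsp.par[OF par.IH(1) par.hyps(2,3)] X by simp
    next
      case (2 Y')
      have uv: "u = a" "v = b" using ends X 2 by auto
      show ?thesis
        using ttsp_merge_across[of a b k1 X' M k k2 Y' J l] par.hyps X 2 by (simp add: uv)
    qed
  next
    case (2 Y')
    note Y = 2(1)
    from 2(2)[symmetric] show ?thesis
    proof (cases rule: add_mset_eq_plusE)
      case (1 X')
      have uv: "u = a" "v = b" using ends 1 Y by auto
      show ?thesis
        using ttsp_merge_across[of a b k2 X' M k k1 Y' J l] par.hyps Y 1
        by (simp add: uv par_commute)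
    next
      case (2 Y'')
      then show ?thesis using ttsp.par[OF par.hyps(1) par.IH(2) par.hyps(3)] Y by simp
    qed
  qed
next
  case (ser X M a c k Y J b l)
  have no: False if "(u, v, k) \<in># X" "(u, v, k') \<in># Y" for k k'
    using ttsp_edgeD[OF ser.hyps(1) that(1)] ttsp_edgeD[OF ser.hyps(2) that(2)]
      ttsp_terminals[OF ser.hyps(1)] ttsp_terminals[OF ser.hyps(2)] ser.hyps(3-6) by auto
  from ser.prems show ?case
  proof (cases rule: add_mset_eq_plusE)
    case (1 X')
    note X = 1(1)
    from 1(2)[symmetric] show ?thesis
    proof (cases rule: add_mset_eq_plusE)
      case (1 X'')
      then show ?thesis using ttsp.ser[OF ser.IH(1) ser.hyps(2-6)] X by simp
    qed (use no X in auto)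
  next
    case (2 Y')
    note Y = 2(1)
    from 2(2)[symmetric] show ?thesis
    proof (cases rule: add_mset_eq_plusE)
      case (2 Y'')
      then show ?thesis using ttsp.ser[OF ser.hyps(1) ser.IH(2) ser.hyps(3-6)] Y by simp
    qed (use no Y in auto)
  qed
qed auto

section \<open>Contracting a node with one arc in and one arc out\<close>

lemma ttsp_split_sink:
  assumes "ttsp X J a b l" "X = add_mset (u, b, k) Z" "indeg Z b = 0"
  shows "Z = {#} \<and> u = a \<and> J = {} \<and> l = k \<or>
    (\<exists>l'. ttsp Z (J - {u}) a u l' \<and> u \<in> J \<and> l = ser l' k)"
  using assms
proof (induction arbitrary: Z rule: ttsp.induct)
  case (par X M a b k1 Y J l1)
  from par.prems(1) show ?case
    by (cases rule: add_mset_eq_plusE)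
      (use par.prems(2) ttsp_indeg_pos[OF par.hyps(1), of b] ttsp_indeg_pos[OF par.hyps(2), of b] in auto)
next
  case (ser X M a c k1 Y J b l1)
  from ser.prems(1) show ?case
  proof (cases rule: add_mset_eq_plusE)
    case (1 X')
    then have "(u, b, k) \<in># X" by simp
    then show ?thesis
      using ttsp_edgeD[OF ser.hyps(1)] ser.hyps(6) ttsp_terminals[OF ser.hyps(2)] by blast
  next
    case (2 Y')
    note t = ttsp_terminals[OF ser.hyps(1)] ttsp_terminals[OF ser.hyps(2)]
    have "indeg Y' b = 0" using ser.prems(2) 2 by simp
    from ser.IH(2)[OF 2(1) this] show ?thesis
    proof (elim disjE conjE exE)
      assume "Y' = {#}" "u = c" "J = {}" "l1 = k"
      then show ?thesis using ser.hyps(1) t 2 by auto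
    next
      fix l' assume A: "ttsp Y' (J - {u}) c u l'" "u \<in> J" "l1 = ser l' k"
      have "ttsp (X + Y') (insert c (M \<union> (J - {u}))) a u (ser k1 l')"
        using ttsp.ser[OF ser.hyps(1) A(1)] ser.hyps A(2) by blast
      moreover have "insert c (M \<union> (J - {u})) = insert c (M \<union> J) - {u}"
        using A(2) t ser.hyps(3) by auto
      ultimately show ?thesis using A 2 by (auto simp: ser_assoc)
    qed
  qed
qed auto

lemma ttsp_split_source:
  assumes "ttsp X J a b l" "X = add_mset (a, v, k) Z" "outdeg Z a = 0"
  shows "Z = {#} \<and> v = b \<and> J = {} \<and> l = k \<or>
    (\<exists>l'. ttsp Z (J - {v}) v b l' \<and> v \<in> J \<and> l = ser k l')"
  using assms
proof (induction arbitrary: Z rule: ttsp.induct)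
  case (par X M a b k1 Y J l1)
  from par.prems(1) show ?case
    by (cases rule: add_mset_eq_plusE)
      (use par.prems(2) ttsp_outdeg_pos[OF par.hyps(1), of a] ttsp_outdeg_pos[OF par.hyps(2), of a] in auto)
next
  case (ser X M a c k1 Y J b l1)
  from ser.prems(1) show ?case
  proof (cases rule: add_mset_eq_plusE)
    case (2 Y')
    then have "(a, v, k) \<in># Y" by simp
    then show ?thesis
      using ttsp_edgeD[OF ser.hyps(2)] ser.hyps(5) ttsp_terminals[OF ser.hyps(1)] by blast
  next
    case (1 X')
    note t = ttsp_terminals[OF ser.hyps(1)] ttsp_terminals[OF ser.hyps(2)]
    have "outdeg X' a = 0" using ser.prems(2) 1 by simp
    from ser.IH(1)[OF 1(1) this] show ?thesis
    proof (elim disjE conjE exE)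
      assume "X' = {#}" "v = c" "M = {}" "k1 = k"
      then show ?thesis using ser.hyps(2) t 1 by auto
    next
      fix l' assume A: "ttsp X' (M - {v}) v c l'" "v \<in> M" "k1 = ser k l'"
      have "ttsp (X' + Y) (insert c (M - {v} \<union> J)) v b (ser l' l1)"
        using ttsp.ser[OF A(1) ser.hyps(2)] ser.hyps A(2) by blast
      moreover have "insert c (M - {v} \<union> J) = insert c (M \<union> J) - {v}"
        using A(2) t ser.hyps(3) by auto
      ultimately show ?thesis using A 1 by (auto simp: ser_assoc)
    qed
  qed
qed auto

text \<open>All arcs at an inner node of a factor belong to that factor, so the induction runs down
  to the series composition in which \<open>w\<close> is the middle node. There the arc into
  \<open>w\<close> ends the first factor and the arc out of \<open>w\<close> starts the second one,
  and associativity of \<open>ser\<close> brings the two labels together.\<close>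

lemma ttsp_contract:
  assumes "ttsp X J a b l" "X = add_mset (u, w, k1) (add_mset (w, v, k2) Z)"
    and "w \<in> J" "indeg Z w = 0" "outdeg Z w = 0"
  shows "ttsp (add_mset (u, v, ser k1 k2) Z) (J - {w}) a b l"
  using assms
proof (induction arbitrary: Z rule: ttsp.induct)
  case (edge a b l)
  then show ?case by simp
next
  case (par X M a b k Y J l)
  note t = ttsp_terminals[OF par.hyps(1)] ttsp_terminals[OF par.hyps(2)]
  show ?case
  proof (cases "w \<in> M")
    case True
    with par.hyps(3) t have w: "w \<notin> insert a J" "w \<notin> insert b J" by auto
    note Y0 = ttsp_indeg_0[OF par.hyps(2) w(2)] ttsp_outdeg_0[OF par.hyps(2) w(1)]
    from par.prems(1) obtain X' where X': "X = add_mset (u, w, k1) X'"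
        "add_mset (w, v, k2) Z = X' + Y"
      by (cases rule: add_mset_eq_plusE) (use Y0 in auto)
    from X'(2)[symmetric] obtain X'' where X'': "X' = add_mset (w, v, k2) X''" "Z = X'' + Y"
      by (cases rule: add_mset_eq_plusE) (use Y0 in auto)
    have IH: "ttsp (add_mset (u, v, ser k1 k2) X'') (M - {w}) a b k"
      using par.IH(1)[of X''] X' X'' True par.prems by simp
    have MJ: "(M - {w}) \<inter> J = {}" "M \<union> J - {w} = (M - {w}) \<union> J" using par.hyps(3) w by auto
    show ?thesis using ttsp.par[OF IH par.hyps(2) MJ(1)] X'' MJ(2) by simp
  next
    case False
    with par.prems have wN: "w \<in> J" by simp
    with False t have w: "w \<notin> insert a M" "w \<notin> insert b M" by auto
    note X0 = ttsp_indeg_0[OF par.hyps(1) w(2)] ttsp_outdeg_0[OF par.hyps(1) w(1)]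
    from par.prems(1) obtain Y' where Y': "Y = add_mset (u, w, k1) Y'"
        "add_mset (w, v, k2) Z = X + Y'"
      by (cases rule: add_mset_eq_plusE) (use X0 in auto)
    from Y'(2)[symmetric] obtain Y'' where Y'': "Y' = add_mset (w, v, k2) Y''" "Z = X + Y''"
      by (cases rule: add_mset_eq_plusE) (use X0 in auto)
    have IH: "ttsp (add_mset (u, v, ser k1 k2) Y'') (J - {w}) a b l"
      using par.IH(2)[of Y''] Y' Y'' wN par.prems by simp
    have MJ: "M \<inter> (J - {w}) = {}" "M \<union> J - {w} = M \<union> (J - {w})" using par.hyps(3) w by auto
    show ?thesis using ttsp.par[OF par.hyps(1) IH MJ(1)] Y'' MJ(2) by simp
  qed
next
  case (ser X M a c k Y J b l)
  note t = ttsp_terminals[OF ser.hyps(1)] ttsp_terminals[OF ser.hyps(2)]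
  consider (c) "w = c" | (M) "w \<in> M" "w \<noteq> c" | (J) "w \<in> J" "w \<noteq> c" "w \<notin> M"
    using ser.prems(2) ser.hyps(3) by auto
  then show ?case
  proof cases
    case c
    have X0: "outdeg X c = 0" using ttsp_outdeg_0[OF ser.hyps(1)] t by auto
    have Y0: "indeg Y c = 0" using ttsp_indeg_0[OF ser.hyps(2)] t by auto
    from ser.prems(1) obtain X' where X': "X = add_mset (u, c, k1) X'"
        "add_mset (w, v, k2) Z = X' + Y"
      by (cases rule: add_mset_eq_plusE) (use Y0 c in auto)
    from X'(2)[symmetric] obtain Y' where Y': "Y = add_mset (c, v, k2) Y'" "Z = X' + Y'"
      by (cases rule: add_mset_eq_plusE) (use X0 X' c in \<open>auto split: if_splits\<close>)
    have deg: "indeg X' c = 0" "outdeg Y' c = 0" using ser.prems(3,4) Y'(2) c by auto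
    have set: "insert c (M \<union> J) - {w} = M \<union> J" using c t by auto
    have uv: "u \<in> insert a M" "v \<in> insert b J"
      using ttsp_edgeD[OF ser.hyps(1), of u c k1] ttsp_edgeD[OF ser.hyps(2), of c v k2] X' Y' t by auto
    have "u \<noteq> v" using uv ser.hyps(3-6) by auto
    have E: "ttsp {#(u, v, ser k1 k2)#} {} u v (ser k1 k2)" using \<open>u \<noteq> v\<close> by (rule ttsp.edge)
    \<comment> \<open>The new arc is first composed with what remains of \<open>Y\<close>, which
      absorbs \<open>k1\<close> into the label of the second factor; afterwards the remainder of
      \<open>X\<close> is put in front.\<close>
    from ttsp_split_source[OF ser.hyps(2) Y'(1) deg(2)]
    have F: "\<exists>m. ttsp (add_mset (u, v, ser k1 k2) Y') J u b m \<and> m = ser k1 l"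
    proof (elim disjE conjE exE)
      assume "Y' = {#}" "v = b" "J = {}" "l = k2"
      then show ?thesis using E by auto
    next
      fix l' assume A: "ttsp Y' (J - {v}) v b l'" "v \<in> J" "l = ser k2 l'"
      have J: "insert v ({} \<union> (J - {v})) = J" using A by auto
      have "u \<noteq> b" "u \<notin> J - {v}" using uv ser.hyps(3-6) by auto
      from ttsp.ser[OF E A(1) _ this] show ?thesis
        unfolding J by (simp add: A(3) ser_assoc)
    qed
    then have F: "ttsp (add_mset (u, v, ser k1 k2) Y') J u b (ser k1 l)" by blast
    from ttsp_split_sink[OF ser.hyps(1) X'(1) deg(1)] show ?thesis
    proof (elim disjE conjE exE)
      assume "X' = {#}" "u = a" "M = {}" "k = k1"
      then show ?thesis using F Y' set by auto
    next
      fix l' assume A: "ttsp X' (M - {u}) a u l'" "u \<in> M" "k = ser l' k1"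
      have MJ: "insert u (M - {u} \<union> J) = M \<union> J" using A by auto
      have "(M - {u}) \<inter> J = {}" "b \<notin> M - {u}" using ser.hyps(3,6) by auto
      from ttsp.ser[OF A(1) F this(1) ser.hyps(4,5) this(2)] show ?thesis
        unfolding MJ set by (simp add: A(3) Y'(2) ser_assoc)
    qed
  next
    case M
    with ser.hyps(3) ser.hyps(6) have w: "w \<notin> insert c J" "w \<notin> insert b J" by auto
    note Y0 = ttsp_indeg_0[OF ser.hyps(2) w(2)] ttsp_outdeg_0[OF ser.hyps(2) w(1)]
    from ser.prems(1) obtain X' where X': "X = add_mset (u, w, k1) X'"
        "add_mset (w, v, k2) Z = X' + Y"
      by (cases rule: add_mset_eq_plusE) (use Y0 in auto)
    from X'(2)[symmetric] obtain X'' where X'': "X' = add_mset (w, v, k2) X''" "Z = X'' + Y"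
      by (cases rule: add_mset_eq_plusE) (use Y0 in auto)
    have IH: "ttsp (add_mset (u, v, ser k1 k2) X'') (M - {w}) a c k"
      using ser.IH(1)[of X''] X' X'' M ser.prems by simp
    have MJ: "(M - {w}) \<inter> J = {}" "b \<notin> M - {w}" "insert c (M \<union> J) - {w} = insert c (M - {w} \<union> J)"
      using ser.hyps(3,6) w by auto
    show ?thesis using ttsp.ser[OF IH ser.hyps(2) MJ(1) ser.hyps(4,5) MJ(2)] X'' MJ(3) by simp
  next
    case J
    with ser.hyps(5) have w: "w \<notin> insert a M" "w \<notin> insert c M" by auto
    note X0 = ttsp_indeg_0[OF ser.hyps(1) w(2)] ttsp_outdeg_0[OF ser.hyps(1) w(1)]
    from ser.prems(1) obtain Y' where Y': "Y = add_mset (u, w, k1) Y'"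
        "add_mset (w, v, k2) Z = X + Y'"
      by (cases rule: add_mset_eq_plusE) (use X0 in auto)
    from Y'(2)[symmetric] obtain Y'' where Y'': "Y' = add_mset (w, v, k2) Y''" "Z = X + Y''"
      by (cases rule: add_mset_eq_plusE) (use X0 in auto)
    have IH: "ttsp (add_mset (u, v, ser k1 k2) Y'') (J - {w}) c b l"
      using ser.IH(2)[of Y''] Y' Y'' J ser.prems by simp
    have MJ: "M \<inter> (J - {w}) = {}" "a \<notin> J - {w}" "insert c (M \<union> J) - {w} = insert c (M \<union> (J - {w}))"
      using ser.hyps(3,5) J by auto
    show ?thesis using ttsp.ser[OF ser.hyps(1) IH MJ(1) ser.hyps(4) MJ(2) ser.hyps(6)] Y'' MJ(3) by simp
  qed
qed

text \<open>Only arcs into \<open>x\<close> are restricted, since the nodes are treated one at a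
  time and the rest of the graph is not yet reduced. The tail \<open>a\<close> is exempt because a
  terminal is never contracted.\<close>

definition reduced_at :: "('v \<times> 'v \<times> 'l) multiset \<Rightarrow> 'v \<Rightarrow> 'v \<Rightarrow> bool" where
  "reduced_at X a x \<longleftrightarrow>
     (\<forall>u. size {#e \<in># X. fst e = u \<and> fst (snd e) = x#} \<le> 1) \<and>
     (\<forall>u k. (u, x, k) \<in># X \<longrightarrow> u = a \<or> outdeg X u \<ge> 2)"

lemma reduced_at_simple:
  "reduced_at X a x \<Longrightarrow> size {#e \<in># X. fst e = u \<and> fst (snd e) = x#} \<le> 1"
  unfolding reduced_at_def by (elim conjE allE)

lemma reduced_at_tail:
  "reduced_at X a x \<Longrightarrow> (u, x, k) \<in># X \<Longrightarrow> u = a \<or> outdeg X u \<ge> 2"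
  unfolding reduced_at_def by (elim conjE) blast

text \<open>Passing to a part cannot create parallel arcs, but it may lower the outdegree of a tail.
  This is excluded for tails that send no arc into the other part. The source \<open>a'\<close> of
  the part may differ from \<open>a\<close>: in the second factor of a series composition it is the
  middle node.\<close>

lemma reduced_at_sub:
  assumes "reduced_at (X + Y) a x" "\<And>u k. (u, x, k) \<in># X \<Longrightarrow> u = a' \<or> u \<noteq> a \<and> outdeg Y u = 0"
  shows "reduced_at X a' x"
proof -
  have "size {#e \<in># X. fst e = u \<and> fst (snd e) = x#} \<le> 1" for u
  proof -
    have "size {#e \<in># X + Y. fst e = u \<and> fst (snd e) = x#} \<le> 1"
      using assms(1) by (rule reduced_at_simple)
    then show ?thesis by simp
  qed
  moreover have "u = a' \<or> outdeg X u \<ge> 2" if "(u, x, k) \<in># X" for u k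
  proof -
    have "(u, x, k) \<in># X + Y" using that by simp
    with assms(1) have "u = a \<or> outdeg (X + Y) u \<ge> 2" by (rule reduced_at_tail)
    with assms(2)[OF that] show ?thesis by auto
  qed
  ultimately show ?thesis unfolding reduced_at_def by simp
qed

text \<open>By induction the factors at the sink are single arcs. In a parallel composition these
  two arcs would be parallel. In a series composition, the arc from the middle node \<open>c\<close>
  would be the only one leaving \<open>c\<close>, although \<open>c\<close> is not the source. So
  the decomposition is trivial.\<close>

lemma reduced_at_sink:
  assumes "ttsp X J a b l" "reduced_at X a b"
  shows "X = {#(a, b, l)#}"
  using assms
proof (induction rule: ttsp.induct)
  case (par X M a b k Y J l)
  note t = ttsp_terminals[OF par.hyps(1)] ttsp_terminals[OF par.hyps(2)]
  have sideX: "u = a \<or> u \<noteq> a \<and> outdeg Y u = 0" if "(u, v, m) \<in># X" for u v m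
    using ttsp_edgeD[OF par.hyps(1) that] ttsp_outdeg_0[OF par.hyps(2), of u] par.hyps(3) t by auto
  have sideY: "u = a \<or> u \<noteq> a \<and> outdeg X u = 0" if "(u, v, m) \<in># Y" for u v m
    using ttsp_edgeD[OF par.hyps(2) that] ttsp_outdeg_0[OF par.hyps(1), of u] par.hyps(3) t by auto
  have "reduced_at X a b"
    using par.prems by (rule reduced_at_sub) (rule sideX)
  moreover have "reduced_at (Y + X) a b" using par.prems by (simp add: add.commute)
  then have "reduced_at Y a b"
    by (rule reduced_at_sub) (rule sideY)
  ultimately have XY: "X = {#(a, b, k)#}" "Y = {#(a, b, l)#}" using par.IH by auto
  have "size {#e \<in># X + Y. fst e = a \<and> fst (snd e) = b#} \<le> 1"
    using par.prems by (rule reduced_at_simple)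
  then show ?case by (simp add: XY)
next
  case (ser X M a c k Y J b l)
  note t = ttsp_terminals[OF ser.hyps(1)] ttsp_terminals[OF ser.hyps(2)]
  have sideX: "u = a \<or> u \<noteq> a \<and> outdeg Y u = 0" if "(u, v, m) \<in># X" for u v m
    using ttsp_edgeD[OF ser.hyps(1) that] ttsp_outdeg_0[OF ser.hyps(2), of u] ser.hyps(3) t by auto
  have sideY: "u = c \<or> u \<noteq> a \<and> outdeg X u = 0" if "(u, v, m) \<in># Y" for u v m
    using ttsp_edgeD[OF ser.hyps(2) that] ttsp_outdeg_0[OF ser.hyps(1), of u] ser.hyps(3,5) t by auto
  have "reduced_at (Y + X) a b" using ser.prems by (simp add: add.commute)
  then have "reduced_at Y c b"
    by (rule reduced_at_sub) (rule sideY)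
  then have Y: "Y = {#(c, b, l)#}" by (rule ser.IH(2))
  have "outdeg X c = 0" using ttsp_outdeg_0[OF ser.hyps(1)] t by auto
  then show ?case using reduced_at_tail[OF ser.prems, of c l] Y t by auto
qed auto

text \<open>The induction descends to the component that has \<open>x\<close> as its sink. It
  contains all arcs into \<open>x\<close>, so that \<open>reduced_at_sink\<close> applies to
  it.\<close>

lemma reduced_at_indeg:
  assumes "ttsp X J a b l" "reduced_at X a x" "x = b \<or> x \<in> J"
  shows "indeg X x = 1"
  using assms
proof (induction rule: ttsp.induct)
  case (edge a b l)
  then show ?case by simp
next
  case (par X M a b k Y J l)
  show ?case
  proof (cases "x = b")
    case True
    have "ttsp (X + Y) (M \<union> J) a b (par k l)" using par.hyps by (rule ttsp.par)
    from reduced_at_sink[OF this] True par.prems show ?thesis by simp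
  next
    case False
    note t = ttsp_terminals[OF par.hyps(1)] ttsp_terminals[OF par.hyps(2)]
    have sideX: "u = a \<or> u \<noteq> a \<and> outdeg Y u = 0" if "(u, v, m) \<in># X" for u v m
      using ttsp_edgeD[OF par.hyps(1) that] ttsp_outdeg_0[OF par.hyps(2), of u] par.hyps(3) t by auto
    have sideY: "u = a \<or> u \<noteq> a \<and> outdeg X u = 0" if "(u, v, m) \<in># Y" for u v m
      using ttsp_edgeD[OF par.hyps(2) that] ttsp_outdeg_0[OF par.hyps(1), of u] par.hyps(3) t by auto
    show ?thesis
    proof (cases "x \<in> M")
      case True
      have "reduced_at X a x"
        using par.prems(1) by (rule reduced_at_sub) (rule sideX)
      moreover have "indeg Y x = 0" by (rule ttsp_indeg_0[OF par.hyps(2)]) (use True False par.hyps(3) in auto)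
      ultimately show ?thesis using par.IH(1) True by simp
    next
      case False': False
      have "reduced_at (Y + X) a x" using par.prems by (simp add: add.commute)
      then have "reduced_at Y a x"
        by (rule reduced_at_sub) (rule sideY)
      moreover have "indeg X x = 0" by (rule ttsp_indeg_0[OF par.hyps(1)]) (use False' False in auto)
      ultimately show ?thesis using par.IH(2) False' False par.prems by simp
    qed
  qed
next
  case (ser X M a c k Y J b l)
  note t = ttsp_terminals[OF ser.hyps(1)] ttsp_terminals[OF ser.hyps(2)]
  have sideX: "u = a \<or> u \<noteq> a \<and> outdeg Y u = 0" if "(u, v, m) \<in># X" for u v m
    using ttsp_edgeD[OF ser.hyps(1) that] ttsp_outdeg_0[OF ser.hyps(2), of u] ser.hyps(3) t by auto
  have sideY: "u = c \<or> u \<noteq> a \<and> outdeg X u = 0" if "(u, v, m) \<in># Y" for u v m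
    using ttsp_edgeD[OF ser.hyps(2) that] ttsp_outdeg_0[OF ser.hyps(1), of u] ser.hyps(3,5) t by auto
  consider "x = b" | "x = c \<or> x \<in> M" "x \<noteq> b" | "x \<in> J" "x \<noteq> b" "x \<noteq> c" "x \<notin> M"
    using ser.prems(2) by auto
  then show ?case
  proof cases
    case 1
    have "ttsp (X + Y) (insert c (M \<union> J)) a b (ser k l)" using ser.hyps by (rule ttsp.ser)
    from reduced_at_sink[OF this] 1 ser.prems show ?thesis by simp
  next
    case 2
    have "reduced_at X a x"
      using ser.prems(1) by (rule reduced_at_sub) (rule sideX)
    moreover have "indeg Y x = 0" by (rule ttsp_indeg_0[OF ser.hyps(2)]) (use 2 t ser.hyps(3) in auto)
    ultimately show ?thesis using ser.IH(1) 2 by simp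
  next
    case 3
    have "reduced_at (Y + X) a x" using ser.prems by (simp add: add.commute)
    then have "reduced_at Y c x"
      by (rule reduced_at_sub) (rule sideY)
    moreover have "indeg X x = 0" by (rule ttsp_indeg_0[OF ser.hyps(1)]) (use 3 in auto)
    ultimately show ?thesis using ser.IH(2) 3 by simp
  qed
qed

text \<open>Acyclicity, in the form of a ranking. The ranks are real so that the values at the
  terminals can be prescribed and the middle node of a series composition can still be placed
  between them.\<close>

lemma ttsp_rank:
  assumes "ttsp X J a b l" "ra < rb"
  shows "\<exists>rk :: 'v \<Rightarrow> real. rk a = ra \<and> rk b = rb \<and> (\<forall>u v k. (u, v, k) \<in># X \<longrightarrow> rk u < rk v)"
  using assms
proof (induction arbitrary: ra rb rule: ttsp.induct)
  case (edge a b l)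
  then show ?case by (intro exI[of _ "\<lambda>w. if w = a then ra else rb"]) auto
next
  case (par X M a b k Y J l)
  note t = ttsp_terminals[OF par.hyps(1)] ttsp_terminals[OF par.hyps(2)]
  from par.IH(1)[OF par.prems] obtain r1 where r1: "r1 a = ra" "r1 b = rb"
      "\<And>u v k. (u, v, k) \<in># X \<Longrightarrow> r1 u < r1 v" by blast
  from par.IH(2)[OF par.prems] obtain r2 where r2: "r2 a = ra" "r2 b = rb"
      "\<And>u v k. (u, v, k) \<in># Y \<Longrightarrow> r2 u < r2 v" by blast
  define r where "r w = (if w \<in> M then r1 w else r2 w)" for w
  have rM: "r w = r1 w" if "w \<in> insert a M \<or> w \<in> insert b M" for w
    using that r1 r2 t by (auto simp: r_def)
  have rJ: "r w = r2 w" if "w \<in> insert a J \<or> w \<in> insert b J" for w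
    using that r1 r2 t par.hyps(3) by (auto simp: r_def)
  have "r u < r v" if "(u, v, k) \<in># X" for u v k
    using ttsp_edgeD[OF par.hyps(1) that] rM[of u] rM[of v] r1(3)[OF that] by metis
  moreover have "r u < r v" if "(u, v, k) \<in># Y" for u v k
    using ttsp_edgeD[OF par.hyps(2) that] rJ[of u] rJ[of v] r2(3)[OF that] by metis
  ultimately show ?case using r2 t by (intro exI[of _ r]) (auto simp: r_def)
next
  case (ser X M a c k Y J b l)
  note t = ttsp_terminals[OF ser.hyps(1)] ttsp_terminals[OF ser.hyps(2)]
  define rc where "rc = (ra + rb) / 2"
  have rc: "ra < rc" "rc < rb" using ser.prems by (auto simp: rc_def)
  from ser.IH(1)[OF rc(1)] obtain r1 where r1: "r1 a = ra" "r1 c = rc"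
      "\<And>u v k. (u, v, k) \<in># X \<Longrightarrow> r1 u < r1 v" by blast
  from ser.IH(2)[OF rc(2)] obtain r2 where r2: "r2 c = rc" "r2 b = rb"
      "\<And>u v k. (u, v, k) \<in># Y \<Longrightarrow> r2 u < r2 v" by blast
  define r where "r w = (if w \<in> insert a M then r1 w else r2 w)" for w
  have rM: "r w = r1 w" if "w \<in> insert a M \<or> w \<in> insert c M" for w
    using that r1 r2 t by (auto simp: r_def)
  have rJ: "r w = r2 w" if "w \<in> insert c J \<or> w \<in> insert b J" for w
    using that r1 r2 t ser.hyps(3-6) by (auto simp: r_def)
  have "r u < r v" if "(u, v, k) \<in># X" for u v k
    using ttsp_edgeD[OF ser.hyps(1) that] rM[of u] rM[of v] r1(3)[OF that] by metis
  moreover have "r u < r v" if "(u, v, k) \<in># Y" for u v k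
    using ttsp_edgeD[OF ser.hyps(2) that] rJ[of u] rJ[of v] r2(3)[OF that] by metis
  moreover have "r a = ra" "r b = rb" using r1 r2 ser.hyps(4,6) by (auto simp: r_def)
  ultimately show ?case by (intro exI[of _ r]) auto
qed

end

section \<open>Running programs\<close>

text \<open>All loop bodies of the program are kept free of loops. Their effect is then a total
  function \<open>sem\<close>, which the simplifier can evaluate, and only the conditions on
  overflow, collected in \<open>fits\<close>, have to be proved separately.\<close>

fun while_free :: "com \<Rightarrow> bool" where
  "while_free Skip \<longleftrightarrow> True"
| "while_free (Assign x e) \<longleftrightarrow> True"
| "while_free (Put a i e) \<longleftrightarrow> True"
| "while_free (Seq p q) \<longleftrightarrow> while_free p \<and> while_free q"
| "while_free (Cond b p q) \<longleftrightarrow> while_free p \<and> while_free q"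
| "while_free (While b p) \<longleftrightarrow> False"

fun sem :: "com \<Rightarrow> state \<Rightarrow> state" where
  "sem Skip s = s"
| "sem (Assign x e) s = ((fst s)(x := aval e s), snd s)"
| "sem (Put a i e) s = (fst s, (snd s)(a := (snd s a)(aval i s := aval e s)))"
| "sem (Seq p q) s = sem q (sem p s)"
| "sem (Cond b p q) s = (if bval b s then sem p s else sem q s)"
| "sem (While b p) s = s"

fun fits :: "nat \<Rightarrow> com \<Rightarrow> state \<Rightarrow> bool" where
  "fits W Skip s \<longleftrightarrow> True"
| "fits W (Assign x e) s \<longleftrightarrow> aval e s \<le> W"
| "fits W (Put a i e) s \<longleftrightarrow> aval i s \<le> W \<and> aval e s \<le> W"
| "fits W (Seq p q) s \<longleftrightarrow> fits W p s \<and> fits W q (sem p s)"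
| "fits W (Cond b p q) s \<longleftrightarrow> (if bval b s then fits W p s else fits W q s)"
| "fits W (While b p) s \<longleftrightarrow> False"

text \<open>Both branches of a conditional are added up, which makes the bound independent of the
  state. The value at \<open>While\<close> is a dummy.\<close>

fun max_cost :: "com \<Rightarrow> nat" where
  "max_cost Skip = 1"
| "max_cost (Assign x e) = 1 + acost e"
| "max_cost (Put a i e) = 1 + acost i + acost e"
| "max_cost (Seq p q) = max_cost p + max_cost q"
| "max_cost (Cond b p q) = 1 + bcost b + max_cost p + max_cost q"
| "max_cost (While b p) = 0"

lemma exec_while_free:
  "while_free p \<Longrightarrow> fits W p s \<Longrightarrow> \<exists>t \<le> max_cost p. exec W p s t (sem p s)"
proof (induction p arbitrary: s)
  case (Seq p q)
  from Seq.IH(1)[of s] Seq.IH(2)[of "sem p s"] Seq.prems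
  obtain t u where "t \<le> max_cost p" "exec W p s t (sem p s)"
      "u \<le> max_cost q" "exec W q (sem p s) u (sem q (sem p s))" by fastforce
  then show ?case by (auto intro!: exI[of _ "t + u"] exec.Seq)
next
  case (Cond b p q)
  show ?case
  proof (cases "bval b s")
    case True
    with Cond.IH(1)[of s] Cond.prems obtain t where "t \<le> max_cost p" "exec W p s t (sem p s)" by auto
    with True show ?thesis by (auto intro!: exI[of _ "1 + bcost b + t"] exec.CondTrue simp del: One_nat_def)
  next
    case False
    with Cond.IH(2)[of s] Cond.prems obtain t where "t \<le> max_cost q" "exec W q s t (sem q s)" by auto
    with False show ?thesis by (auto intro!: exI[of _ "1 + bcost b + t"] exec.CondFalse simp del: One_nat_def)
  qed
next
  case Skip
  then show ?case by (auto intro!: exI[of _ 1] exec.Skip simp del: One_nat_def)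
next
  case (Assign x e)
  then show ?case by (auto intro!: exI[of _ "1 + acost e"] exec.Assign simp del: One_nat_def)
next
  case (Put a i e)
  then show ?case by (auto intro!: exI[of _ "1 + acost i + acost e"] exec.Put simp del: One_nat_def)
qed auto

text \<open>Maintained for the entire memory. Copying a stored value then never overflows, and cells
  whose contents are not described by an invariant need no bounds of their own.\<close>

definition word_state :: "nat \<Rightarrow> state \<Rightarrow> bool" where
  "word_state W s \<longleftrightarrow> (\<forall>x. fst s x \<le> W) \<and> (\<forall>a i. snd s a i \<le> W)"

lemma word_stateD [dest]: "word_state W s \<Longrightarrow> fst s x \<le> W" "word_state W s \<Longrightarrow> snd s a i \<le> W"
  by (auto simp: word_state_def)

lemma word_state_sem: "while_free p \<Longrightarrow> fits W p s \<Longrightarrow> word_state W s \<Longrightarrow> word_state W (sem p s)"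
proof (induction p arbitrary: s)
  case (Cond b p q)
  then show ?case by (auto split: if_splits)
qed (auto simp: word_state_def)

section \<open>Total correctness with time bounds\<close>

definition runs :: "nat \<Rightarrow> com \<Rightarrow> state \<Rightarrow> nat \<Rightarrow> (state \<Rightarrow> bool) \<Rightarrow> bool" where
  "runs W p s T Q \<longleftrightarrow> (\<exists>t s'. exec W p s t s' \<and> t \<le> T \<and> word_state W s' \<and> Q s')"

lemma runs_while_free:
  assumes "while_free p" "word_state W s" "fits W p s" "Q (sem p s)"
  shows "runs W p s (max_cost p) Q"
  using exec_while_free[OF assms(1,3)] word_state_sem[OF assms(1,3,2)] assms(4)
  unfolding runs_def by blast

lemma runs_Seq:
  assumes "runs W p s T P" "\<And>s'. word_state W s' \<Longrightarrow> P s' \<Longrightarrow> runs W q s' U Q"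
  shows "runs W (Seq p q) s (T + U) Q"
proof -
  from assms(1) obtain t s' where p: "exec W p s t s'" "t \<le> T" "word_state W s'" "P s'"
    unfolding runs_def by blast
  from assms(2)[OF p(3,4)] obtain u s'' where "exec W q s' u s''" "u \<le> U" "word_state W s''" "Q s''"
    unfolding runs_def by blast
  with p show ?thesis unfolding runs_def by (blast intro: exec.Seq add_mono)
qed

lemma runs_While:
  assumes "while_free p" "word_state W s" "I k s"
    and step: "\<And>k s. \<lbrakk>word_state W s; I k s; bval b s\<rbrakk> \<Longrightarrow> fits W p s \<and> (\<exists>k' < k. I k' (sem p s))"
  shows "runs W (While b p) s ((1 + bcost b + max_cost p) * (k + 1)) (\<lambda>s. (\<exists>k. I k s) \<and> \<not> bval b s)"
  using assms(2,3)
proof (induction k arbitrary: s rule: less_induct)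
  case (less k)
  show ?case
  proof (cases "bval b s")
    case False
    then have "exec W (While b p) s (1 + bcost b) s" by (rule exec.WhileFalse)
    with less.prems False show ?thesis unfolding runs_def
      by (intro exI[of _ "1 + bcost b"] exI[of _ s]) auto
  next
    case True
    from step[OF less.prems True] obtain k' where k': "fits W p s" "k' < k" "I k' (sem p s)" by blast
    from exec_while_free[OF assms(1) k'(1)] obtain t where
      t: "t \<le> max_cost p" "exec W p s t (sem p s)" by blast
    from less.IH[OF k'(2) word_state_sem[OF assms(1) k'(1) less.prems(1)] k'(3)] obtain u s' where
      u: "exec W (While b p) (sem p s) u s'" "u \<le> (1 + bcost b + max_cost p) * (k' + 1)"
         "word_state W s'" "\<exists>k. I k s'" "\<not> bval b s'"
      unfolding runs_def by blast
    have "exec W (While b p) s (1 + bcost b + t + u) s'" by (rule exec.WhileTrue[OF True t(2) u(1)])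
    moreover have "1 + bcost b + t + u \<le> (1 + bcost b + max_cost p) * (k + 1)"
    proof -
      have "1 + bcost b + t + u \<le> (1 + bcost b + max_cost p) * (k' + 2)" using t(1) u(2) by simp
      also have "\<dots> \<le> (1 + bcost b + max_cost p) * (k + 1)" using k'(2) by (intro mult_le_mono2) simp
      finally show ?thesis .
    qed
    ultimately show ?thesis using u unfolding runs_def by blast
  qed
qed

lemma runs_mono: "runs W p s T Q \<Longrightarrow> T \<le> U \<Longrightarrow> (\<And>s. word_state W s \<Longrightarrow> Q s \<Longrightarrow> R s) \<Longrightarrow> runs W p s U R"
  unfolding runs_def by (meson le_trans)

definition Eq :: "aexp \<Rightarrow> aexp \<Rightarrow> bexp" where
  "Eq e f = Conj (Neg (Less e f)) (Neg (Less f e))"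

lemma bval_Eq [simp]: "bval (Eq e f) s \<longleftrightarrow> aval e s = aval f s"
  by (auto simp: Eq_def)

text \<open>A function on a finite domain becomes program text, namely a cascade of comparisons.
  Evaluating it costs a constant, and the function itself need not be expressible by arithmetic.
  Arguments outside the table leave the state unchanged.\<close>

fun tabulate :: "vname \<Rightarrow> vname \<Rightarrow> vname \<Rightarrow> (nat \<Rightarrow> nat \<Rightarrow> nat) \<Rightarrow> (nat \<times> nat) list \<Rightarrow> com" where
  "tabulate z x y f [] = Skip"
| "tabulate z x y f ((i, j) # ps) =
     Cond (Conj (Eq (V x) (N i)) (Eq (V y) (N j))) (Assign z (N (f i j))) (tabulate z x y f ps)"

lemma while_free_tabulate [simp]: "while_free (tabulate z x y f ps)"
  by (induction ps) auto

lemma sem_tabulate: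
  "(fst s x, fst s y) \<in> set ps \<Longrightarrow>
   sem (tabulate z x y f ps) s = ((fst s)(z := f (fst s x) (fst s y)), snd s)"
  by (induction ps) auto

lemma fits_tabulate:
  "(fst s x, fst s y) \<in> set ps \<Longrightarrow> f (fst s x) (fst s y) \<le> W \<Longrightarrow> fits W (tabulate z x y f ps) s"
  by (induction ps) auto

definition lookup :: "vname \<Rightarrow> vname \<Rightarrow> vname \<Rightarrow> (nat \<Rightarrow> nat \<Rightarrow> nat) \<Rightarrow> nat \<Rightarrow> com" where
  "lookup z x y f q = tabulate z x y f (List.product [0..<q] [0..<q])"

lemma while_free_lookup [simp]: "while_free (lookup z x y f q)"
  by (simp add: lookup_def)

lemma sem_lookup [simp]:
  "fst s x < q \<Longrightarrow> fst s y < q \<Longrightarrow>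
   sem (lookup z x y f q) s = ((fst s)(z := f (fst s x) (fst s y)), snd s)"
  by (simp add: lookup_def sem_tabulate)

lemma fits_lookup [simp]:
  "fst s x < q \<Longrightarrow> fst s y < q \<Longrightarrow> f (fst s x) (fst s y) \<le> W \<Longrightarrow> fits W (lookup z x y f q) s"
  by (simp add: lookup_def fits_tabulate)

section \<open>Msp-digraphs\<close>

lemma finite_msp: "msp_digraph G \<Longrightarrow> finite (pverts G) \<and> parcs G \<subseteq> pverts G \<times> pverts G"
  by (induction rule: msp_digraph.induct)
    (auto simp: parallel_comp_def series_comp_def sources_def sinks_def)

lemma finite_msp_arcs: "msp_digraph G \<Longrightarrow> finite (parcs G)"
  using finite_msp[of G] by (auto intro: finite_subset[OF _ finite_cartesian_product])

lemma in_degree_eq_0: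
  "finite (parcs G) \<Longrightarrow> in_degree (with_proj G) v = 0 \<longleftrightarrow> (\<forall>u. (u, v) \<notin> parcs G)"
  by (auto simp: in_degree_def in_arcs_def card_eq_0_iff)

lemma out_degree_eq_0:
  "finite (parcs G) \<Longrightarrow> out_degree (with_proj G) v = 0 \<longleftrightarrow> (\<forall>w. (v, w) \<notin> parcs G)"
  by (auto simp: out_degree_def out_arcs_def card_eq_0_iff)

lemma sources_sinks_subset: "sources G \<subseteq> pverts G" "sinks G \<subseteq> pverts G"
  by (auto simp: sources_def sinks_def)

lemma msp_sources: "msp_digraph G \<Longrightarrow> sources G = {v \<in> pverts G. \<forall>u. (u, v) \<notin> parcs G}"
  by (auto simp: sources_def in_degree_eq_0 finite_msp_arcs)

lemma msp_sinks: "msp_digraph G \<Longrightarrow> sinks G = {v \<in> pverts G. \<forall>w. (v, w) \<notin> parcs G}"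
  by (auto simp: sinks_def out_degree_eq_0 finite_msp_arcs)

lemma single_simps [simp]:
  "sources \<lparr>pverts = {v}, parcs = {}\<rparr> = {v}" "sinks \<lparr>pverts = {v}, parcs = {}\<rparr> = {v}"
  using msp_sources[OF single[of v]] msp_sinks[OF single[of v]] by auto

lemma parallel_simps [simp]:
  "pverts (parallel_comp G H) = pverts G \<union> pverts H"
  "parcs (parallel_comp G H) = parcs G \<union> parcs H"
  by (simp_all add: parallel_comp_def)

lemma series_simps [simp]:
  "pverts (series_comp G H) = pverts G \<union> pverts H"
  "parcs (series_comp G H) = parcs G \<union> parcs H \<union> sinks G \<times> sources H"
  by (simp_all add: series_comp_def)

lemma parallel_sources_sinks:
  assumes "msp_digraph G" "msp_digraph H" "pverts G \<inter> pverts H = {}"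
  shows "sources (parallel_comp G H) = sources G \<union> sources H"
    and "sinks (parallel_comp G H) = sinks G \<union> sinks H"
  using finite_msp[OF assms(1)] finite_msp[OF assms(2)] assms(3)
  by (auto simp: msp_sources msp_sinks assms(1,2) parallel[OF assms])

text \<open>These inclusions are separated from the equalities below because the latter depend on
  sources and sinks being nonempty, which in turn is proved by induction from the
  inclusions.\<close>

lemma series_sources_supset:
  assumes "msp_digraph G" "msp_digraph H" "pverts G \<inter> pverts H = {}"
  shows "sources G \<subseteq> sources (series_comp G H)" "sinks H \<subseteq> sinks (series_comp G H)"
proof -
  have G: "x \<in> pverts G \<and> y \<in> pverts G" if "(x, y) \<in> parcs G" for x y
    using finite_msp[OF assms(1)] that by blast
  have H: "x \<in> pverts H \<and> y \<in> pverts H" if "(x, y) \<in> parcs H" for x y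
    using finite_msp[OF assms(2)] that by blast
  note sub = sources_sinks_subset[of G] sources_sinks_subset[of H]
  show "sources G \<subseteq> sources (series_comp G H)"
  proof
    fix x assume "x \<in> sources G"
    then have "x \<in> pverts G" "\<forall>u. (u, x) \<notin> parcs G" using msp_sources[OF assms(1)] by auto
    then show "x \<in> sources (series_comp G H)"
      unfolding msp_sources[OF series[OF assms]] using H[of _ x] sub assms(3) by auto
  qed
  show "sinks H \<subseteq> sinks (series_comp G H)"
  proof
    fix x assume "x \<in> sinks H"
    then have "x \<in> pverts H" "\<forall>w. (x, w) \<notin> parcs H" using msp_sinks[OF assms(2)] by auto
    then show "x \<in> sinks (series_comp G H)"
      unfolding msp_sinks[OF series[OF assms]] using G[of x] sub assms(3) by (auto; blast)
  qed
qed

lemma sources_sinks_nonempty: "msp_digraph G \<Longrightarrow> sources G \<noteq> {} \<and> sinks G \<noteq> {}"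
proof (induction rule: msp_digraph.induct)
  case (parallel G H)
  then show ?case by (simp add: parallel_sources_sinks)
next
  case (series G H)
  then show ?case using series_sources_supset[OF series.hyps] by auto
qed simp

text \<open>A source of \<open>H\<close> stops being a source because some sink of \<open>G\<close>
  exists, and a sink of \<open>G\<close> stops being a sink because some source of \<open>H\<close>
  exists.\<close>

lemma series_sources_sinks:
  assumes "msp_digraph G" "msp_digraph H" "pverts G \<inter> pverts H = {}"
  shows "sources (series_comp G H) = sources G" and "sinks (series_comp G H) = sinks H"
proof -
  obtain g h where gh: "g \<in> sinks G" "h \<in> sources H"
    using sources_sinks_nonempty[OF assms(1)] sources_sinks_nonempty[OF assms(2)] by auto
  have "x \<in> sources G" if "x \<in> sources (series_comp G H)" for x
  proof -
    from that have x: "x \<in> pverts G \<union> pverts H" "\<And>u. (u, x) \<notin> parcs (series_comp G H)"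
      unfolding msp_sources[OF series[OF assms]] by auto
    have "x \<notin> sources H" using x(2)[of g] gh(1) by auto
    then have "x \<in> pverts G" using x(1) x(2) msp_sources[OF assms(2)] by auto
    then show ?thesis using x(2) msp_sources[OF assms(1)] by auto
  qed
  then show "sources (series_comp G H) = sources G" using series_sources_supset[OF assms] by blast
  have "x \<in> sinks H" if "x \<in> sinks (series_comp G H)" for x
  proof -
    from that have x: "x \<in> pverts G \<union> pverts H" "\<And>w. (x, w) \<notin> parcs (series_comp G H)"
      unfolding msp_sinks[OF series[OF assms]] by auto
    have "x \<notin> sinks G" using x(2)[of h] gh(2) by auto
    then have "x \<in> pverts H" using x(1) x(2) msp_sinks[OF assms(1)] by auto
    then show ?thesis using x(2) msp_sinks[OF assms(2)] by auto
  qed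
  then show "sinks (series_comp G H) = sinks H" using series_sources_supset[OF assms] by blast
qed

text \<open>Since the sinks of the first factor become adjacent to the sources of the second one, arcs
  come in complete bipartite blocks.\<close>

lemma msp_bipartite_blocks:
  "msp_digraph G \<Longrightarrow> (u, v) \<in> parcs G \<Longrightarrow> (u', v) \<in> parcs G \<Longrightarrow> (u, w) \<in> parcs G \<Longrightarrow> (u', w) \<in> parcs G"
proof (induction rule: msp_digraph.induct)
  case (parallel G H)
  have G: "x \<in> pverts G \<and> y \<in> pverts G" if "(x, y) \<in> parcs G" for x y
    using finite_msp[OF parallel.hyps(1)] that by blast
  have H: "x \<in> pverts H \<and> y \<in> pverts H" if "(x, y) \<in> parcs H" for x y
    using finite_msp[OF parallel.hyps(2)] that by blast
  show ?case
    using parallel.prems parallel.hyps(3) parallel.IH G[of u v] G[of u' v] G[of u w]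
      H[of u v] H[of u' v] H[of u w] by auto
next
  case (series G H)
  have G: "x \<in> pverts G \<and> y \<in> pverts G \<and> x \<notin> sinks G" if "(x, y) \<in> parcs G" for x y
    using finite_msp[OF series.hyps(1)] that msp_sinks[OF series.hyps(1)] by blast
  have H: "x \<in> pverts H \<and> y \<in> pverts H \<and> y \<notin> sources H" if "(x, y) \<in> parcs H" for x y
    using finite_msp[OF series.hyps(2)] that msp_sources[OF series.hyps(2)] by blast
  show ?case
    using series.prems series.hyps(3) series.IH G[of u v] G[of u' v] G[of u w]
      H[of u v] H[of u' v] H[of u w] sources_sinks_subset[of G] sources_sinks_subset[of H] by auto
qed simp

lemma glue_homs:
  assumes "msp_digraph G" "msp_digraph H" "pverts G \<inter> pverts H = {}"
    and c: "c ` pverts G \<subseteq> R" "\<forall>(u, v) \<in> parcs G. (c u, c v) \<in> K"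
    and d: "d ` pverts H \<subseteq> R" "\<forall>(u, v) \<in> parcs H. (d u, d v) \<in> K"
  obtains e where "e ` (pverts G \<union> pverts H) \<subseteq> R"
    "\<And>u v. (u, v) \<in> parcs G \<union> parcs H \<Longrightarrow> (e u, e v) \<in> K"
    "\<And>v. v \<in> pverts G \<Longrightarrow> e v = c v" "\<And>v. v \<in> pverts H \<Longrightarrow> e v = d v"
proof -
  define e where "e v = (if v \<in> pverts G then c v else d v)" for v
  have eG: "e v = c v" if "v \<in> pverts G" for v using that by (simp add: e_def)
  have eH: "e v = d v" if "v \<in> pverts H" for v using that assms(3) by (auto simp: e_def)
  have 1: "(e u, e v) \<in> K" if "(u, v) \<in> parcs G" for u v
    using bspec[OF c(2) that] finite_msp[OF assms(1)] that eG[of u] eG[of v] by auto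
  have 2: "(e u, e v) \<in> K" if "(u, v) \<in> parcs H" for u v
    using bspec[OF d(2) that] finite_msp[OF assms(2)] that eH[of u] eH[of v] by auto
  have 3: "e ` (pverts G \<union> pverts H) \<subseteq> R"
    using c(1) d(1) eG eH by (auto simp: image_subset_iff)
  show thesis by (rule that[of e]) (use 1 2 3 eG eH in auto)
qed

subsection \<open>Seven colors suffice\<close>

text \<open>The quadratic residue tournament: \<open>j - i\<close> is a nonzero square modulo 7.\<close>

definition qr7 :: "(nat \<times> nat) set" where
  "qr7 = {(1, 2), (1, 3), (1, 5), (2, 3), (2, 4), (2, 6), (3, 4), (3, 5), (3, 7),
     (4, 5), (4, 6), (4, 1), (5, 6), (5, 7), (5, 2), (6, 7), (6, 1), (6, 3), (7, 1), (7, 2), (7, 4)}"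

lemma qr7_colors: "qr7 \<subseteq> {1..7} \<times> {1..7}"
  unfolding qr7_def by simp

lemma qr7_oriented: "(i, j) \<in> qr7 \<Longrightarrow> i \<noteq> j \<and> (j, i) \<notin> qr7"
proof -
  have "\<forall>(i, j) \<in> qr7. i \<noteq> j \<and> (j, i) \<notin> qr7" unfolding qr7_def by simp
  then show "(i, j) \<in> qr7 \<Longrightarrow> i \<noteq> j \<and> (j, i) \<notin> qr7" by auto
qed

text \<open>The midpoint modulo 7 works: one half is 4 modulo 7, which is itself a square, so half
  of a nonzero square is a nonzero square.\<close>

lemma qr7_transitive_triangle: "(i, k) \<in> qr7 \<Longrightarrow> \<exists>j. (i, j) \<in> qr7 \<and> (j, k) \<in> qr7"
proof -
  have "\<forall>(i, k) \<in> qr7. \<exists>j \<in> {1, 2, 3, 4, 5, 6, 7}. (i, j) \<in> qr7 \<and> (j, k) \<in> qr7"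
    unfolding qr7_def by simp
  then show "(i, k) \<in> qr7 \<Longrightarrow> \<exists>j. (i, j) \<in> qr7 \<and> (j, k) \<in> qr7" by fast
qed

text \<open>Induction works for sources of color \<open>i\<close> and sinks with colors in the in-neighborhood of \<open>k\<close>:
  in a series composition, the intermediate color \<open>j\<close> goes to the sources of the second factor.\<close>

lemma msp_hom_qr7:
  assumes "msp_digraph G" "(i, k) \<in> qr7"
  shows "\<exists>c. c ` pverts G \<subseteq> {1..7} \<and> (\<forall>(u, v) \<in> parcs G. (c u, c v) \<in> qr7) \<and>
    (\<forall>v \<in> sources G. c v = i) \<and> (\<forall>v \<in> sinks G. (c v, k) \<in> qr7)"
  using assms
proof (induction arbitrary: i k rule: msp_digraph.induct)
  case (single v)
  then show ?case by (intro exI[of _ "\<lambda>_. i"]) (use single qr7_colors in auto)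
next
  case (parallel G H)
  from parallel.IH(1)[OF parallel.prems] obtain c where c: "c ` pverts G \<subseteq> {1..7}"
    "\<forall>(u, v) \<in> parcs G. (c u, c v) \<in> qr7"
    "\<forall>v \<in> sources G. c v = i" "\<forall>v \<in> sinks G. (c v, k) \<in> qr7" by blast
  from parallel.IH(2)[OF parallel.prems] obtain d where d: "d ` pverts H \<subseteq> {1..7}"
    "\<forall>(u, v) \<in> parcs H. (d u, d v) \<in> qr7"
    "\<forall>v \<in> sources H. d v = i" "\<forall>v \<in> sinks H. (d v, k) \<in> qr7" by blast
  note wf = finite_msp[OF parallel.hyps(1)] finite_msp[OF parallel.hyps(2)]
  note sub = sources_sinks_subset[of G] sources_sinks_subset[of H]
  obtain e where e: "e ` (pverts G \<union> pverts H) \<subseteq> {1..7}"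
    "\<And>u v. (u, v) \<in> parcs G \<union> parcs H \<Longrightarrow> (e u, e v) \<in> qr7"
    "\<And>v. v \<in> pverts G \<Longrightarrow> e v = c v" "\<And>v. v \<in> pverts H \<Longrightarrow> e v = d v"
    using glue_homs[OF parallel.hyps c(1,2) d(1,2)] by blast
  have "e ` pverts (parallel_comp G H) \<subseteq> {1..7}" using e(1) by simp
  moreover have "(e u, e v) \<in> qr7" if "(u, v) \<in> parcs (parallel_comp G H)" for u v
  proof (cases "(u, v) \<in> parcs G \<union> parcs H")
    case False
    with that show ?thesis by simp
  qed (rule e(2))
  moreover have "\<forall>v \<in> sources (parallel_comp G H). e v = i"
    using c(3) d(3) e(3,4) sub unfolding parallel_sources_sinks[OF parallel.hyps] by auto
  moreover have "\<forall>v \<in> sinks (parallel_comp G H). (e v, k) \<in> qr7"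
    using c(4) d(4) e(3,4) sub unfolding parallel_sources_sinks[OF parallel.hyps] by auto
  ultimately show ?case by (intro exI[of _ e]) auto
next
  case (series G H)
  from qr7_transitive_triangle[OF series.prems] obtain j where j: "(i, j) \<in> qr7" "(j, k) \<in> qr7" by blast
  from series.IH(1)[OF j(1)] obtain c where c: "c ` pverts G \<subseteq> {1..7}"
    "\<forall>(u, v) \<in> parcs G. (c u, c v) \<in> qr7"
    "\<forall>v \<in> sources G. c v = i" "\<forall>v \<in> sinks G. (c v, j) \<in> qr7" by blast
  from series.IH(2)[OF j(2)] obtain d where d: "d ` pverts H \<subseteq> {1..7}"
    "\<forall>(u, v) \<in> parcs H. (d u, d v) \<in> qr7"
    "\<forall>v \<in> sources H. d v = j" "\<forall>v \<in> sinks H. (d v, k) \<in> qr7" by blast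
  note wf = finite_msp[OF series.hyps(1)] finite_msp[OF series.hyps(2)]
  note sub = sources_sinks_subset[of G] sources_sinks_subset[of H]
  obtain e where e: "e ` (pverts G \<union> pverts H) \<subseteq> {1..7}"
    "\<And>u v. (u, v) \<in> parcs G \<union> parcs H \<Longrightarrow> (e u, e v) \<in> qr7"
    "\<And>v. v \<in> pverts G \<Longrightarrow> e v = c v" "\<And>v. v \<in> pverts H \<Longrightarrow> e v = d v"
    using glue_homs[OF series.hyps c(1,2) d(1,2)] by blast
  have "e ` pverts (series_comp G H) \<subseteq> {1..7}" using e(1) by simp
  moreover have "(e u, e v) \<in> qr7" if "(u, v) \<in> parcs (series_comp G H)" for u v
  proof (cases "(u, v) \<in> parcs G \<union> parcs H")
    case False
    with that have uv: "u \<in> sinks G" "v \<in> sources H" by auto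
    with sub have "u \<in> pverts G" "v \<in> pverts H" by auto
    with uv show ?thesis using e(3)[of u] e(4)[of v] c(4) d(3) by simp
  qed (rule e(2))
  moreover have "\<forall>v \<in> sources (series_comp G H). e v = i"
    using c(3) d(3) e(3,4) sub unfolding series_sources_sinks[OF series.hyps] by auto
  moreover have "\<forall>v \<in> sinks (series_comp G H). (e v, k) \<in> qr7"
    using c(4) d(4) e(3,4) sub unfolding series_sources_sinks[OF series.hyps] by auto
  ultimately show ?case by (intro exI[of _ e]) auto
qed

subsection \<open>A finite algebra of colorings\<close>

type_synonym label = "(nat \<times> (nat \<times> nat) set \<times> nat set \<times> nat set) set"

definition oriented_targets :: "(nat \<times> (nat \<times> nat) set) set" where
  "oriented_targets =
     {(r, H). r \<le> 7 \<and> H \<subseteq> {1..r} \<times> {1..r} \<and> (\<forall>i j. (i, j) \<in> H \<longrightarrow> i \<noteq> j \<and> (j, i) \<notin> H)}"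

definition labels :: "label set" where
  "labels = Pow {(r, H, S, T). (r, H) \<in> oriented_targets \<and> S \<subseteq> {1..r} \<and> T \<subseteq> {1..r}}"

text \<open>\<open>H\<close> need not be the set of color pairs that occur on arcs. Allowing surplus
  pairs lets the two factors of a composition be colored over one common target.\<close>

definition hom_label :: "'a pair_pre_digraph \<Rightarrow> label" where
  "hom_label G = {(r, H, c ` sources G, c ` sinks G) | r H c.
     (r, H) \<in> oriented_targets \<and> c ` pverts G \<subseteq> {1..r} \<and> (\<forall>(u, v) \<in> parcs G. (c u, c v) \<in> H)}"

definition single_label :: label where
  "single_label = {(r, H, {i}, {i}) | r H i. (r, H) \<in> oriented_targets \<and> i \<in> {1..r}}"

text \<open>The same \<open>r\<close> and \<open>H\<close> are required on both sides, since
  colorings of disjoint digraphs still conflict if one uses a color pair and the other its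
  reverse.\<close>

definition par_label :: "label \<Rightarrow> label \<Rightarrow> label" where
  "par_label K L = {(r, H, S \<union> S', T \<union> T') | r H S T S' T'. (r, H, S, T) \<in> K \<and> (r, H, S', T') \<in> L}"

definition ser_label :: "label \<Rightarrow> label \<Rightarrow> label" where
  "ser_label K L = {(r, H, S, T') | r H S T S' T'. (r, H, S, T) \<in> K \<and> (r, H, S', T') \<in> L \<and> T \<times> S' \<subseteq> H}"

definition min_colors :: "label \<Rightarrow> nat" where
  "min_colors L = (LEAST r. \<exists>H S T. (r, H, S, T) \<in> L)"

lemma in_par_label:
  "(r, H, A, B) \<in> par_label K L \<longleftrightarrow>
    (\<exists>S T S' T'. A = S \<union> S' \<and> B = T \<union> T' \<and> (r, H, S, T) \<in> K \<and> (r, H, S', T') \<in> L)"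
  by (auto simp: par_label_def)

lemma in_ser_label:
  "(r, H, S, T) \<in> ser_label K L \<longleftrightarrow>
    (\<exists>A B. (r, H, S, A) \<in> K \<and> (r, H, B, T) \<in> L \<and> A \<times> B \<subseteq> H)"
  by (auto simp: ser_label_def)

lemma in_hom_label:
  "(r, H, S, T) \<in> hom_label G \<longleftrightarrow> (r, H) \<in> oriented_targets \<and>
    (\<exists>c. c ` pverts G \<subseteq> {1..r} \<and> (\<forall>(u, v) \<in> parcs G. (c u, c v) \<in> H) \<and>
         S = c ` sources G \<and> T = c ` sinks G)"
  by (auto simp: hom_label_def)

lemma label_eqI: "(\<And>r H S T. (r, H, S, T) \<in> K \<longleftrightarrow> (r, H, S, T) \<in> L) \<Longrightarrow> K = (L :: label)"
  by auto

lemma par_label_commute: "par_label K L = par_label L K"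
  by (rule label_eqI, unfold in_par_label) (metis Un_commute)

lemma par_label_assoc: "par_label (par_label K L) M = par_label K (par_label L M)"
proof (rule label_eqI)
  fix r H A B
  show "(r, H, A, B) \<in> par_label (par_label K L) M \<longleftrightarrow> (r, H, A, B) \<in> par_label K (par_label L M)"
  proof
    assume "(r, H, A, B) \<in> par_label (par_label K L) M"
    then obtain S T S' T' S'' T'' where AB: "A = S \<union> S' \<union> S''" "B = T \<union> T' \<union> T''"
      and m: "(r, H, S, T) \<in> K" "(r, H, S', T') \<in> L" "(r, H, S'', T'') \<in> M"
      unfolding in_par_label by auto
    have "(r, H, S' \<union> S'', T' \<union> T'') \<in> par_label L M" unfolding in_par_label using m by blast
    with m(1) AB show "(r, H, A, B) \<in> par_label K (par_label L M)"
      unfolding in_par_label[of _ _ _ _ K] by (metis Un_assoc)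
  next
    assume "(r, H, A, B) \<in> par_label K (par_label L M)"
    then obtain S T S' T' S'' T'' where AB: "A = S \<union> (S' \<union> S'')" "B = T \<union> (T' \<union> T'')"
      and m: "(r, H, S, T) \<in> K" "(r, H, S', T') \<in> L" "(r, H, S'', T'') \<in> M"
      unfolding in_par_label by auto
    have "(r, H, S \<union> S', T \<union> T') \<in> par_label K L" unfolding in_par_label using m by blast
    with m(3) AB show "(r, H, A, B) \<in> par_label (par_label K L) M"
      unfolding in_par_label[of _ _ _ _ _ M] by (metis Un_assoc)
  qed
qed

lemma ser_label_assoc: "ser_label (ser_label K L) M = ser_label K (ser_label L M)"
  by (rule label_eqI, unfold in_ser_label) metis

interpretation sp: sp_algebra par_label ser_label
  by unfold_locales (fact par_label_assoc par_label_commute ser_label_assoc)+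

lemma finite_labels: "finite labels"
proof -
  have "x \<in> {..7} \<times> Pow ({1..7} \<times> {1..7}) \<times> Pow {1..7} \<times> Pow {1..7}"
    if "x \<in> {(r, H, S, T). (r, H) \<in> oriented_targets \<and> S \<subseteq> {1..r} \<and> T \<subseteq> {1..r}}" for x
  proof -
    obtain r H S T where x: "x = (r, H, S, T)" by (cases x) auto
    with that have r: "r \<le> 7" and sub: "H \<subseteq> {1..r} \<times> {1..r}" "S \<subseteq> {1..r}" "T \<subseteq> {1..r}"
      by (simp_all add: oriented_targets_def)
    from r have "{1..r} \<subseteq> {1..7}" by simp
    from sub(1) Sigma_mono[OF this this] sub(2,3) this
    show ?thesis unfolding x using r by (simp only: mem_Times_iff fst_conv snd_conv Pow_iff) (blast intro: atMost_iff[THEN iffD2])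
  qed
  then have "labels \<subseteq> Pow ({..7} \<times> Pow ({1..7} \<times> {1..7}) \<times> Pow {1..7} \<times> Pow {1..7})"
    unfolding labels_def by (intro Pow_mono subsetI)
  then show ?thesis by (rule finite_subset) simp
qed

lemma single_label_in: "single_label \<in> labels"
  by (auto simp: labels_def single_label_def)

lemma par_label_in: "K \<in> labels \<Longrightarrow> L \<in> labels \<Longrightarrow> par_label K L \<in> labels"
  unfolding labels_def par_label_def by blast

lemma ser_label_in: "K \<in> labels \<Longrightarrow> L \<in> labels \<Longrightarrow> ser_label K L \<in> labels"
  unfolding labels_def ser_label_def by blast

lemma hom_label_single: "hom_label \<lparr>pverts = {v}, parcs = {}\<rparr> = single_label"
proof -
  have "\<exists>c. x = c v" for x :: nat and v :: 'a by (intro exI[of _ "\<lambda>_. x"]) simp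
  then show ?thesis unfolding hom_label_def single_label_def by auto
qed

lemma hom_label_parallel:
  assumes "msp_digraph G" "msp_digraph H" "pverts G \<inter> pverts H = {}"
  shows "hom_label (parallel_comp G H) = par_label (hom_label G) (hom_label H)"
proof (intro label_eqI iffI)
  fix r K S T assume "(r, K, S, T) \<in> hom_label (parallel_comp G H)"
  then obtain c where rK: "(r, K) \<in> oriented_targets"
    and c: "c ` pverts G \<subseteq> {1..r}" "c ` pverts H \<subseteq> {1..r}"
      "\<forall>(u, v) \<in> parcs G. (c u, c v) \<in> K" "\<forall>(u, v) \<in> parcs H. (c u, c v) \<in> K"
    and ST: "S = c ` sources G \<union> c ` sources H" "T = c ` sinks G \<union> c ` sinks H"
    unfolding in_hom_label parallel_sources_sinks[OF assms] parallel_simps image_Un by blast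
  have "(r, K, c ` sources G, c ` sinks G) \<in> hom_label G" "(r, K, c ` sources H, c ` sinks H) \<in> hom_label H"
    unfolding in_hom_label using rK c by auto
  with ST show "(r, K, S, T) \<in> par_label (hom_label G) (hom_label H)"
    unfolding in_par_label by metis
next
  fix r K S T assume "(r, K, S, T) \<in> par_label (hom_label G) (hom_label H)"
  then obtain c d where rK: "(r, K) \<in> oriented_targets"
    and ST: "S = c ` sources G \<union> d ` sources H" "T = c ` sinks G \<union> d ` sinks H"
    and c: "c ` pverts G \<subseteq> {1..r}" "\<forall>(u, v) \<in> parcs G. (c u, c v) \<in> K"
    and d: "d ` pverts H \<subseteq> {1..r}" "\<forall>(u, v) \<in> parcs H. (d u, d v) \<in> K"
    unfolding in_par_label in_hom_label by auto
  note sub = sources_sinks_subset[of G] sources_sinks_subset[of H]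
  obtain e where e: "e ` (pverts G \<union> pverts H) \<subseteq> {1..r}"
    "\<And>u v. (u, v) \<in> parcs G \<union> parcs H \<Longrightarrow> (e u, e v) \<in> K"
    "\<And>v. v \<in> pverts G \<Longrightarrow> e v = c v" "\<And>v. v \<in> pverts H \<Longrightarrow> e v = d v"
    using glue_homs[OF assms c(1,2) d(1,2)] by blast
  have "e ` pverts (parallel_comp G H) \<subseteq> {1..r}" using e(1) by simp
  moreover have "\<forall>(u, v) \<in> parcs (parallel_comp G H). (e u, e v) \<in> K" using e(2) by auto
  moreover have "e ` sources G = c ` sources G" "e ` sources H = d ` sources H"
      "e ` sinks G = c ` sinks G" "e ` sinks H = d ` sinks H"
    using e(3,4) sub by (auto intro!: image_cong)
  then have "S = e ` sources (parallel_comp G H)" "T = e ` sinks (parallel_comp G H)"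
    unfolding parallel_sources_sinks[OF assms] image_Un ST by simp_all
  ultimately show "(r, K, S, T) \<in> hom_label (parallel_comp G H)"
    unfolding in_hom_label using rK by blast
qed

lemma hom_label_series:
  assumes "msp_digraph G" "msp_digraph H" "pverts G \<inter> pverts H = {}"
  shows "hom_label (series_comp G H) = ser_label (hom_label G) (hom_label H)"
proof (intro label_eqI iffI)
  fix r K S T assume "(r, K, S, T) \<in> hom_label (series_comp G H)"
  then obtain c where rK: "(r, K) \<in> oriented_targets"
    and c: "c ` pverts G \<subseteq> {1..r}" "c ` pverts H \<subseteq> {1..r}"
      "\<forall>(u, v) \<in> parcs G. (c u, c v) \<in> K" "\<forall>(u, v) \<in> parcs H. (c u, c v) \<in> K"
      "\<forall>(u, v) \<in> sinks G \<times> sources H. (c u, c v) \<in> K"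
    and ST: "S = c ` sources G" "T = c ` sinks H"
    unfolding in_hom_label series_sources_sinks[OF assms] series_simps image_Un by blast
  have "(r, K, c ` sources G, c ` sinks G) \<in> hom_label G" "(r, K, c ` sources H, c ` sinks H) \<in> hom_label H"
    unfolding in_hom_label using rK c by auto
  moreover have "c ` sinks G \<times> c ` sources H \<subseteq> K" using c(5) by auto
  ultimately show "(r, K, S, T) \<in> ser_label (hom_label G) (hom_label H)"
    unfolding in_ser_label ST by metis
next
  fix r K S T assume "(r, K, S, T) \<in> ser_label (hom_label G) (hom_label H)"
  then obtain c d where rK: "(r, K) \<in> oriented_targets"
    and ST: "S = c ` sources G" "T = d ` sinks H" and cd: "c ` sinks G \<times> d ` sources H \<subseteq> K"
    and c: "c ` pverts G \<subseteq> {1..r}" "\<forall>(u, v) \<in> parcs G. (c u, c v) \<in> K"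
    and d: "d ` pverts H \<subseteq> {1..r}" "\<forall>(u, v) \<in> parcs H. (d u, d v) \<in> K"
    unfolding in_ser_label in_hom_label by auto
  note sub = sources_sinks_subset[of G] sources_sinks_subset[of H]
  obtain e where e: "e ` (pverts G \<union> pverts H) \<subseteq> {1..r}"
    "\<And>u v. (u, v) \<in> parcs G \<union> parcs H \<Longrightarrow> (e u, e v) \<in> K"
    "\<And>v. v \<in> pverts G \<Longrightarrow> e v = c v" "\<And>v. v \<in> pverts H \<Longrightarrow> e v = d v"
    using glue_homs[OF assms c(1,2) d(1,2)] by blast
  have "e ` pverts (series_comp G H) \<subseteq> {1..r}" using e(1) by simp
  moreover have "(e u, e v) \<in> K" if "u \<in> sinks G" "v \<in> sources H" for u v
  proof -
    from that sub have "e u = c u" "e v = d v" using e(3,4) by auto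
    with that cd show ?thesis by auto
  qed
  with e(2) have "\<forall>(u, v) \<in> parcs (series_comp G H). (e u, e v) \<in> K" by auto
  moreover have "e ` sources G = c ` sources G" "e ` sinks H = d ` sinks H"
    using e(3,4) sub by (auto intro!: image_cong)
  then have "S = e ` sources (series_comp G H)" "T = e ` sinks (series_comp G H)"
    unfolding series_sources_sinks[OF assms] ST by simp_all
  ultimately show "(r, K, S, T) \<in> hom_label (series_comp G H)"
    unfolding in_hom_label using rK by blast
qed

text \<open>An oriented coloring is a homomorphism to an oriented graph on the colors: the second
  coloring condition says that a color pair and its reverse never both occur. As a target one can
  take the pairs that occur on arcs.\<close>

lemma hom_label_iff_coloring:
  assumes "msp_digraph G" "r \<le> 7"
  shows "(\<exists>H S T. (r, H, S, T) \<in> hom_label G) \<longleftrightarrow> (\<exists>c. oriented_coloring G r c)"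
proof
  assume "\<exists>H S T. (r, H, S, T) \<in> hom_label G"
  then obtain H c where H: "(r, H) \<in> oriented_targets" and c: "c ` pverts G \<subseteq> {1..r}"
    "\<forall>(u, v) \<in> parcs G. (c u, c v) \<in> H" unfolding in_hom_label by blast
  have "oriented_coloring G r c"
    unfolding oriented_coloring_def
  proof (intro conjI)
    show "c \<in> pverts G \<rightarrow> {1..r}" using c(1) by auto
    show "\<forall>(u, v) \<in> parcs G. c u \<noteq> c v" using H c(2) by (fastforce simp: oriented_targets_def)
    show "\<forall>(u, v) \<in> parcs G. \<forall>(x, y) \<in> parcs G. c v = c x \<longrightarrow> c u \<noteq> c y"
    proof (clarify)
      fix u v x y assume "(u, v) \<in> parcs G" "(x, y) \<in> parcs G" and eq: "c v = c x" "c u = c y"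
      with c(2) have "(c u, c v) \<in> H" "(c x, c y) \<in> H" by auto
      with eq H show False by (auto simp: oriented_targets_def)
    qed
  qed
  then show "\<exists>c. oriented_coloring G r c" by blast
next
  assume "\<exists>c. oriented_coloring G r c"
  then obtain c where c: "oriented_coloring G r c" by blast
  define H where "H = (\<lambda>(u, v). (c u, c v)) ` parcs G"
  have "(r, H) \<in> oriented_targets"
  proof -
    have "H \<subseteq> {1..r} \<times> {1..r}"
      using c finite_msp[OF assms(1)] unfolding oriented_coloring_def H_def by auto
    moreover have "i \<noteq> j \<and> (j, i) \<notin> H" if "(i, j) \<in> H" for i j
    proof -
      from that obtain u v where uv: "(u, v) \<in> parcs G" "i = c u" "j = c v" unfolding H_def by auto
      have "c u \<noteq> c y" if "(x, y) \<in> parcs G" "c v = c x" for x y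
        using c uv(1) that unfolding oriented_coloring_def by blast
      moreover have "c u \<noteq> c v" using c uv(1) unfolding oriented_coloring_def by blast
      ultimately show ?thesis using uv unfolding H_def by fastforce
    qed
    ultimately show ?thesis using assms(2) unfolding oriented_targets_def by blast
  qed
  moreover have "c ` pverts G \<subseteq> {1..r}" using c by (auto simp: oriented_coloring_def)
  moreover have "\<forall>(u, v) \<in> parcs G. (c u, c v) \<in> H" by (auto simp: H_def)
  ultimately show "\<exists>H S T. (r, H, S, T) \<in> hom_label G" unfolding in_hom_label by blast
qed

lemma msp_coloring_7:
  assumes "msp_digraph G"
  shows "\<exists>H S T. (7, H, S, T) \<in> hom_label G"
proof -
  have "(1, 2) \<in> qr7" by (simp add: qr7_def)
  from msp_hom_qr7[OF assms this] obtain c where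
    "c ` pverts G \<subseteq> {1..7}" "\<forall>(u, v) \<in> parcs G. (c u, c v) \<in> qr7" by blast
  moreover have "(7, qr7) \<in> oriented_targets"
    using qr7_oriented qr7_colors by (simp add: oriented_targets_def)
  ultimately show ?thesis unfolding in_hom_label by blast
qed

text \<open>The labels know about targets with at most seven vertices only, so the two predicates
  under LEAST agree just up to 7. Since both hold at 7, their least elements lie in the range of
  agreement.\<close>

lemma oriented_chromatic_number_msp:
  assumes "msp_digraph G"
  shows "oriented_chromatic_number G = min_colors (hom_label G)"
proof -
  note 7 = msp_coloring_7[OF assms]
  define P where "P r \<longleftrightarrow> (\<exists>H S T. (r, H, S, T) \<in> hom_label G)" for r
  define Q where "Q r \<longleftrightarrow> (\<exists>c. oriented_coloring G r c)" for r
  have PQ: "P r \<longleftrightarrow> Q r" if "r \<le> 7" for r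
    using hom_label_iff_coloring[OF assms that] by (simp add: P_def Q_def)
  have P7: "P 7" using 7 by (simp add: P_def)
  then have "Q 7" using PQ by simp
  have "Least P \<le> 7" "Least Q \<le> 7" using P7 \<open>Q 7\<close> by (auto intro: Least_le)
  moreover have "P (Least P)" "Q (Least Q)" using P7 \<open>Q 7\<close> by (auto intro: LeastI)
  ultimately have "Least Q \<le> Least P" "Least P \<le> Least Q"
    using PQ by (auto intro!: Least_le)
  then have "Least Q = Least P" by simp
  then show ?thesis by (simp add: oriented_chromatic_number_def min_colors_def P_def[abs_def] Q_def[abs_def])
qed

lemma min_colors_le_7: "msp_digraph G \<Longrightarrow> min_colors (hom_label G) \<le> 7"
  unfolding min_colors_def by (rule Least_le) (rule msp_coloring_7)

section \<open>The multigraph of blocks\<close>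

text \<open>
  Vertices become arcs of the multigraph, and complete bipartite blocks become nodes. A block is
  named after the largest number of a vertex on its right-hand side.
\<close>

definition head_block :: "('a \<Rightarrow> nat) \<Rightarrow> nat \<Rightarrow> 'a pair_pre_digraph \<Rightarrow> 'a \<Rightarrow> nat" where
  "head_block f b G v =
     (if v \<in> sinks G then b else Suc (Max (f ` {w. (v, w) \<in> parcs G})))"

definition tail_block :: "('a \<Rightarrow> nat) \<Rightarrow> nat \<Rightarrow> 'a pair_pre_digraph \<Rightarrow> 'a \<Rightarrow> nat" where
  "tail_block f a G v =
     (if v \<in> sources G then a
      else Suc (Max (f ` {w. \<exists>u. (u, v) \<in> parcs G \<and> (u, w) \<in> parcs G})))"

definition block_graph ::
  "('a \<Rightarrow> nat) \<Rightarrow> nat \<Rightarrow> nat \<Rightarrow> 'a pair_pre_digraph \<Rightarrow> (nat \<times> nat \<times> label) multiset" where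
  "block_graph f a b G =
     image_mset (\<lambda>v. (tail_block f a G v, head_block f b G v, single_label)) (mset_set (pverts G))"

lemma block_graph_union:
  assumes "msp_digraph G" "msp_digraph H" "pverts G \<inter> pverts H = {}" "pverts K = pverts G \<union> pverts H"
    and "\<And>v. v \<in> pverts G \<Longrightarrow> tail_block f a K v = tail_block f a1 G v \<and> head_block f b K v = head_block f b1 G v"
    and "\<And>v. v \<in> pverts H \<Longrightarrow> tail_block f a K v = tail_block f a2 H v \<and> head_block f b K v = head_block f b2 H v"
  shows "block_graph f a b K = block_graph f a1 b1 G + block_graph f a2 b2 H"
proof -
  have fin: "finite (pverts G)" "finite (pverts H)" using finite_msp assms(1,2) by auto
  have "mset_set (pverts K) = mset_set (pverts G) + mset_set (pverts H)"
    unfolding assms(4) using fin assms(3) by (rule mset_set_Union)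
  moreover have "image_mset (\<lambda>v. (tail_block f a K v, head_block f b K v, single_label)) (mset_set (pverts G))
      = block_graph f a1 b1 G"
    unfolding block_graph_def using fin assms(5) by (intro image_mset_cong) auto
  moreover have "image_mset (\<lambda>v. (tail_block f a K v, head_block f b K v, single_label)) (mset_set (pverts H))
      = block_graph f a2 b2 H"
    unfolding block_graph_def using fin assms(6) by (intro image_mset_cong) auto
  ultimately show ?thesis unfolding block_graph_def[of f a b K] by simp
qed

lemma disjoint_Suc_image:
  assumes "f ` A \<inter> f ` B = {}" "J1 \<subseteq> Suc ` f ` (A - C)" "J2 \<subseteq> Suc ` f ` (B - D)"
  shows "J1 \<inter> J2 = {}"
proof -
  have "Suc ` f ` A \<inter> Suc ` f ` B = {}"
    using assms(1) by (simp add: image_Int[symmetric])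
  moreover have "J1 \<subseteq> Suc ` f ` A" "J2 \<subseteq> Suc ` f ` B"
    using assms(2,3) image_mono[of "f ` (A - C)" "f ` A" Suc] image_mono[of "f ` (B - D)" "f ` B" Suc]
      image_mono[of "A - C" A f] image_mono[of "B - D" B f] by (meson Diff_subset subset_trans)+
  ultimately have "J1 \<inter> J2 \<subseteq> {}" by (metis Int_mono)
  then show ?thesis by simp
qed

text \<open>The terminals are arbitrary in the induction, because the block between two series
  factors is the sink of the first and the source of the second. An inner block is named after a
  vertex on its right-hand side, hence after a vertex that is not a source; this keeps the names in
  the two factors and those of the terminals apart.\<close>

lemma ttsp_block_graph:
  assumes "msp_digraph G" "inj_on f (pverts G)" "a \<noteq> b"
    "{a, b} \<inter> Suc ` f ` (pverts G - sources G) = {}"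
  shows "\<exists>J \<subseteq> Suc ` f ` (pverts G - sources G). sp.ttsp (block_graph f a b G) J a b (hom_label G)"
  using assms
proof (induction arbitrary: a b rule: msp_digraph.induct)
  case (single v)
  have "block_graph f a b \<lparr>pverts = {v}, parcs = {}\<rparr> = {#(a, b, single_label)#}"
    by (simp add: block_graph_def tail_block_def head_block_def)
  then show ?case using single.prems(2) by (auto simp: hom_label_single intro: sp.ttsp.edge)
next
  case (parallel G H)
  note hyps = parallel.hyps
  have G: "x \<in> pverts G \<and> y \<in> pverts G" if "(x, y) \<in> parcs G" for x y
    using finite_msp[OF hyps(1)] that by blast
  have H: "x \<in> pverts H \<and> y \<in> pverts H" if "(x, y) \<in> parcs H" for x y
    using finite_msp[OF hyps(2)] that by blast
  note sub = sources_sinks_subset[of G] sources_sinks_subset[of H]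
  note ss = parallel_sources_sinks[OF hyps]
  let ?K = "parallel_comp G H"
  have nG: "v \<notin> pverts H" if "v \<in> pverts G" for v using that hyps(3) by auto
  have nH: "v \<notin> pverts G" if "v \<in> pverts H" for v using that hyps(3) by auto
  have KG: "(u, v) \<in> parcs ?K \<longleftrightarrow> (u, v) \<in> parcs G" if "u \<in> pverts G \<or> v \<in> pverts G" for u v
    using that H[of u v] nG[of u] nG[of v] by auto
  have KH: "(u, v) \<in> parcs ?K \<longleftrightarrow> (u, v) \<in> parcs H" if "u \<in> pverts H \<or> v \<in> pverts H" for u v
    using that G[of u v] nH[of u] nH[of v] by auto
  have tG: "tail_block f a ?K v = tail_block f a G v \<and> head_block f b ?K v = head_block f b G v"
    if v: "v \<in> pverts G" for v
  proof -
    have "{w. (v, w) \<in> parcs ?K} = {w. (v, w) \<in> parcs G}" using KG v by auto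
    moreover have "(u, v) \<in> parcs ?K \<and> (u, w) \<in> parcs ?K \<longleftrightarrow> (u, v) \<in> parcs G \<and> (u, w) \<in> parcs G" for u w
      using KG[of u v] KG[of u w] G[of u v] v by blast
    moreover have "v \<in> sources ?K \<longleftrightarrow> v \<in> sources G" "v \<in> sinks ?K \<longleftrightarrow> v \<in> sinks G"
      unfolding ss using sub nG[OF v] by auto
    ultimately show ?thesis unfolding tail_block_def head_block_def by simp
  qed
  have tH: "tail_block f a ?K v = tail_block f a H v \<and> head_block f b ?K v = head_block f b H v"
    if v: "v \<in> pverts H" for v
  proof -
    have "{w. (v, w) \<in> parcs ?K} = {w. (v, w) \<in> parcs H}" using KH v by auto
    moreover have "(u, v) \<in> parcs ?K \<and> (u, w) \<in> parcs ?K \<longleftrightarrow> (u, v) \<in> parcs H \<and> (u, w) \<in> parcs H" for u w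
      using KH[of u v] KH[of u w] H[of u v] v by blast
    moreover have "v \<in> sources ?K \<longleftrightarrow> v \<in> sources H" "v \<in> sinks ?K \<longleftrightarrow> v \<in> sinks H"
      unfolding ss using sub nH[OF v] by auto
    ultimately show ?thesis unfolding tail_block_def head_block_def by simp
  qed
  have union: "block_graph f a b ?K = block_graph f a b G + block_graph f a b H"
    using hyps by (rule block_graph_union) (use tG tH in simp_all)
  have inj: "inj_on f (pverts G)" "inj_on f (pverts H)"
    using parallel.prems(1) by (auto simp: inj_on_Un)
  have dis: "{a, b} \<inter> Suc ` f ` (pverts G - sources G) = {}" "{a, b} \<inter> Suc ` f ` (pverts H - sources H) = {}"
    and KJ: "Suc ` f ` (pverts ?K - sources ?K) = Suc ` f ` (pverts G - sources G) \<union> Suc ` f ` (pverts H - sources H)"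
  proof -
    have "pverts ?K - sources ?K = (pverts G - sources G) \<union> (pverts H - sources H)"
      unfolding ss using sub nG nH by auto
    then show "Suc ` f ` (pverts ?K - sources ?K) =
      Suc ` f ` (pverts G - sources G) \<union> Suc ` f ` (pverts H - sources H)" by (simp only: image_Un)
    with parallel.prems(3) show "{a, b} \<inter> Suc ` f ` (pverts G - sources G) = {}"
      "{a, b} \<inter> Suc ` f ` (pverts H - sources H) = {}" by auto
  qed
  from parallel.IH(1)[OF inj(1) parallel.prems(2) dis(1)] obtain J1 where
    J1: "J1 \<subseteq> Suc ` f ` (pverts G - sources G)" "sp.ttsp (block_graph f a b G) J1 a b (hom_label G)" by blast
  from parallel.IH(2)[OF inj(2) parallel.prems(2) dis(2)] obtain J2 where
    J2: "J2 \<subseteq> Suc ` f ` (pverts H - sources H)" "sp.ttsp (block_graph f a b H) J2 a b (hom_label H)" by blast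
  have "f ` pverts G \<inter> f ` pverts H = {}"
    using inj_on_image_Int[OF parallel.prems(1), of "pverts G" "pverts H"] hyps(3) by simp
  then have "J1 \<inter> J2 = {}" using J1(1) J2(1) by (rule disjoint_Suc_image)
  from sp.ttsp.par[OF J1(2) J2(2) this] Un_mono[OF J1(1) J2(1)] show ?case
    unfolding union hom_label_parallel[OF hyps] KJ by (intro exI[of _ "J1 \<union> J2"] conjI)
next
  case (series G H)
  note hyps = series.hyps
  have G: "x \<in> pverts G \<and> y \<in> pverts G \<and> x \<notin> sinks G" if "(x, y) \<in> parcs G" for x y
    using finite_msp[OF hyps(1)] msp_sinks[OF hyps(1)] that by blast
  have H: "x \<in> pverts H \<and> y \<in> pverts H \<and> y \<notin> sources H" if "(x, y) \<in> parcs H" for x y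
    using finite_msp[OF hyps(2)] msp_sources[OF hyps(2)] that by blast
  note sub = sources_sinks_subset[of G] sources_sinks_subset[of H]
  note ss = series_sources_sinks[OF hyps]
  let ?K = "series_comp G H"
  \<comment> \<open>The one new block joins the sinks of \<open>G\<close> to the sources of
    \<open>H\<close>. Its name stems from the sources of \<open>H\<close>, which are no longer
    sources in the composition and have named no block inside \<open>H\<close>.\<close>
  define c where "c = Suc (Max (f ` sources H))"
  have nG: "v \<notin> pverts H" if "v \<in> pverts G" for v using that hyps(3) by auto
  have nH: "v \<notin> pverts G" if "v \<in> pverts H" for v using that hyps(3) by auto
  have ne: "sinks G \<noteq> {}" "sources H \<noteq> {}" using sources_sinks_nonempty hyps by auto
  have KG: "(u, v) \<in> parcs ?K \<longleftrightarrow> (u, v) \<in> parcs G" if "v \<in> pverts G \<or> u \<in> pverts G - sinks G" for u v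
    using that H[of u v] nG[of u] nG[of v] sub by auto
  have KH: "(u, v) \<in> parcs ?K \<longleftrightarrow> (u, v) \<in> parcs H" if "u \<in> pverts H \<or> v \<in> pverts H - sources H" for u v
    using that G[of u v] nH[of u] nH[of v] sub by auto
  have KS: "(u, v) \<in> parcs ?K \<longleftrightarrow> v \<in> sources H" if "u \<in> sinks G" for u v
    using that G[of u v] H[of u v] sub nG[of u] by auto
  have KT: "(u, v) \<in> parcs ?K \<longleftrightarrow> u \<in> sinks G" if "v \<in> sources H" for u v
    using that G[of u v] H[of u v] sub nH[of v] by auto
  have tG: "tail_block f a ?K v = tail_block f a G v \<and> head_block f b ?K v = head_block f c G v"
    if v: "v \<in> pverts G" for v
  proof
    have "(u, v) \<in> parcs ?K \<and> (u, w) \<in> parcs ?K \<longleftrightarrow> (u, v) \<in> parcs G \<and> (u, w) \<in> parcs G" for u w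
      using KG[of v u] KG[of w u] G[of u v] v by blast
    then show "tail_block f a ?K v = tail_block f a G v" unfolding tail_block_def ss by simp
    have "v \<notin> sinks H" using sub nG[OF v] by auto
    show "head_block f b ?K v = head_block f c G v"
    proof (cases "v \<in> sinks G")
      case True
      then have "{w. (v, w) \<in> parcs ?K} = sources H" using KS by blast
      with True \<open>v \<notin> sinks H\<close> show ?thesis unfolding head_block_def ss c_def by simp
    next
      case False
      then have "{w. (v, w) \<in> parcs ?K} = {w. (v, w) \<in> parcs G}" using KG v by blast
      with False \<open>v \<notin> sinks H\<close> show ?thesis unfolding head_block_def ss by simp
    qed
  qed
  have tH: "tail_block f a ?K v = tail_block f c H v \<and> head_block f b ?K v = head_block f b H v"
    if v: "v \<in> pverts H" for v
  proof
    have "{w. (v, w) \<in> parcs ?K} = {w. (v, w) \<in> parcs H}" using KH v by blast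
    then show "head_block f b ?K v = head_block f b H v" unfolding head_block_def ss by simp
    have "v \<notin> sources G" using sub nH[OF v] by auto
    show "tail_block f a ?K v = tail_block f c H v"
    proof (cases "v \<in> sources H")
      case True
      have "(\<exists>u. (u, v) \<in> parcs ?K \<and> (u, w) \<in> parcs ?K) \<longleftrightarrow> w \<in> sources H" for w
        using KT[OF True] KS[of _ w] ne(1) by blast
      with True \<open>v \<notin> sources G\<close> show ?thesis unfolding tail_block_def ss c_def by simp
    next
      case False
      have "(u, v) \<in> parcs ?K \<and> (u, w) \<in> parcs ?K \<longleftrightarrow> (u, v) \<in> parcs H \<and> (u, w) \<in> parcs H" for u w
        using KH[of u v] KH[of u w] H[of u v] v False by blast
      with False \<open>v \<notin> sources G\<close> show ?thesis unfolding tail_block_def ss by simp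
    qed
  qed
  have union: "block_graph f a b ?K = block_graph f a c G + block_graph f c b H"
    using hyps by (rule block_graph_union) (use tG tH in simp_all)
  have inj: "inj_on f (pverts G)" "inj_on f (pverts H)"
    using series.prems(1) by (auto simp: inj_on_Un)
  have fdis: "f ` pverts G \<inter> f ` pverts H = {}"
    using inj_on_image_Int[OF series.prems(1), of "pverts G" "pverts H"] hyps(3) by simp
  have "finite (sources H)" using finite_msp[OF hyps(2)] sub finite_subset by blast
  then have "Max (f ` sources H) \<in> f ` sources H" using ne by simp
  then obtain x where x: "x \<in> sources H" "c = Suc (f x)" unfolding c_def by auto
  have KJ: "pverts ?K - sources ?K = (pverts G - sources G) \<union> pverts H"
    unfolding ss using sub nH by auto
  have SK: "Suc ` f ` (pverts ?K - sources ?K) = Suc ` f ` (pverts G - sources G) \<union> Suc ` f ` pverts H"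
    unfolding KJ image_Un ..
  have xH: "x \<in> pverts H" using x sub by auto
  then have "c \<in> Suc ` f ` pverts H" using x(2) by auto
  with series.prems(3) have ac: "a \<noteq> c" "c \<noteq> b" unfolding SK by auto
  have c1: "c \<notin> Suc ` f ` (pverts G - sources G)" using fdis xH x(2) by auto
  have c2: "c \<notin> Suc ` f ` (pverts H - sources H)" using inj_on_image_mem_iff[OF inj(2) xH, of "pverts H - sources H"] x by auto
  have d1: "{a, c} \<inter> Suc ` f ` (pverts G - sources G) = {}" using series.prems(3) c1 unfolding SK by auto
  have d2: "{c, b} \<inter> Suc ` f ` (pverts H - sources H) = {}" using series.prems(3) c2 unfolding SK by auto
  from series.IH(1)[OF inj(1) ac(1) d1] obtain J1 where
    J1: "J1 \<subseteq> Suc ` f ` (pverts G - sources G)" "sp.ttsp (block_graph f a c G) J1 a c (hom_label G)" by blast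
  from series.IH(2)[OF inj(2) ac(2) d2] obtain J2 where
    J2: "J2 \<subseteq> Suc ` f ` (pverts H - sources H)" "sp.ttsp (block_graph f c b H) J2 c b (hom_label H)" by blast
  have "J1 \<inter> J2 = {}" using fdis J1(1) J2(1) by (rule disjoint_Suc_image)
  moreover have "a \<notin> J2" "b \<notin> J1" using series.prems(3) J1(1) J2(1) unfolding SK by auto
  ultimately have "sp.ttsp (block_graph f a b ?K) (insert c (J1 \<union> J2)) a b (hom_label ?K)"
    unfolding union hom_label_series[OF hyps]
    by (intro sp.ttsp.ser[OF J1(2) J2(2)] series.prems(2))
  moreover have "insert c (J1 \<union> J2) \<subseteq> Suc ` f ` (pverts ?K - sources ?K)"
    unfolding SK using J1(1) J2(1) \<open>c \<in> Suc ` f ` pverts H\<close> by auto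
  ultimately show ?case by (intro exI[of _ "insert c (J1 \<union> J2)"] conjI)
qed

text \<open>By \<open>msp_bipartite_blocks\<close>, all predecessors of \<open>v\<close> have the
  same successors. Hence any single arc into \<open>v\<close> reveals its tail block, which is how
  the program finds it.\<close>

lemma tail_block_arc:
  assumes "msp_digraph G" "(u, v) \<in> parcs G"
  shows "tail_block f a G v = head_block f b G u"
proof -
  have "v \<notin> sources G" "u \<notin> sinks G" using assms(2) msp_sources[OF assms(1)] msp_sinks[OF assms(1)] by auto
  moreover have "(\<exists>u. (u, v) \<in> parcs G \<and> (u, w) \<in> parcs G) \<longleftrightarrow> (u, w) \<in> parcs G" for w
    using msp_bipartite_blocks[OF assms(1)] assms(2) by blast
  ultimately show ?thesis unfolding tail_block_def head_block_def by simp
qed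

section \<open>Contracting the multigraph\<close>

text \<open>Any numbering will do: codes enter the program as constants and table entries only, so
  labels never have to be coded at run time.\<close>

definition label_code :: "label \<Rightarrow> nat" where
  "label_code = (SOME h. bij_betw h labels {0..<card labels})"

definition code_label :: "nat \<Rightarrow> label" where
  "code_label = inv_into labels label_code"

lemma label_code_bij: "bij_betw label_code labels {0..<card labels}"
  unfolding label_code_def using ex_bij_betw_finite_nat[OF finite_labels] by (rule someI_ex)

lemma label_code_less: "L \<in> labels \<Longrightarrow> label_code L < card labels"
  using bij_betwE[OF label_code_bij] by auto

lemma code_label_inverse [simp]: "L \<in> labels \<Longrightarrow> code_label (label_code L) = L"
  unfolding code_label_def using bij_betw_imp_inj_on[OF label_code_bij] by (rule inv_into_f_f)

lemma code_label_in: "i < card labels \<Longrightarrow> code_label i \<in> labels"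
  unfolding code_label_def using bij_betw_imp_surj_on[OF label_code_bij] by (auto intro: inv_into_into)

definition par_code :: "nat \<Rightarrow> nat \<Rightarrow> nat" where
  "par_code i j = label_code (par_label (code_label i) (code_label j))"

definition ser_code :: "nat \<Rightarrow> nat \<Rightarrow> nat" where
  "ser_code i j = label_code (ser_label (code_label i) (code_label j))"

lemma par_code:
  assumes "i < card labels" "j < card labels"
  shows "par_code i j < card labels" "code_label (par_code i j) = par_label (code_label i) (code_label j)"
  using assms by (simp_all add: par_code_def label_code_less par_label_in code_label_in)

lemma ser_code:
  assumes "i < card labels" "j < card labels"
  shows "ser_code i j < card labels" "code_label (ser_code i j) = ser_label (code_label i) (code_label j)"
  using assms by (simp_all add: ser_code_def label_code_less ser_label_in code_label_in)

text \<open>Vertex \<open>v\<close> is an arc from block \<open>tb v\<close> to block \<open>hb v\<close>; block \<open>0\<close> is the target and block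
  \<open>Suc n\<close> the source.\<close>

locale block_multigraph =
  fixes n :: nat and hb tb :: "nat \<Rightarrow> nat" and J :: "nat set" and L :: label
  assumes ttsp_blocks:
    "sp.ttsp (image_mset (\<lambda>v. (tb v, hb v, single_label)) (mset_set {..<n})) J (Suc n) 0 L"
begin

abbreviation "src \<equiv> Suc n"

abbreviation "vertex_arcs A \<equiv> image_mset (\<lambda>v. (tb v, hb v, single_label)) A"

end

text \<open>Positions grow from the target towards the source, and \<open>vs\<close> is consumed
  from its end. So all arcs into a block are treated before any arc out of it, and by
  \<open>pos_inj\<close> the arcs into one block are consecutive.\<close>

locale block_order = block_multigraph +
  fixes vs :: "nat list" and pos :: "nat \<Rightarrow> nat"
  assumes distinct_vs: "distinct vs" and set_vs: "set vs = {..<n}"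
    and pos_sorted: "i \<le> j \<Longrightarrow> j < n \<Longrightarrow> pos (hb (vs ! i)) \<le> pos (hb (vs ! j))"
    and pos_inj: "u < n \<Longrightarrow> v < n \<Longrightarrow> pos (hb u) = pos (hb v) \<Longrightarrow> hb u = hb v"
    and pos_tail: "v < n \<Longrightarrow> pos (hb v) < pos (tb v)"
    and pos_0: "pos 0 = 0"
begin

abbreviation "tree_arcs pa la Y \<equiv> image_mset (\<lambda>y. (pa y, y, code_label (la y))) (mset_set Y)"

abbreviation "current_arcs x ac S \<equiv> image_mset (\<lambda>w. (w, x, code_label (ac w))) (mset_set S)"

lemma length_vs: "length vs = n"
  using distinct_card[OF distinct_vs] set_vs by simp

lemma vs_nth: "i < n \<Longrightarrow> vs ! i < n"
  using set_vs length_vs nth_mem by fastforce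

text \<open>
  The arcs entering the blocks \<open>hb (vs ! (n - 1)), \<dots>, hb (vs ! i)\<close> have been treated, the last
  one of these blocks is \<open>x\<close>. What is left of the graph consists of a tree on \<open>Y\<close> rooted
  at the source, with \<open>pa\<close> giving parents and \<open>la\<close> labels; at most one arc from each element of
  \<open>S\<close> to \<open>x\<close>; the untreated arcs; and the arcs \<open>Z\<close> that are being moved. Elements
  of \<open>R\<close> may have a single outgoing arc left.
\<close>

definition contracted ::
  "nat \<Rightarrow> nat \<Rightarrow> (nat \<times> nat \<times> label) multiset \<Rightarrow> nat set \<Rightarrow> (nat \<Rightarrow> nat) \<Rightarrow> (nat \<Rightarrow> nat) \<Rightarrow>
   (nat \<Rightarrow> nat) \<Rightarrow> (nat \<Rightarrow> nat) \<Rightarrow> (nat \<Rightarrow> nat) \<Rightarrow> nat set \<Rightarrow> nat set \<Rightarrow>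
   (nat \<times> nat \<times> label) multiset \<Rightarrow> nat set \<Rightarrow> bool" where
  "contracted i x Z R st ac cn pa la Y S X I \<longleftrightarrow>
     X = tree_arcs pa la Y +
         current_arcs x ac S +
         vertex_arcs (mset (take i vs)) + Z \<and>
     sp.ttsp X I src 0 L \<and> finite Y \<and> finite S \<and> i \<le> n \<and> I \<subseteq> J \<and>
     Y \<subseteq> I \<and> S \<subseteq> insert src Y \<and>
     (\<forall>u \<in> insert src Y. u \<in> S \<longleftrightarrow> st u = Suc x) \<and>
     (\<forall>u \<in> insert src I. cn u = outdeg X u) \<and>
     (\<forall>u \<in> S - R. u = src \<or> 2 \<le> cn u) \<and>
     (\<forall>y \<in> Y. pa y \<in> insert src Y \<and> la y < card labels) \<and>
     (\<forall>u \<in> S. ac u < card labels) \<and>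
     (\<forall>u. st u \<noteq> 0 \<longrightarrow> (\<exists>j. i \<le> j \<and> j < n \<and> st u = Suc (hb (vs ! j)))) \<and>
     (i < n \<longrightarrow> x = hb (vs ! i) \<and> (\<forall>y \<in> Y. pos x < pos y)) \<and>
     (i = n \<longrightarrow> S = {} \<and> Y = {})"

lemma contractedD:
  assumes "contracted i x Z R st ac cn pa la Y S X I"
  shows contracted_graph: "X = tree_arcs pa la Y +
         current_arcs x ac S +
         vertex_arcs (mset (take i vs)) + Z"
    and contracted_ttsp: "sp.ttsp X I src 0 L"
    and contracted_finite: "finite Y" "finite S"
    and contracted_outdeg: "u \<in> insert src I \<Longrightarrow> cn u = outdeg X u"
    and contracted_cn: "u \<in> S \<Longrightarrow> u \<notin> R \<Longrightarrow> u = src \<or> 2 \<le> cn u"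
    and contracted_ac: "u \<in> S \<Longrightarrow> ac u < card labels"
    and contracted_S: "S \<subseteq> insert src Y" and contracted_Y: "Y \<subseteq> I"
    and contracted_pos: "i < n \<Longrightarrow> y \<in> Y \<Longrightarrow> pos x < pos y"
proof -
  note c = assms[unfolded contracted_def]
  from c show "X = tree_arcs pa la Y +
         current_arcs x ac S +
         vertex_arcs (mset (take i vs)) + Z"
    by (elim conjE)
  from c show "sp.ttsp X I src 0 L" by (elim conjE)
  from c show "finite Y" by (elim conjE)
  from c show "finite S" by (elim conjE)
  from c show "S \<subseteq> insert src Y" by (elim conjE)
  from c show "Y \<subseteq> I" by (elim conjE)
  from c have "\<forall>u \<in> insert src I. cn u = outdeg X u" by (elim conjE)
  then show "u \<in> insert src I \<Longrightarrow> cn u = outdeg X u" by (rule bspec)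
  from c have "\<forall>u \<in> S - R. u = src \<or> 2 \<le> cn u" by (elim conjE)
  then show "u \<in> S \<Longrightarrow> u \<notin> R \<Longrightarrow> u = src \<or> 2 \<le> cn u" by blast
  from c have "\<forall>u \<in> S. ac u < card labels" by (elim conjE)
  then show "u \<in> S \<Longrightarrow> ac u < card labels" by (rule bspec)
  from c have "i < n \<longrightarrow> x = hb (vs ! i) \<and> (\<forall>y \<in> Y. pos x < pos y)" by (elim conjE)
  then show "i < n \<Longrightarrow> y \<in> Y \<Longrightarrow> pos x < pos y" by blast
qed

lemma contracted_init:
  assumes "\<And>u. st u = 0" "\<And>u. cn u = card {v. v < n \<and> tb v = u}"
  shows "contracted n x {#} {} st ac cn pa la {} {} (vertex_arcs (mset_set {..<n})) J"
proof -
  have "mset (take n vs) = mset_set {..<n}"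
    using length_vs distinct_vs set_vs by (simp add: mset_set_set[symmetric])
  moreover have "outdeg (vertex_arcs (mset_set {..<n})) u = cn u" for u
    unfolding outdeg_def filter_mset_image_mset assms(2)
    by (simp add: comp_def filter_mset_mset_set conj_commute lessThan_def)
  ultimately show ?thesis
    unfolding contracted_def using ttsp_blocks assms(1) by simp
qed

text \<open>The moved arc is parallel to a recorded one and is merged with it. This costs
  \<open>w\<close> one outgoing arc and may leave it with a single one, whence the exception set
  \<open>{w}\<close>.\<close>

lemma contracted_place_old:
  assumes "contracted i x {#(w, x, code_label l)#} {} st ac cn pa la Y S X I" "w \<in> S" "l < card labels"
  shows "\<exists>X'. contracted i x {#} {w} st (ac(w := par_code (ac w) l)) (cn(w := cn w - 1)) pa la Y S X' I"
proof -
  note c = assms(1)[unfolded contracted_def]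
  from c have finS: "finite S" and acS: "\<And>u. u \<in> S \<Longrightarrow> ac u < card labels" by auto
  define B where "B = tree_arcs pa la Y +
         current_arcs x ac (S - {w}) +
         vertex_arcs (mset (take i vs))"
  have S: "mset_set S = add_mset w (mset_set (S - {w}))"
    using finS assms(2) by (rule mset_set.remove)
  have X: "X = add_mset (w, x, code_label (ac w)) (add_mset (w, x, code_label l) B)"
    using c unfolding B_def S by simp
  define X' where "X' = add_mset (w, x, code_label (par_code (ac w) l)) B"
  have X'_eq: "X' = tree_arcs pa la Y +
         image_mset (\<lambda>u. (u, x, code_label ((ac(w := par_code (ac w) l)) u))) (mset_set S) +
         vertex_arcs (mset (take i vs)) + {#}"
  proof -
    have "image_mset (\<lambda>u. (u, x, code_label ((ac(w := par_code (ac w) l)) u))) (mset_set (S - {w}))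
        = current_arcs x ac (S - {w})"
      using finS by (intro image_mset_cong) auto
    then show ?thesis unfolding X'_def B_def S by simp
  qed
  have "sp.ttsp X' I src 0 L"
    unfolding X'_def par_code(2)[OF acS[OF assms(2)] assms(3)]
    using c X by (intro sp.ttsp_merge_parallel[of X]) auto
  moreover have "outdeg X' u = (cn(w := cn w - 1)) u" if "u \<in> insert src I" for u
  proof -
    have "cn u = outdeg X u" using c that by blast
    then show ?thesis unfolding X X'_def by (cases "u = w") auto
  qed
  ultimately show ?thesis
    using c X'_eq par_code(1)[OF acS[OF assms(2)] assms(3)]
    by (intro exI[of _ X']) (auto simp: contracted_def)
qed

text \<open>The multigraph stays the same; the moved arc is merely recorded. It may be the only arc
  leaving \<open>w\<close>, so \<open>w\<close> is again an exception.\<close>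

lemma contracted_place_new:
  assumes "contracted i x {#(w, x, code_label l)#} {} st ac cn pa la Y S X I"
    "w \<in> insert src Y" "w \<notin> S" "l < card labels" "i < n"
  shows "contracted i x {#} {w} (st(w := Suc x)) (ac(w := l)) cn pa la Y (insert w S) X I"
proof -
  note c = assms(1)[unfolded contracted_def]
  from c have finS: "finite S" by auto
  have "image_mset (\<lambda>u. (u, x, code_label ((ac(w := l)) u))) (mset_set (insert w S)) =
      add_mset (w, x, code_label l) (current_arcs x ac S)"
  proof -
    have "image_mset (\<lambda>u. (u, x, code_label ((ac(w := l)) u))) (mset_set S) =
        current_arcs x ac S"
      using assms(3) finS by (intro image_mset_cong) auto
    then show ?thesis using assms(3) finS by simp
  qed
  then have "X = tree_arcs pa la Y +
         image_mset (\<lambda>u. (u, x, code_label ((ac(w := l)) u))) (mset_set (insert w S)) +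
         vertex_arcs (mset (take i vs)) + {#}"
    using c by simp
  moreover have "\<exists>j. i \<le> j \<and> j < n \<and> x = hb (vs ! j)" using c assms(5) by auto
  ultimately show ?thesis unfolding contracted_def using c assms(2-5) by auto
qed

text \<open>The entries of \<open>pa\<close> and \<open>la\<close> at \<open>x\<close> are
  provisional: \<open>x\<close> is not in the tree yet, and a later arc into \<open>x\<close>
  overwrites them.\<close>

lemma contracted_stop:
  assumes "contracted i x {#} {w} st ac cn pa la Y S X I" "w \<in> S" "w = src \<or> 2 \<le> cn w" "i < n"
  shows "contracted i x {#} {} st ac cn (pa(x := w)) (la(x := ac w)) Y S X I"
proof -
  note c = assms(1)[unfolded contracted_def]
  have x: "x \<notin> Y" using c assms(4) by auto
  then have "image_mset (\<lambda>y. ((pa(x := w)) y, y, code_label ((la(x := ac w)) y))) (mset_set Y)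
      = tree_arcs pa la Y"
    using c by (intro image_mset_cong) auto
  then show ?thesis unfolding contracted_def using c assms(2,3) x by auto
qed

lemma untreated_pos: "i < n \<Longrightarrow> v \<in> set (take i vs) \<Longrightarrow> pos (hb v) \<le> pos (hb (vs ! i))"
  using pos_sorted by (auto simp: in_set_conv_nth length_vs)

text \<open>Only the tree arc enters \<open>w\<close>: the current and the untreated arcs have heads
  at positions up to that of \<open>x\<close>, while tree nodes lie beyond. After the contraction
  the parent has lost its arc to \<open>w\<close> and gained one to \<open>x\<close>, so all
  remaining counters \<open>cn\<close> stay correct. The new arc may be parallel to a recorded one,
  so it becomes the moved arc.\<close>

lemma contracted_step:
  assumes "contracted i x {#} {w} st ac cn pa la Y S X I" "w \<in> S" "w \<noteq> src" "cn w < 2" "i < n"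
  shows "\<exists>X'. contracted i x {#(pa w, x, code_label (ser_code (la w) (ac w)))#} {}
            st ac cn pa la (Y - {w}) (S - {w}) X' (I - {w}) \<and> pa w \<in> insert src (Y - {w})"
proof -
  note c = assms(1)[unfolded contracted_def]
  from c have fin: "finite Y" "finite S" and wY: "w \<in> Y" and wI: "w \<in> I" using assms(2,3) by auto
  from c have t: "sp.ttsp X I src 0 L" by auto
  have codes: "la w < card labels" "ac w < card labels" using c wY assms(2) by auto
  have posY: "\<And>y. y \<in> Y \<Longrightarrow> pos x < pos y" and x: "x = hb (vs ! i)" using c assms(5) by auto
  define B where "B = tree_arcs pa la (Y - {w}) +
         current_arcs x ac (S - {w}) +
         vertex_arcs (mset (take i vs))"
  have Y: "mset_set Y = add_mset w (mset_set (Y - {w}))" using fin(1) wY by (rule mset_set.remove)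
  have S: "mset_set S = add_mset w (mset_set (S - {w}))" using fin(2) assms(2) by (rule mset_set.remove)
  have X: "X = add_mset (pa w, w, code_label (la w)) (add_mset (w, x, code_label (ac w)) B)"
    using c unfolding B_def Y S by simp
  have "(pa w, w, code_label (la w)) \<in># X" unfolding X by simp
  from sp.ttsp_edgeD[OF t this] have paw: "pa w \<noteq> w" by simp
  have "cn w = outdeg X w" using c wI by blast
  with assms(4) paw have out: "outdeg B w = 0" unfolding X by simp
  have "(u, w, l) \<notin># B" for u l
  proof
    assume "(u, w, l) \<in># B"
    then consider "w = x" | v where "v \<in> set (take i vs)" "hb v = w"
      unfolding B_def using fin by auto
    then show False
    proof cases
      case 1
      then show False using posY[OF wY] by simp
    next
      case 2
      then show False using posY[OF wY] untreated_pos[OF assms(5) 2(1)] x by simp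
    qed
  qed
  then have "indeg B w = 0" unfolding indeg_eq_0_iff by blast
  from sp.ttsp_contract[OF t X wI this out]
  have t': "sp.ttsp (add_mset (pa w, x, code_label (ser_code (la w) (ac w))) B) (I - {w}) src 0 L"
    unfolding ser_code(2)[OF codes] .
  define X' where "X' = add_mset (pa w, x, code_label (ser_code (la w) (ac w))) B"
  have deg: "cn u = outdeg X' u" if "u \<in> insert src (I - {w})" for u
  proof -
    have "cn u = outdeg X u" using c that by blast
    then show ?thesis using that assms(3) unfolding X X'_def by auto
  qed
  \<comment> \<open>The only arc leaving \<open>w\<close> goes to \<open>x\<close>, so
    \<open>w\<close> has no children and its removal leaves a tree.\<close>
  have pa: "pa y \<noteq> w" if "y \<in> Y - {w}" for y
  proof
    assume "pa y = w"
    then have "(w, y, code_label (la y)) \<in># B" unfolding B_def using that fin by auto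
    then show False using out unfolding outdeg_eq_0_iff by blast
  qed
  have "contracted i x {#(pa w, x, code_label (ser_code (la w) (ac w)))#} {}
            st ac cn pa la (Y - {w}) (S - {w}) X' (I - {w})"
    unfolding contracted_def using c assms(3,5) t' deg pa unfolding X'_def B_def by auto
  moreover have "pa w \<in> insert src (Y - {w})" using c wY paw by auto
  ultimately show ?thesis by blast
qed

lemma contracted_heads:
  assumes "contracted i x {#} {} st ac cn pa la Y S X I" "(u, y, l) \<in># X"
  shows "y \<in> Y \<or> y = x \<and> u \<in> S \<or> (\<exists>v \<in> set (take i vs). y = hb v \<and> u = tb v)"
  using assms(2) contracted_finite[OF assms(1)] unfolding contracted_graph[OF assms(1)]
  by (fastforce simp only: union_iff set_image_mset image_iff finite_set_mset_mset_set set_mset_mset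
      prod.inject empty_not_add_mset set_mset_empty empty_iff)

text \<open>Once no untreated arc enters \<open>x\<close>, all arcs into it are recorded in
  \<open>S\<close>: one for each tail, and with an empty exception set every tail is the source or
  has two outgoing arcs.\<close>

lemma contracted_reduced:
  assumes "contracted i x {#} {} st ac cn pa la Y S X I" "i < n"
    and "\<And>v. v \<in> set (take i vs) \<Longrightarrow> hb v \<noteq> x"
  shows "sp.reduced_at X src x"
  unfolding sp.reduced_at_def
proof (intro conjI allI impI)
  note fin = contracted_finite[OF assms(1)]
  have xY: "x \<notin> Y" using contracted_pos[OF assms(1,2)] by auto
  fix u
  have tree: "{#e \<in># tree_arcs pa la Y. fst e = u \<and> fst (snd e) = x#} = {#}"
    using xY fin by auto
  have pend: "{#e \<in># vertex_arcs (mset (take i vs)). fst e = u \<and> fst (snd e) = x#} = {#}"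
    using assms(3) by auto
  have "{#e \<in># X. fst e = u \<and> fst (snd e) = x#} =
      image_mset (\<lambda>w. (w, x, code_label (ac w))) {#w \<in># mset_set S. w = u#}"
    unfolding contracted_graph[OF assms(1)] filter_union_mset tree pend by (simp add: filter_mset_image_mset)
  moreover have "size {#w \<in># mset_set S. w = u#} \<le> 1"
  proof -
    have "{w \<in> S. w = u} \<subseteq> {u}" by auto
    then have "card {w \<in> S. w = u} \<le> card {u}" by (intro card_mono) simp_all
    then show ?thesis using fin(2) by (simp add: filter_mset_mset_set)
  qed
  ultimately show "size {#e \<in># X. fst e = u \<and> fst (snd e) = x#} \<le> 1" by simp
  fix k assume e: "(u, x, k) \<in># X"
  from contracted_heads[OF assms(1) e] xY assms(3) have uS: "u \<in> S" by auto
  have "u \<in> insert src I" using sp.ttsp_edgeD[OF contracted_ttsp[OF assms(1)] e] by simp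
  then have "cn u = outdeg X u" by (rule contracted_outdeg[OF assms(1)])
  moreover have "u = src \<or> 2 \<le> cn u" using contracted_cn[OF assms(1) uS] by simp
  ultimately show "u = src \<or> 2 \<le> outdeg X u" by simp
qed

lemma contracted_arc_in:
  assumes "contracted i x {#} {} st ac cn pa la Y S X I" "w \<in> S"
  shows "(w, x, code_label (ac w)) \<in># X"
  unfolding contracted_graph[OF assms(1)] using assms(2) contracted_finite[OF assms(1)] by simp

lemma contracted_singleton:
  assumes "contracted i x {#} {} st ac cn pa la Y S X I" "i < n" "w \<in> S"
    and "\<And>v. v \<in> set (take i vs) \<Longrightarrow> hb v \<noteq> x"
  shows "S = {w}"
proof -
  note t = contracted_ttsp[OF assms(1)]
  from sp.ttsp_edgeD[OF t contracted_arc_in[OF assms(1,3)]] have "x = 0 \<or> x \<in> I" by simp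
  from sp.reduced_at_indeg[OF t contracted_reduced[OF assms(1,2,4)] this]
  have "indeg X x = 1" .
  moreover have "indeg (current_arcs x ac S) x = card S"
    unfolding indeg_def filter_mset_image_mset by simp
  moreover have "indeg X x \<ge> indeg (current_arcs x ac S) x"
    unfolding contracted_graph[OF assms(1)] by simp
  ultimately have "card S \<le> Suc 0" by simp
  then have "u = w" if "u \<in> S" for u
    using that assms(3) unfolding card_le_Suc0_iff_eq[OF contracted_finite(2)[OF assms(1)]] by blast
  with assms(3) show ?thesis by blast
qed

text \<open>When the arcs into \<open>x\<close> are exhausted, reducedness leaves a single one, which joins the tree.\<close>

lemma contracted_close:
  assumes "contracted i x {#} {} st ac cn pa la Y S X I" "i < n" "pa x \<in> S" "la x = ac (pa x)" "x \<noteq> 0"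
    and "\<And>v. v \<in> set (take i vs) \<Longrightarrow> hb v \<noteq> x"
  shows "x \<notin> Y" "x \<in> I" "pa x \<in> insert src Y" "la x < card labels" "S = {pa x}"
    "X = tree_arcs pa la (insert x Y) + vertex_arcs (mset (take i vs))"
proof -
  note c = assms(1)[unfolded contracted_def]
  from c have fin: "finite Y" and t: "sp.ttsp X I src 0 L" by auto
  show xY: "x \<notin> Y" using c assms(2) by auto
  show "S = {pa x}" using contracted_singleton[OF assms(1,2,3,6)] .
  with c assms(4) have X: "X = tree_arcs pa la Y +
         {#(pa x, x, code_label (la x))#} +
         vertex_arcs (mset (take i vs))" by simp
  then show "X = tree_arcs pa la (insert x Y) +
         vertex_arcs (mset (take i vs))" using xY fin by simp
  have "(pa x, x, code_label (la x)) \<in># X" unfolding X by simp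
  from sp.ttsp_edgeD[OF t this] assms(5) show "x \<in> I" by simp
  show "pa x \<in> insert src Y" "la x < card labels" using c assms(3,4) by auto
qed

text \<open>If \<open>v\<close> starts a new block, the finished block \<open>x\<close> becomes a
  tree node and \<open>S\<close> is emptied; this accounts for the possible growth of
  \<open>Y\<close> by one. Otherwise, within the same block or at the very start, only an untreated
  arc becomes the moved one.\<close>

lemma contracted_fetch:
  assumes "contracted i x {#} {} st ac cn pa la Y S X I" "0 < i" "i < n \<Longrightarrow> pa x \<in> S \<and> la x = ac (pa x)"
    and v: "v = vs ! (i - 1)"
  shows "\<exists>Y' S'. contracted (i - 1) (hb v) {#(tb v, hb v, single_label)#} {} st ac cn pa la Y' S' X I \<and>
    tb v \<in> insert src Y' \<and> card Y' \<le> Suc (card Y)"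
proof -
  note c = assms(1)[unfolded contracted_def]
  from c have fin: "finite Y" "finite S" and t: "sp.ttsp X I src 0 L" and "i \<le> n" by auto
  have i1: "i - 1 < n" using \<open>0 < i\<close> \<open>i \<le> n\<close> by simp
  have vn: "v < n" using vs_nth[OF i1] v by simp
  have take: "take i vs = take (i - 1) vs @ [v]"
    using take_Suc_conv_app_nth[of "i - 1" vs] i1 \<open>0 < i\<close> v length_vs by simp
  have vt: "v \<in> set (take i vs)" using take by simp
  have st_later: "\<exists>j. i - 1 \<le> j \<and> j < n \<and> st u = Suc (hb (vs ! j))" if "st u \<noteq> 0" for u
  proof -
    from c that obtain j where "i \<le> j" "j < n" "st u = Suc (hb (vs ! j))" by blast
    then show ?thesis by (intro exI[of _ j]) auto
  qed
  have tbI: "tb v \<in> insert src I"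
  proof -
    have "(tb v, hb v, single_label) \<in># X" using c vt by auto
    from sp.ttsp_edgeD[OF t this] show ?thesis by simp
  qed
  have pend_pos: "pos (hb u) \<le> pos (hb v)" if "u \<in> set (take i vs)" for u
  proof -
    from that obtain j where "j < i" "u = vs ! j" by (auto simp: in_set_conv_nth length_vs)
    then show ?thesis using pos_sorted[of j "i - 1"] i1 v by simp
  qed
  \<comment> \<open>Every untreated arc has its head at a position below that of
    \<open>tb v\<close>. So an arc into \<open>tb v\<close>, which exists unless this is the source,
    has been treated already and ends in the tree or in the block just finished.\<close>
  have tail_cases: "tb v = src \<or> tb v \<in> Y \<or> tb v = x \<and> i < n"
  proof (cases "tb v = src")
    case False
    then have "tb v \<in> I" using tbI by simp
    then have "indeg X (tb v) > 0" using sp.ttsp_indeg_pos[OF t] by simp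
    then obtain u l where e: "(u, tb v, l) \<in># X" using indeg_eq_0_iff[of X "tb v"] by auto
    from contracted_heads[OF assms(1) e] show ?thesis
    proof (elim disjE bexE conjE)
      fix u' assume u': "u' \<in> set (take i vs)" "tb v = hb u'"
      then show ?thesis using pend_pos[OF u'(1)] pos_tail[OF vn] by simp
    next
      assume "tb v = x" "u \<in> S"
      then show ?thesis using c \<open>i \<le> n\<close> by (cases "i = n") auto
    qed simp
  qed simp
  show ?thesis
  proof (cases "i < n \<and> hb v \<noteq> x")
    case True
    then have "i < n" "hb v \<noteq> x" by auto
    have x: "x = hb (vs ! i)" and posY: "\<And>y. y \<in> Y \<Longrightarrow> pos x < pos y" using c \<open>i < n\<close> by auto
    \<comment> \<open>Equal positions would mean equal blocks, so the new block is strictly closer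
      to the target.\<close>
    have lt: "pos (hb v) < pos x"
      using untreated_pos[OF \<open>i < n\<close> vt] pos_inj[OF vn vs_nth[OF \<open>i < n\<close>]] \<open>hb v \<noteq> x\<close> x by fastforce
    have no_x: "hb u \<noteq> x" if "u \<in> set (take i vs)" for u using pend_pos[OF that] lt by auto
    have x0: "x \<noteq> 0" using lt pos_0 by (cases "x = 0") auto
    from assms(3)[OF \<open>i < n\<close>] have pax: "pa x \<in> S" "la x = ac (pa x)" by auto
    note close = contracted_close[OF assms(1) \<open>i < n\<close> pax x0 no_x]
    \<comment> \<open>Stamps left over belong to blocks at the position of \<open>x\<close> or
      beyond. None can be mistaken for the stamp of the new block, so \<open>S\<close> becomes empty
      without any clearing.\<close>
    have st_new: "st u \<noteq> Suc (hb v)" for u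
    proof
      assume "st u = Suc (hb v)"
      with c obtain j where j: "i \<le> j" "j < n" "st u = Suc (hb (vs ! j))" by (metis nat.distinct(1))
      with \<open>st u = Suc (hb v)\<close> have "hb v = hb (vs ! j)" by simp
      with pos_sorted[OF j(1,2)] lt x show False by simp
    qed
    have "contracted (i - 1) (hb v) {#(tb v, hb v, single_label)#} {} st ac cn pa la (insert x Y) {} X I"
      unfolding contracted_def
    proof (intro conjI)
      show "X = tree_arcs pa la (insert x Y) +
        image_mset (\<lambda>w. (w, hb v, code_label (ac w))) (mset_set {}) +
        vertex_arcs (mset (take (i - 1) vs)) + {#(tb v, hb v, single_label)#}"
        using close(6) take by simp
      show "\<forall>u \<in> insert src (insert x Y). u \<in> {} \<longleftrightarrow> st u = Suc (hb v)" using st_new by auto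
      show "i - 1 < n \<longrightarrow> hb v = hb (vs ! (i - 1)) \<and> (\<forall>y \<in> insert x Y. pos (hb v) < pos y)"
        using v lt posY by fastforce
      show "\<forall>y \<in> insert x Y. pa y \<in> insert src (insert x Y) \<and> la y < card labels"
        using close(3,4) c by auto
      show "\<forall>u. st u \<noteq> 0 \<longrightarrow> (\<exists>j\<ge>i - 1. j < n \<and> st u = Suc (hb (vs ! j)))" using st_later by blast
      show "i - 1 = n \<longrightarrow> {} = {} \<and> insert x Y = {}" using i1 by simp
      show "\<forall>u\<in>insert src I. cn u = outdeg X u" using c by blast
    qed (use t fin i1 close(2) c in auto)
    moreover have "tb v \<in> insert src (insert x Y)" using tail_cases by auto
    moreover have "card (insert x Y) \<le> Suc (card Y)" using fin(1) by (simp add: card_insert_if)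
    ultimately show ?thesis by blast
  next
    case False
    have S_eq: "current_arcs x ac S =
        image_mset (\<lambda>w. (w, hb v, code_label (ac w))) (mset_set S)"
      using False c \<open>i \<le> n\<close> by (cases "i = n") auto
    have stS: "\<forall>u \<in> insert src Y. u \<in> S \<longleftrightarrow> st u = Suc (hb v)"
    proof (cases "i = n")
      case True
      have "st u = 0" for u
      proof (rule ccontr)
        assume "st u \<noteq> 0"
        with c obtain j where "i \<le> j" "j < n" by blast
        with True show False by simp
      qed
      then show ?thesis using c True by simp
    next
      case False': False
      with False \<open>i \<le> n\<close> have "hb v = x" by simp
      then show ?thesis using c by blast
    qed
    have posY: "\<forall>y \<in> Y. pos (hb v) < pos y" using False c \<open>i \<le> n\<close> by (cases "i = n") auto
    have "contracted (i - 1) (hb v) {#(tb v, hb v, single_label)#} {} st ac cn pa la Y S X I"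
      unfolding contracted_def
    proof (intro conjI)
      show "X = tree_arcs pa la Y +
        image_mset (\<lambda>w. (w, hb v, code_label (ac w))) (mset_set S) +
        vertex_arcs (mset (take (i - 1) vs)) + {#(tb v, hb v, single_label)#}"
        using c take S_eq by simp
      show "\<forall>u \<in> insert src Y. u \<in> S \<longleftrightarrow> st u = Suc (hb v)" by (rule stS)
      show "i - 1 < n \<longrightarrow> hb v = hb (vs ! (i - 1)) \<and> (\<forall>y \<in> Y. pos (hb v) < pos y)"
        using v posY by simp
      show "\<forall>u. st u \<noteq> 0 \<longrightarrow> (\<exists>j\<ge>i - 1. j < n \<and> st u = Suc (hb (vs ! j)))" using st_later by blast
      show "i - 1 = n \<longrightarrow> S = {} \<and> Y = {}" using i1 by simp
      show "\<forall>u\<in>insert src I. cn u = outdeg X u" using c by blast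
    qed (use t fin i1 c in auto)
    moreover have "tb v \<in> insert src Y"
    proof -
      have "tb v \<noteq> x" if "i < n" using that False pos_tail[OF vn] by auto
      with tail_cases show ?thesis by auto
    qed
    ultimately show ?thesis by fastforce
  qed
qed

text \<open>Some arc enters the target, which is not in the tree, so the current block must be the
  target. As no untreated arc is left, the multigraph is reduced at its sink and hence a single arc,
  whose label is \<open>L\<close>.\<close>

lemma contracted_finish:
  assumes "contracted 0 x {#} {} st ac cn pa la Y S X I" "0 < n" "pa x \<in> S" "la x = ac (pa x)"
  shows "x = 0" "la 0 < card labels" "L = code_label (la 0)"
proof -
  note fin = contracted_finite[OF assms(1)] and t = contracted_ttsp[OF assms(1)]
  note ends = sp.ttsp_terminals[OF t]
  have "indeg X 0 > 0" using sp.ttsp_indeg_pos[OF t] by simp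
  then obtain u l where e: "(u, 0, l) \<in># X" using indeg_eq_0_iff[of X 0] by auto
  have "0 \<notin> Y" using contracted_Y[OF assms(1)] ends by auto
  with contracted_heads[OF assms(1) e] show x: "x = 0" by auto
  show "la 0 < card labels" using contracted_ac[OF assms(1,3)] assms(4) x by simp
  have "sp.reduced_at X src x" using contracted_reduced[OF assms(1,2)] by simp
  with x sp.reduced_at_sink[OF t] have X: "X = {#(src, 0, L)#}" by simp
  then show "L = code_label (la 0)" using contracted_arc_in[OF assms(1,3)] x assms(4) by auto
qed

end

text \<open>The block names in terms of the list of arcs alone. The inserted \<open>0\<close> sends
  sinks to the target block; all other heads lie between 1 and \<open>n\<close> because of
  \<open>Suc\<close>, which leaves \<open>Suc n\<close> free for the source.\<close>

locale block_input = block_multigraph +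
  fixes es :: "(nat \<times> nat) list"
  assumes n_pos: "0 < n" and arcs_bounded: "set es \<subseteq> {..<n} \<times> {..<n}"
    and hb_eq: "u < n \<Longrightarrow> hb u = Max (insert 0 (Suc ` {v. (u, v) \<in> set es}))"
    and tb_arc: "(u, v) \<in> set es \<Longrightarrow> tb v = hb u"
    and tb_source: "v < n \<Longrightarrow> (\<And>u. (u, v) \<notin> set es) \<Longrightarrow> tb v = src"
begin

lemma finite_heads: "finite {v. (u, v) \<in> set (take i es)}"
  by (rule finite_subset[of _ "snd ` set es"]) (auto dest: in_set_takeD intro: rev_image_eqI)

lemma hb_le:
  assumes "u < n"
  shows "hb u \<le> n"
proof -
  have "finite {v. (u, v) \<in> set es}" using finite_heads[of u "length es"] by simp
  moreover have "Suc ` {v. (u, v) \<in> set es} \<subseteq> {..n}" using arcs_bounded by auto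
  ultimately show ?thesis unfolding hb_eq[OF assms] by (subst Max_le_iff) auto
qed

lemma hb_pos:
  assumes "(u, v) \<in> set es"
  shows "0 < hb u"
proof -
  have "u < n" using assms arcs_bounded by auto
  moreover have "finite {v. (u, v) \<in> set es}" using finite_heads[of u "length es"] by simp
  then have "Suc v \<le> Max (insert 0 (Suc ` {v. (u, v) \<in> set es}))" using assms by (intro Max_ge) auto
  ultimately show ?thesis using hb_eq[of u] by simp
qed

lemma tb_bounds:
  assumes "v < n"
  shows "0 < tb v" "tb v \<le> src"
proof -
  have "0 < tb v \<and> tb v \<le> src"
  proof (cases "\<exists>u. (u, v) \<in> set es")
    case True
    then obtain u where u: "(u, v) \<in> set es" by blast
    then have "u < n" using arcs_bounded by auto
    then show ?thesis using tb_arc[OF u] hb_pos[OF u] hb_le[of u] by simp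
  next
    case False
    then show ?thesis using tb_source[OF assms] by simp
  qed
  then show "0 < tb v" "tb v \<le> src" by auto
qed

lemma block_arc:
  "v < n \<Longrightarrow> (tb v, hb v, single_label) \<in># vertex_arcs (mset_set {..<n})"
  by simp

lemma block_successor:
  assumes "v < n" "hb v \<noteq> 0"
  shows "\<exists>v' < n. tb v' = hb v"
proof -
  let ?X = "vertex_arcs (mset_set {..<n})"
  from sp.ttsp_edgeD[OF ttsp_blocks block_arc[OF assms(1)]] assms(2) have "hb v \<in> J" by simp
  then have "outdeg ?X (hb v) > 0" using sp.ttsp_outdeg_pos[OF ttsp_blocks] by simp
  then obtain y l where "(hb v, y, l) \<in># ?X" using outdeg_eq_0_iff[of ?X "hb v"] by auto
  then show ?thesis by auto
qed

subsection \<open>Ordering the blocks\<close>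

text \<open>
  Kahn's algorithm, run from the target: \<open>Q\<close> lists the blocks discovered so far, the first \<open>qh\<close> of
  them have been visited, \<open>E\<close> lists the arcs emitted so far, and \<open>R\<close> is the rest of the list of arcs
  into the block under visit.
\<close>

definition kahn :: "nat \<Rightarrow> nat list \<Rightarrow> nat list \<Rightarrow> nat list \<Rightarrow> (nat \<Rightarrow> nat) \<Rightarrow> bool" where
  "kahn qh Q E R dn \<longleftrightarrow>
     distinct Q \<and> set Q \<subseteq> {..src} \<and> qh \<le> length Q \<and> Q \<noteq> [] \<and> Q ! 0 = 0 \<and>
     distinct E \<and> distinct R \<and> set E \<inter> set R = {} \<and>
     set E \<union> set R = {v. v < n \<and> hb v \<in> set (take qh Q)} \<and>
     (\<forall>v \<in> set R. hb v = Q ! (qh - 1)) \<and> (R \<noteq> [] \<longrightarrow> 0 < qh) \<and>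
     (\<forall>u. dn u = card {v \<in> set E. tb v = u}) \<and>
     set Q = insert 0 {u. (\<exists>v < n. tb v = u) \<and> (\<forall>v < n. tb v = u \<longrightarrow> v \<in> set E)} \<and>
     (\<forall>i j. i \<le> j \<longrightarrow> j < length E \<longrightarrow>
        (\<exists>a b. a \<le> b \<and> b < qh \<and> hb (E ! i) = Q ! a \<and> hb (E ! j) = Q ! b)) \<and>
     (\<forall>b v. b < length Q \<longrightarrow> v < n \<longrightarrow> tb v = Q ! b \<longrightarrow> (\<exists>a < b. hb v = Q ! a))"

lemma kahnD:
  assumes "kahn qh Q E R dn"
  shows kahn_queue: "distinct Q" "set Q \<subseteq> {..src}" "qh \<le> length Q" "Q \<noteq> []" "Q ! 0 = 0"
    and kahn_distinct: "distinct E" "distinct R" "set E \<inter> set R = {}"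
    and kahn_arcs: "set E \<union> set R = {v. v < n \<and> hb v \<in> set (take qh Q)}"
    and "\<forall>v \<in> set R. hb v = Q ! (qh - 1)" "R \<noteq> [] \<longrightarrow> 0 < qh"
    and kahn_count: "\<forall>u. dn u = card {v \<in> set E. tb v = u}"
    and "set Q = insert 0 {u. (\<exists>v < n. tb v = u) \<and> (\<forall>v < n. tb v = u \<longrightarrow> v \<in> set E)}"
    and "\<forall>i j. i \<le> j \<longrightarrow> j < length E \<longrightarrow>
        (\<exists>a b. a \<le> b \<and> b < qh \<and> hb (E ! i) = Q ! a \<and> hb (E ! j) = Q ! b)"
    and "\<forall>b v. b < length Q \<longrightarrow> v < n \<longrightarrow> tb v = Q ! b \<longrightarrow> (\<exists>a < b. hb v = Q ! a)"
  by (insert assms, unfold kahn_def, (elim conjE, assumption)+)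

lemma kahn_init: "kahn 0 [0] [] [] (\<lambda>_. 0)"
  unfolding kahn_def using tb_bounds(1) by auto

lemma kahn_E:
  assumes "kahn qh Q E R dn"
  shows "set E \<subseteq> {..<n}" "set R \<subseteq> {..<n}" "length E + length R \<le> n" "length Q \<le> n + 2"
proof -
  have ER: "set E \<union> set R \<subseteq> {..<n}" and d: "distinct E" "distinct R" "set E \<inter> set R = {}"
    and Q: "distinct Q" "set Q \<subseteq> {..src}"
    using kahn_arcs[OF assms] kahn_distinct[OF assms] kahn_queue[OF assms] by auto
  then show "set E \<subseteq> {..<n}" "set R \<subseteq> {..<n}" by auto
  have "distinct (E @ R)" using d by simp
  then have "length (E @ R) = card (set E \<union> set R)" using distinct_card[of "E @ R"] by simp
  also have "\<dots> \<le> card {..<n}" using ER by (intro card_mono) auto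
  finally show "length E + length R \<le> n" by simp
  have "length Q = card (set Q)" using distinct_card[OF Q(1)] by simp
  also have "\<dots> \<le> card {..src}" using Q(2) by (intro card_mono) auto
  finally show "length Q \<le> n + 2" by simp
qed

lemma kahn_pop:
  assumes "kahn qh Q E [] dn" "qh < length Q" "distinct R" "set R = {v. v < n \<and> hb v = Q ! qh}"
  shows "kahn (Suc qh) Q E R dn"
proof -
  note D = kahnD[OF assms(1)]
  have take: "set (take (Suc qh) Q) = insert (Q ! qh) (set (take qh Q))"
    using assms(2) by (simp add: take_Suc_conv_app_nth)
  have "distinct (take (Suc qh) Q)" using D(1) by simp
  then have new: "Q ! qh \<notin> set (take qh Q)"
    using assms(2) by (simp add: take_Suc_conv_app_nth)
  have E: "set E = {v. v < n \<and> hb v \<in> set (take qh Q)}" using D(9) by simp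
  have "set E \<inter> set R = {}" unfolding E assms(4) using new by auto
  moreover have "set E \<union> set R = {v. v < n \<and> hb v \<in> set (take (Suc qh) Q)}"
    unfolding E assms(4) take by auto
  moreover have "\<exists>a b. a \<le> b \<and> b < Suc qh \<and> hb (E ! i) = Q ! a \<and> hb (E ! j) = Q ! b"
    if "i \<le> j" "j < length E" for i j
  proof -
    from D(14) that obtain a b where "a \<le> b" "b < qh" "hb (E ! i) = Q ! a" "hb (E ! j) = Q ! b" by blast
    then show ?thesis by (intro exI[of _ a] exI[of _ b]) simp
  qed
  moreover have "\<forall>v \<in> set R. hb v = Q ! (Suc qh - 1)" using assms(4) by simp
  moreover have "Suc qh \<le> length Q" using assms(2) by simp
  ultimately show ?thesis
    unfolding kahn_def using D(1,2,4,5,6,12,13,15) assms(3)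
    by (intro conjI; (assumption | blast | simp))
qed

lemma kahn_visited:
  assumes "kahn qh Q E R dn" "v \<in> set E"
  shows "\<exists>a < qh. hb v = Q ! a"
proof -
  have "set E \<union> set R = {v. v < n \<and> hb v \<in> set (take qh Q)}" "qh \<le> length Q"
    using kahn_arcs[OF assms(1)] kahn_queue[OF assms(1)] by auto
  with assms(2) have "hb v \<in> set (take qh Q)" by blast
  then show ?thesis by (auto simp: in_set_conv_nth)
qed

text \<open>A block enters the queue when the last arc leaving it is emitted. The heads of all these
  arcs have been visited by then and therefore precede it in the queue, which yields the topological
  order.\<close>

lemma kahn_emit:
  assumes "kahn qh Q E (v # R) dn" "u = tb v"
    and Q': "Q' = (if Suc (dn u) = card {v. v < n \<and> tb v = u} then Q @ [u] else Q)"
  shows "kahn qh Q' (E @ [v]) R (dn(u := Suc (dn u)))"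
proof -
  note D = kahnD[OF assms(1)]
  have vn: "v < n" and hv: "hb v = Q ! (qh - 1)" and qh: "0 < qh" "qh \<le> length Q"
    and vE: "v \<notin> set E" "v \<notin> set R" using D(3,7,8,10,11) kahn_E(2)[OF assms(1)] by auto
  have setQ: "set Q = insert 0 {u. (\<exists>v < n. tb v = u) \<and> (\<forall>v < n. tb v = u \<longrightarrow> v \<in> set E)}"
    by (rule D(13))
  have u0: "u \<noteq> 0" "u \<le> src" using tb_bounds[OF vn] assms(2) by auto
  \<comment> \<open>Queued blocks other than the target have all their outgoing arcs emitted, and
    \<open>v\<close> was not; so no block is queued twice.\<close>
  have uQ: "u \<notin> set Q" unfolding setQ using u0 vE(1) vn assms(2) by auto
  have take: "take qh Q' = take qh Q" using Q' qh by simp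
  have nth: "Q' ! a = Q ! a" if "a < length Q" for a using Q' that by (simp add: nth_append)
  have dn: "\<And>u. dn u = card {v \<in> set E. tb v = u}" using D(12) by blast
  have dn': "(dn(u := Suc (dn u))) w = card {x \<in> set (E @ [v]). tb x = w}" for w
  proof (cases "w = u")
    case True
    then have "{x \<in> set (E @ [v]). tb x = w} = insert v {x \<in> set E. tb x = w}" using assms(2) by auto
    then show ?thesis using True vE(1) dn[of w] by simp
  next
    case False
    then have "{x \<in> set (E @ [v]). tb x = w} = {x \<in> set E. tb x = w}" using assms(2) by auto
    then show ?thesis using False dn[of w] by simp
  qed
  have full: "Suc (dn u) = card {v. v < n \<and> tb v = u} \<longleftrightarrow> (\<forall>x < n. tb x = u \<longrightarrow> x \<in> set (E @ [v]))"
  proof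
    have sub: "{x \<in> set (E @ [v]). tb x = u} \<subseteq> {x. x < n \<and> tb x = u}"
      using kahn_E(1)[OF assms(1)] vn by auto
    assume "Suc (dn u) = card {v. v < n \<and> tb v = u}"
    then have "card {x \<in> set (E @ [v]). tb x = u} = card {x. x < n \<and> tb x = u}" using dn'[of u] by simp
    with sub have "{x \<in> set (E @ [v]). tb x = u} = {x. x < n \<and> tb x = u}" by (intro card_subset_eq) auto
    then show "\<forall>x < n. tb x = u \<longrightarrow> x \<in> set (E @ [v])" by blast
  next
    assume "\<forall>x < n. tb x = u \<longrightarrow> x \<in> set (E @ [v])"
    then have "{x \<in> set (E @ [v]). tb x = u} = {x. x < n \<and> tb x = u}"
      using kahn_E(1)[OF assms(1)] vn by auto
    then show "Suc (dn u) = card {v. v < n \<and> tb v = u}" using dn'[of u] by simp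
  qed
  have setQ': "set Q' = insert 0 {w. (\<exists>v < n. tb v = w) \<and> (\<forall>x < n. tb x = w \<longrightarrow> x \<in> set (E @ [v]))}"
  proof -
    have "w \<in> set Q' \<longleftrightarrow> w = 0 \<or> (\<exists>v < n. tb v = w) \<and> (\<forall>x < n. tb x = w \<longrightarrow> x \<in> set (E @ [v]))" for w
    proof (cases "w = u")
      case True
      then have "w \<in> set Q' \<longleftrightarrow> Suc (dn u) = card {v. v < n \<and> tb v = u}" using uQ Q' by simp
      moreover have "\<exists>v < n. tb v = w" "w \<noteq> 0" using True u0 vn assms(2) by auto
      ultimately show ?thesis unfolding full using True by simp
    next
      case False
      then have "w \<in> set Q' \<longleftrightarrow> w \<in> set Q" using Q' by simp
      moreover have "(\<forall>x < n. tb x = w \<longrightarrow> x \<in> set (E @ [v])) \<longleftrightarrow> (\<forall>x < n. tb x = w \<longrightarrow> x \<in> set E)"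
        using False assms(2) by auto
      ultimately show ?thesis unfolding setQ by simp
    qed
    then show ?thesis unfolding set_eq_iff insert_iff mem_Collect_eq by (rule allI)
  qed
  have sorted: "\<exists>a b. a \<le> b \<and> b < qh \<and> hb ((E @ [v]) ! i) = Q' ! a \<and> hb ((E @ [v]) ! j) = Q' ! b"
    if ij: "i \<le> j" "j < length (E @ [v])" for i j
  proof (cases "j < length E")
    case True
    then obtain a b where "a \<le> b" "b < qh" "hb (E ! i) = Q ! a" "hb (E ! j) = Q ! b" using D(14) ij by blast
    then show ?thesis using True ij qh nth[of a] nth[of b] by (intro exI[of _ a] exI[of _ b]) (simp add: nth_append)
  next
    case False
    then have j: "j = length E" using ij by simp
    obtain a where a: "a \<le> qh - 1" "hb ((E @ [v]) ! i) = Q ! a"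
    proof (cases "i = length E")
      case True
      then show ?thesis using that[of "qh - 1"] hv by simp
    next
      case False
      then have "i < length E" using ij j by simp
      then have "E ! i \<in> set E" by simp
      from kahn_visited[OF assms(1) this] obtain a where "a < qh" "hb (E ! i) = Q ! a" by blast
      then show ?thesis using that[of a] \<open>i < length E\<close> by (simp add: nth_append)
    qed
    then show ?thesis using j hv qh nth[of a] nth[of "qh - 1"]
      by (intro exI[of _ a] exI[of _ "qh - 1"]) auto
  qed
  have order: "\<exists>a < b. hb x = Q' ! a" if b: "b < length Q'" "x < n" "tb x = Q' ! b" for b x
  proof (cases "b < length Q")
    case True
    then obtain a where "a < b" "hb x = Q ! a" using D(15) b(2,3) nth[OF True] True by auto
    then show ?thesis using nth[of a] True by auto
  next
    case False
    with b Q' have "b = length Q" "Q' = Q @ [u]" "Suc (dn u) = card {v. v < n \<and> tb v = u}"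
      by (auto split: if_splits)
    with b have "tb x = u" by simp
    with full \<open>Suc (dn u) = _\<close> b(2) have "x \<in> set E \<or> x = v" by auto
    then obtain a where a: "a < qh" "hb x = Q ! a"
    proof
      assume "x \<in> set E"
      from kahn_visited[OF assms(1) this] that show thesis by blast
    next
      assume "x = v"
      with that[of "qh - 1"] hv qh show thesis by simp
    qed
    show ?thesis using a qh \<open>b = length Q\<close> nth[of a] by (intro exI[of _ a]) auto
  qed
  show ?thesis
    unfolding kahn_def take
  proof (intro conjI allI impI)
    show "distinct Q'" using D(1) uQ Q' by simp
    show "set Q' \<subseteq> {..src}" using D(2) u0 Q' by simp
    show "qh \<le> length Q'" "Q' \<noteq> []" using D(4) Q' qh by auto
    show "Q' ! 0 = 0" using D(4,5) nth[of 0] by simp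
    show "distinct (E @ [v])" using D(6) vE by simp
    show "distinct R" using D(7) by simp
    show "set (E @ [v]) \<inter> set R = {}" using D(8) vE by auto
    show "set (E @ [v]) \<union> set R = {v. v < n \<and> hb v \<in> set (take qh Q)}" using D(9) by simp
    show "\<forall>v\<in>set R. hb v = Q' ! (qh - 1)" using D(10) nth[of "qh - 1"] qh by simp
    show "0 < qh" by (rule qh(1))
    show "(dn(u := Suc (dn u))) w = card {x \<in> set (E @ [v]). tb x = w}" for w by (rule dn')
    show "set Q' = insert 0 {w. (\<exists>v < n. tb v = w) \<and> (\<forall>x < n. tb x = w \<longrightarrow> x \<in> set (E @ [v]))}"
      by (rule setQ')
    show "\<exists>a b. a \<le> b \<and> b < qh \<and> hb ((E @ [v]) ! i) = Q' ! a \<and> hb ((E @ [v]) ! j) = Q' ! b"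
      if "i \<le> j" "j < length (E @ [v])" for i j using that by (rule sorted)
    show "\<exists>a < b. hb x = Q' ! a" if "b < length Q'" "x < n" "tb x = Q' ! b" for b x
      using that by (rule order)
  qed
qed

text \<open>Among the arcs not emitted, take one whose head has the largest rank. Its head never
  entered the queue, so some arc leaving that head was not emitted either, and this arc has a head
  of larger rank.\<close>

lemma kahn_finish:
  assumes "kahn qh Q E [] dn" "qh = length Q"
  shows "\<exists>pos. block_order n hb tb J L E pos"
proof -
  note D = kahnD[OF assms(1)]
  have E: "set E = {v. v < n \<and> hb v \<in> set Q}" using D(9) assms(2) by simp
  have setQ: "set Q = insert 0 {u. (\<exists>v < n. tb v = u) \<and> (\<forall>v < n. tb v = u \<longrightarrow> v \<in> set E)}"
    by (rule D(13))
  obtain rk :: "nat \<Rightarrow> real" where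
    rk: "\<And>u v l. (u, v, l) \<in># vertex_arcs (mset_set {..<n}) \<Longrightarrow> rk u < rk v"
    using sp.ttsp_rank[OF ttsp_blocks zero_less_one] by blast
  have all: "set E = {..<n}"
  proof (rule ccontr)
    assume "set E \<noteq> {..<n}"
    with kahn_E(1)[OF assms(1)] have "{v. v < n \<and> v \<notin> set E} \<noteq> {}" by auto
    moreover have fin: "finite {v. v < n \<and> v \<notin> set E}" by simp
    ultimately have "Max ((\<lambda>v. rk (hb v)) ` {v. v < n \<and> v \<notin> set E}) \<in>
        (\<lambda>v. rk (hb v)) ` {v. v < n \<and> v \<notin> set E}"
      by (intro Max_in) simp_all
    then obtain v where rk_v: "Max ((\<lambda>v. rk (hb v)) ` {v. v < n \<and> v \<notin> set E}) = rk (hb v)"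
      and "v \<in> {v. v < n \<and> v \<notin> set E}" by (rule imageE)
    then have v: "v < n" "v \<notin> set E" by auto
    have max: "rk (hb x) \<le> rk (hb v)" if "x < n" "x \<notin> set E" for x
      unfolding rk_v[symmetric] using fin that by (intro Max_ge) auto
    have nQ: "hb v \<notin> set Q" using v E by blast
    then have hv: "hb v \<noteq> 0" "\<not> ((\<exists>x < n. tb x = hb v) \<and> (\<forall>x < n. tb x = hb v \<longrightarrow> x \<in> set E))"
      unfolding setQ insert_iff mem_Collect_eq by simp_all
    from block_successor[OF v(1) hv(1)] hv(2) obtain x where x: "x < n" "tb x = hb v" "x \<notin> set E"
      by blast
    have "rk (tb x) < rk (hb x)" by (rule rk[OF block_arc[OF x(1)]])
    with x max[OF x(1,3)] show False by simp
  qed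
  \<comment> \<open>The index in the queue. It is evaluated only at the target and at heads and
    tails of arcs, all of which are in \<open>Q\<close>.\<close>
  define pos where "pos y = (LEAST a. Q ! a = y)" for y
  have pos_nth: "pos (Q ! a) = a" if "a < length Q" for a
    unfolding pos_def
  proof (rule Least_equality)
    fix b assume b: "Q ! b = Q ! a"
    show "a \<le> b"
    proof (rule ccontr)
      assume "\<not> a \<le> b"
      then have "b < length Q" "b \<noteq> a" using that by auto
      then show False using b D(1) that by (simp add: nth_eq_iff_index_eq)
    qed
  qed simp
  have hbQ: "hb v \<in> set Q" if "v < n" for v   proof -
    have "v \<in> set E" using all that by simp
    then show ?thesis unfolding E by simp
  qed
  have tbQ: "tb v \<in> set Q" if "v < n" for v
  proof -
    have "\<forall>x < n. x \<in> set E" using all by simp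
    then show ?thesis unfolding setQ using that by blast
  qed
  show ?thesis
  proof (intro exI[of _ pos], unfold_locales)
    show "distinct E" by (rule D(6))
    show "set E = {..<n}" by (rule all)
    have lenE: "length E = n" using distinct_card[OF \<open>distinct E\<close>] all by simp
    show "pos (hb (E ! i)) \<le> pos (hb (E ! j))" if "i \<le> j" "j < n" for i j
    proof -
      have "j < length E" using that lenE by simp
      from D(14)[rule_format, OF that(1) this] obtain a b where
        "a \<le> b" "b < qh" "hb (E ! i) = Q ! a" "hb (E ! j) = Q ! b" by blast
      then show ?thesis using pos_nth[of a] pos_nth[of b] assms(2) by simp
    qed
    show "hb u = hb v" if "u < n" "v < n" "pos (hb u) = pos (hb v)" for u v
    proof -
      from hbQ[OF that(1)] hbQ[OF that(2)] obtain a b where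
        ab: "a < length Q" "hb u = Q ! a" "b < length Q" "hb v = Q ! b"
        unfolding in_set_conv_nth by auto
      with that(3) pos_nth[of a] pos_nth[of b] have "a = b" by simp
      with ab show ?thesis by simp
    qed
    show "pos (hb v) < pos (tb v)" if "v < n" for v
    proof -
      from tbQ[OF that] obtain b where b: "b < length Q" "tb v = Q ! b"
        unfolding in_set_conv_nth by auto
      from D(15)[rule_format, OF b(1) that b(2)] obtain a where "a < b" "hb v = Q ! a" by blast
      with b show ?thesis using pos_nth[of a] pos_nth[of b] by simp
    qed
    show "pos 0 = 0" using pos_nth[of 0] D(4,5) by simp
  qed
qed

end

section \<open>The program\<close>

definition loop :: "com \<Rightarrow> bexp \<Rightarrow> com \<Rightarrow> com" where
  "loop a b p = Seq a (While b p)"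

definition loop_cost :: "com \<Rightarrow> bexp \<Rightarrow> com \<Rightarrow> nat" where
  "loop_cost a b p = max_cost a + (1 + bcost b + max_cost p)"

text \<open>The factor 4 covers the variants of all loops, the largest being
  \<open>2 * n + 2\<close> and \<open>3 * n\<close> with \<open>n\<close> positive; the final test
  of the guard raises it to 5.\<close>

lemma runs_loop:
  assumes "while_free a" "while_free p" "word_state W s" "fits W a s" "I k (sem a s)" "k \<le> 4 * T" "0 < T"
    and step: "\<And>k s. \<lbrakk>word_state W s; I k s; bval b s\<rbrakk> \<Longrightarrow> fits W p s \<and> (\<exists>k' < k. I k' (sem p s))"
    and exit: "\<And>k s. \<lbrakk>word_state W s; I k s; \<not> bval b s\<rbrakk> \<Longrightarrow> Q s"
  shows "runs W (loop a b p) s (5 * loop_cost a b p * T) Q"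
proof -
  have "runs W (loop a b p) s (max_cost a + (1 + bcost b + max_cost p) * (k + 1))
      (\<lambda>s. (\<exists>k. I k s) \<and> \<not> bval b s)"
    unfolding loop_def
  proof (rule runs_Seq)
    show "runs W a s (max_cost a) (\<lambda>s'. I k s')"
      using assms(1,3,4,5) by (rule runs_while_free)
    show "runs W (While b p) s' ((1 + bcost b + max_cost p) * (k + 1)) (\<lambda>s. (\<exists>k. I k s) \<and> \<not> bval b s)"
      if "word_state W s'" "I k s'" for s'
      using assms(2) that step by (rule runs_While)
  qed
  moreover have "max_cost a + (1 + bcost b + max_cost p) * (k + 1) \<le> 5 * loop_cost a b p * T"
  proof -
    have "k + 1 \<le> 5 * T" "1 \<le> 5 * T" using assms(6,7) by auto
    then have "max_cost a * 1 + (1 + bcost b + max_cost p) * (k + 1)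
        \<le> max_cost a * (5 * T) + (1 + bcost b + max_cost p) * (5 * T)"
      by (intro add_mono mult_le_mono) auto
    then show ?thesis unfolding loop_cost_def by (simp add: algebra_simps)
  qed
  ultimately show ?thesis by (rule runs_mono) (use exit in blast)
qed

lemma word_state_bounds:
  assumes "word_state W s"
  shows "fst s x \<le> W" "snd s a i \<le> W" "fst s x - j \<le> W" "snd s a i - j \<le> W"
  using word_stateD[OF assms] by (auto intro: le_trans[OF diff_le_self])

definition zero_arrays :: "aname set \<Rightarrow> state \<Rightarrow> bool" where
  "zero_arrays A s \<longleftrightarrow> (\<forall>a \<in> A. \<forall>i. snd s a i = 0)"

definition seqs :: "com list \<Rightarrow> com" where
  "seqs ps = foldr Seq ps Skip"

lemma seqs_simps [simp]: "seqs [] = Skip" "seqs (p # ps) = Seq p (seqs ps)"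
  by (simp_all add: seqs_def)

abbreviation "incr x \<equiv> Assign x (Plus (V x) (N 1))"

definition head_body :: com where
  "head_body = seqs
     [Cond (Less (Get ''hb'' (Get ''tail'' (V ''i''))) (Plus (Get ''head'' (V ''i'')) (N 1)))
        (Put ''hb'' (Get ''tail'' (V ''i'')) (Plus (Get ''head'' (V ''i'')) (N 1))) Skip,
      incr ''i'']"

definition tail_body :: com where
  "tail_body = seqs
     [Put ''tb'' (Get ''head'' (V ''i'')) (Get ''hb'' (Get ''tail'' (V ''i''))),
      incr ''i'']"

text \<open>An entry 0 in \<open>tb\<close> marks a vertex without incoming arcs, because no arc of
  the multigraph leaves the target block 0.\<close>

definition list_body :: com where
  "list_body = seqs
     [Cond (Less (N 0) (Get ''tb'' (V ''i''))) Skip (Put ''tb'' (V ''i'') (Plus (V ''n'') (N 1))),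
      Put ''cnt'' (Get ''tb'' (V ''i'')) (Plus (Get ''cnt'' (Get ''tb'' (V ''i''))) (N 1)),
      Put ''next'' (V ''i'') (Get ''first'' (Get ''hb'' (V ''i''))),
      Put ''first'' (Get ''hb'' (V ''i'')) (Plus (V ''i'') (N 1)),
      incr ''i'']"

definition kahn_init_com :: com where
  "kahn_init_com = seqs
     [Put ''nq'' (N 0) (N 0), Assign ''qh'' (N 0), Assign ''qt'' (N 1), Assign ''k'' (N 0), Assign ''e'' (N 0)]"

text \<open>The nested iteration over blocks and their lists of arcs is flattened into one loop: a
  turn emits one arc if the pointer \<open>e\<close> is not null, and visits the next block
  otherwise. This keeps the body free of loops and gives a linear variant directly.\<close>

definition kahn_body :: com where
  "kahn_body = Cond (Less (N 0) (V ''e''))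
     (seqs
       [Assign ''v'' (Minus (V ''e'') (N 1)),
        Put ''q'' (V ''k'') (V ''v''),
        incr ''k'',
        Assign ''u'' (Get ''tb'' (V ''v'')),
        Put ''done'' (V ''u'') (Plus (Get ''done'' (V ''u'')) (N 1)),
        Cond (Eq (Get ''done'' (V ''u'')) (Get ''cnt'' (V ''u'')))
          (Seq (Put ''nq'' (V ''qt'') (V ''u'')) (incr ''qt'')) Skip,
        Assign ''e'' (Get ''next'' (V ''v''))])
     (seqs
       [Assign ''e'' (Get ''first'' (Get ''nq'' (V ''qh''))),
        incr ''qh''])"

definition contract_init :: com where
  "contract_init = seqs [Assign ''i'' (V ''n''), Assign ''go'' (N 0), Assign ''x'' (N 0)]"

definition fetch_com :: com where
  "fetch_com = seqs
     [Assign ''i'' (Minus (V ''i'') (N 1)),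
      Assign ''v'' (Get ''q'' (V ''i'')),
      Assign ''x'' (Get ''hb'' (V ''v'')),
      Assign ''w'' (Get ''tb'' (V ''v'')),
      Assign ''l'' (N (label_code single_label)),
      Assign ''go'' (N 1)]"

text \<open>The entry \<open>ac w\<close> belongs to an arc from \<open>w\<close> to the current block \<open>x\<close> only if \<open>st w = Suc x\<close>;
  this saves clearing the array for every block.\<close>

definition place_com :: com where
  "place_com = Cond (Eq (Get ''st'' (V ''w'')) (Plus (V ''x'') (N 1)))
     (seqs
       [Assign ''y'' (Get ''ac'' (V ''w'')),
        lookup ''z'' ''y'' ''l'' par_code (card labels),
        Put ''ac'' (V ''w'') (V ''z''),
        Put ''cnt'' (V ''w'') (Minus (Get ''cnt'' (V ''w'')) (N 1))])
     (seqs
       [Put ''ac'' (V ''w'') (V ''l''),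
        Put ''st'' (V ''w'') (Plus (V ''x'') (N 1))])"

definition move_com :: com where
  "move_com = Cond (Conj (Neg (Eq (V ''w'') (Plus (V ''n'') (N 1)))) (Less (Get ''cnt'' (V ''w'')) (N 2)))
     (seqs
       [Assign ''y'' (Get ''la'' (V ''w'')),
        Assign ''z'' (Get ''ac'' (V ''w'')),
        lookup ''l'' ''y'' ''z'' ser_code (card labels),
        Assign ''w'' (Get ''pa'' (V ''w''))])
     (seqs
       [Put ''pa'' (V ''x'') (V ''w''),
        Put ''la'' (V ''x'') (Get ''ac'' (V ''w'')),
        Assign ''go'' (N 0)])"

text \<open>Also a flattened nested loop. The flag \<open>go\<close> tells that an arc is being
  moved; a turn then places it and either contracts its tail, which produces the next arc to move,
  or stops.\<close>

definition contract_body :: com where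
  "contract_body = Cond (Less (N 0) (V ''go'')) (Seq place_com move_com) fetch_com"

text \<open>A unary function is looked up on the diagonal of a binary table.\<close>

definition output_com :: com where
  "output_com = Seq (Assign ''y'' (Get ''la'' (N 0)))
     (lookup ''result'' ''y'' ''y'' (\<lambda>i _. min_colors (code_label i)) (card labels))"

definition below :: "vname \<Rightarrow> bexp" where
  "below x = Less (V ''i'') (V x)"

text \<open>A disjunction: with truncated subtraction, the sum is positive iff a list is under way
  or a queued block is not yet visited.\<close>

definition kahn_guard :: bexp where
  "kahn_guard = Less (N 0) (Plus (V ''e'') (Minus (V ''qt'') (V ''qh'')))"

definition contract_guard :: bexp where
  "contract_guard = Less (N 0) (Plus (V ''i'') (V ''go''))"

lemmas com_defs = head_body_def tail_body_def list_body_def kahn_init_com_def kahn_body_def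
  contract_init_def fetch_com_def place_com_def move_com_def contract_body_def output_com_def
  below_def kahn_guard_def contract_guard_def

definition chromatic_com :: com where
  "chromatic_com = seqs
     [loop (Assign ''i'' (N 0)) (below ''m'') head_body,
      loop (Assign ''i'' (N 0)) (below ''m'') tail_body,
      loop (Assign ''i'' (N 0)) (below ''n'') list_body,
      loop kahn_init_com kahn_guard kahn_body,
      loop contract_init contract_guard contract_body,
      output_com]"

text \<open>Linked lists: \<open>Suc v\<close> points to \<open>v\<close>, and \<open>0\<close> is the null pointer.\<close>

fun chain :: "(nat \<Rightarrow> nat) \<Rightarrow> nat \<Rightarrow> nat list \<Rightarrow> bool" where
  "chain nx p [] \<longleftrightarrow> p = 0"
| "chain nx p (v # vs) \<longleftrightarrow> p = Suc v \<and> chain nx (nx v) vs"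

lemma chain_upd [simp]: "v \<notin> set vs \<Longrightarrow> chain (nx(v := a)) p vs = chain nx p vs"
  by (induction vs arbitrary: p) auto

lemma chain_pos: "chain nx p vs \<Longrightarrow> 0 < p \<longleftrightarrow> vs \<noteq> []"
  by (cases vs) auto

section \<open>Correctness of the passes that compute blocks, counters and lists\<close>

context block_input
begin

definition max_head :: "nat \<Rightarrow> nat \<Rightarrow> nat" where
  "max_head i u = Max (insert 0 (Suc ` {v. (u, v) \<in> set (take i es)}))"

lemma max_head_0: "max_head 0 u = 0"
  by (simp add: max_head_def)

lemma max_head_Suc:
  assumes "i < length es"
  shows "max_head (Suc i) u =
    (if u = fst (es ! i) then max (max_head i u) (Suc (snd (es ! i))) else max_head i u)"
proof -
  obtain a b where ab: "es ! i = (a, b)" by (cases "es ! i")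
  show ?thesis
  proof (cases "u = a")
    case True
    then have "{v. (u, v) \<in> set (take (Suc i) es)} = insert b {v. (u, v) \<in> set (take i es)}"
      using assms ab by (auto simp: take_Suc_conv_app_nth)
    then have "max_head (Suc i) u = Max (insert (Suc b) (insert 0 (Suc ` {v. (u, v) \<in> set (take i es)})))"
      unfolding max_head_def by (simp only: image_insert insert_commute)
    then show ?thesis unfolding max_head_def using True ab finite_heads[of u i] by (simp add: max.commute)
  next
    case False
    then have "{v. (u, v) \<in> set (take (Suc i) es)} = {v. (u, v) \<in> set (take i es)}"
      using assms ab by (auto simp: take_Suc_conv_app_nth)
    then show ?thesis unfolding max_head_def using False ab by simp
  qed
qed

lemma max_head_all: "u < n \<Longrightarrow> max_head (length es) u = hb u"
  by (simp add: max_head_def hb_eq)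

lemma arc_bounds:
  assumes "i < length es"
  shows "fst (es ! i) < n" "snd (es ! i) < n"
proof -
  have "es ! i \<in> {..<n} \<times> {..<n}" using arcs_bounded nth_mem[OF assms] by blast
  then show "fst (es ! i) < n" "snd (es ! i) < n" by auto
qed

definition input_ok :: "state \<Rightarrow> bool" where
  "input_ok s \<longleftrightarrow> fst s ''n'' = n \<and> fst s ''m'' = length es \<and>
     (\<forall>i < length es. snd s ''tail'' i = fst (es ! i) \<and> snd s ''head'' i = snd (es ! i))"

lemma input_ok_simps:
  assumes "input_ok s"
  shows "fst s ''n'' = n" "fst s ''m'' = length es"
    "i < length es \<Longrightarrow> snd s ''tail'' i = fst (es ! i)" "i < length es \<Longrightarrow> snd s ''head'' i = snd (es ! i)"
  using assms by (auto simp: input_ok_def)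

definition after_head :: "state \<Rightarrow> bool" where
  "after_head s \<longleftrightarrow> input_ok s \<and> zero_arrays {''tb'', ''cnt'', ''done'', ''first'', ''st''} s \<and>
     (\<forall>u < n. snd s ''hb'' u = hb u)"

definition head_inv :: "nat \<Rightarrow> state \<Rightarrow> bool" where
  "head_inv k s \<longleftrightarrow> input_ok s \<and>
    zero_arrays {''tb'', ''cnt'', ''done'', ''first'', ''st''} s \<and> k + fst s ''i'' = length es \<and>
    (\<forall>u. snd s ''hb'' u = max_head (fst s ''i'') u)"

lemma run_head:
  assumes "input_ok s" "zero_arrays {''hb'', ''tb'', ''cnt'', ''done'', ''first'', ''st''} s"
    and "word_state W s" "n + length es + 10 \<le> W"
  shows "runs W (loop (Assign ''i'' (N 0)) (below ''m'') head_body) s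
    (5 * loop_cost (Assign ''i'' (N 0)) (below ''m'') head_body * (n + length es)) after_head"
proof (rule runs_loop[where k = "length es" and I = head_inv])
  show "while_free head_body" by (simp add: com_defs)
  show "head_inv (length es) (sem (Assign ''i'' (N 0)) s)"
    using assms(1,2) by (simp add: head_inv_def input_ok_def zero_arrays_def max_head_0)
next
  fix k s assume w: "word_state W s" and "head_inv k s" and b: "bval (below ''m'') s"
  note inv = this(2)[unfolded head_inv_def]
  with b have i: "fst s ''i'' < length es" by (simp add: com_defs input_ok_def)
  note io = input_ok_simps[OF conjunct1[OF inv]]
  have hb: "\<And>u. snd s ''hb'' u = max_head (fst s ''i'') u" using inv by blast
  have "fits W head_body s"
    using i arc_bounds[OF i] assms(4) by (simp add: com_defs io)
  moreover have "input_ok (sem head_body s)" using inv by (simp add: com_defs input_ok_def)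
  moreover have "zero_arrays {''tb'', ''cnt'', ''done'', ''first'', ''st''} (sem head_body s)"
    using inv by (simp add: com_defs zero_arrays_def)
  moreover have "(k - 1) + fst (sem head_body s) ''i'' = length es" "k - 1 < k"
    using inv i by (auto simp: com_defs)
  moreover have "snd (sem head_body s) ''hb'' u = max_head (fst (sem head_body s) ''i'') u" for u
    using i by (auto simp: com_defs io hb max_head_Suc)
  ultimately show "fits W head_body s \<and> (\<exists>k'<k. head_inv k' (sem head_body s))"
    unfolding head_inv_def by blast
next
  fix k s assume inv: "head_inv k s" and "\<not> bval (below ''m'') s"
  then have "fst s ''i'' = length es" by (simp add: com_defs head_inv_def input_ok_def)
  with inv show "after_head s" by (simp add: head_inv_def after_head_def max_head_all)
qed (use assms n_pos in \<open>simp_all add: com_defs\<close>)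

definition after_tail :: "state \<Rightarrow> bool" where
  "after_tail s \<longleftrightarrow> fst s ''n'' = n \<and> zero_arrays {''cnt'', ''done'', ''first'', ''st''} s \<and>
     (\<forall>u < n. snd s ''hb'' u = hb u) \<and>
     (\<forall>v. snd s ''tb'' v = (if \<exists>u. (u, v) \<in> set es then tb v else 0))"

definition tail_inv :: "nat \<Rightarrow> state \<Rightarrow> bool" where
  "tail_inv k s \<longleftrightarrow> input_ok s \<and>
    zero_arrays {''cnt'', ''done'', ''first'', ''st''} s \<and> k + fst s ''i'' = length es \<and>
    (\<forall>u < n. snd s ''hb'' u = hb u) \<and>
    (\<forall>v. snd s ''tb'' v = (if \<exists>u. (u, v) \<in> set (take (fst s ''i'') es) then tb v else 0))"

lemma run_tail:
  assumes "after_head s" "word_state W s" "n + length es + 10 \<le> W"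
  shows "runs W (loop (Assign ''i'' (N 0)) (below ''m'') tail_body) s
    (5 * loop_cost (Assign ''i'' (N 0)) (below ''m'') tail_body * (n + length es)) after_tail"
proof (rule runs_loop[where k = "length es" and I = tail_inv])
  show "while_free tail_body" by (simp add: com_defs)
  show "tail_inv (length es) (sem (Assign ''i'' (N 0)) s)"
    using assms(1) by (simp add: tail_inv_def after_head_def input_ok_def zero_arrays_def)
next
  fix k s assume w: "word_state W s" and "tail_inv k s" and b: "bval (below ''m'') s"
  note inv = this(2)[unfolded tail_inv_def]
  with b have i: "fst s ''i'' < length es" by (simp add: com_defs input_ok_def)
  note io = input_ok_simps[OF conjunct1[OF inv]]
  have hb: "\<And>u. u < n \<Longrightarrow> snd s ''hb'' u = hb u" using inv by blast
  have tb: "\<And>v. snd s ''tb'' v = (if \<exists>u. (u, v) \<in> set (take (fst s ''i'') es) then tb v else 0)"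
    using inv by blast
  have "(fst (es ! fst s ''i''), snd (es ! fst s ''i'')) \<in> set es" using nth_mem[OF i] by simp
  note arc = tb_arc[OF this]
  have "fits W tail_body s"
    using i arc_bounds[OF i] assms(3) word_state_bounds[OF w] by (simp add: com_defs io)
  moreover have "input_ok (sem tail_body s)" using inv by (simp add: com_defs input_ok_def)
  moreover have "zero_arrays {''cnt'', ''done'', ''first'', ''st''} (sem tail_body s)"
    using inv by (simp add: com_defs zero_arrays_def)
  moreover have "(k - 1) + fst (sem tail_body s) ''i'' = length es" "k - 1 < k"
    using inv i by (auto simp: com_defs)
  moreover have "\<forall>u < n. snd (sem tail_body s) ''hb'' u = hb u" using hb by (simp add: com_defs)
  moreover have "snd (sem tail_body s) ''tb'' v =
      (if \<exists>u. (u, v) \<in> set (take (fst (sem tail_body s) ''i'') es) then tb v else 0)" for v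
  proof -
    have "(\<exists>u. (u, v) \<in> set (take (Suc (fst s ''i'')) es)) \<longleftrightarrow>
        v = snd (es ! fst s ''i'') \<or> (\<exists>u. (u, v) \<in> set (take (fst s ''i'') es))"
      using i by (cases "es ! fst s ''i''") (auto simp: take_Suc_conv_app_nth)
    then show ?thesis using i hb[OF arc_bounds(1)[OF i]] arc tb[of v] by (auto simp: com_defs io)
  qed
  ultimately show "fits W tail_body s \<and> (\<exists>k'<k. tail_inv k' (sem tail_body s))"
    unfolding tail_inv_def by blast
next
  fix k s assume "tail_inv k s" "\<not> bval (below ''m'') s"
  then show "after_tail s" by (simp add: com_defs input_ok_def tail_inv_def after_tail_def)
qed (use assms n_pos in \<open>simp_all add: com_defs\<close>)

definition after_list :: "state \<Rightarrow> bool" where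
  "after_list s \<longleftrightarrow> fst s ''n'' = n \<and> zero_arrays {''done'', ''st''} s \<and>
     (\<forall>v < n. snd s ''hb'' v = hb v \<and> snd s ''tb'' v = tb v) \<and>
     (\<forall>u. snd s ''cnt'' u = card {v. v < n \<and> tb v = u}) \<and>
     (\<forall>y. \<exists>ls. chain (snd s ''next'') (snd s ''first'' y) ls \<and> distinct ls \<and> set ls = {v. v < n \<and> hb v = y})"

definition list_inv :: "nat \<Rightarrow> state \<Rightarrow> bool" where
  "list_inv k s \<longleftrightarrow> fst s ''n'' = n \<and> zero_arrays {''done'', ''st''} s \<and> k + fst s ''i'' = n \<and>
     (\<forall>v < n. snd s ''hb'' v = hb v) \<and>
     (\<forall>v < n. snd s ''tb'' v = (if v < fst s ''i'' \<or> (\<exists>u. (u, v) \<in> set es) then tb v else 0)) \<and>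
     (\<forall>u. snd s ''cnt'' u = card {v. v < fst s ''i'' \<and> tb v = u}) \<and>
     (\<forall>y. \<exists>ls. chain (snd s ''next'') (snd s ''first'' y) ls \<and> distinct ls \<and>
        set ls = {v. v < fst s ''i'' \<and> hb v = y})"

lemma list_step:
  assumes w: "word_state W s" and inv: "list_inv k s" and b: "fst s ''i'' < n" and W: "n + 10 \<le> W"
  shows "fits W list_body s \<and> list_inv (k - 1) (sem list_body s)"
proof -
  define i where "i = fst s ''i''"
  have i: "i < n" using b by (simp add: i_def)
  have n: "fst s ''n'' = n" and hb: "\<And>v. v < n \<Longrightarrow> snd s ''hb'' v = hb v"
    and tb: "\<And>v. v < n \<Longrightarrow> snd s ''tb'' v = (if v < i \<or> (\<exists>u. (u, v) \<in> set es) then tb v else 0)"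
    and cnt: "\<And>u. snd s ''cnt'' u = card {v. v < i \<and> tb v = u}"
    and lists: "\<And>y. \<exists>ls. chain (snd s ''next'') (snd s ''first'' y) ls \<and> distinct ls \<and>
        set ls = {v. v < i \<and> hb v = y}"
    and zero: "zero_arrays {''done'', ''st''} s" and k: "k + i = n"
    using inv unfolding list_inv_def i_def by blast+
  have src: "tb i = src" if "\<not> (\<exists>u. (u, i) \<in> set es)" using tb_source[OF i] that by blast
  have "card {v. v < i \<and> tb v = u} \<le> i" for u
  proof -
    have "card {v. v < i \<and> tb v = u} \<le> card {..<i}" by (intro card_mono) auto
    then show ?thesis by simp
  qed
  then have cnt_le: "Suc (card {v. v < i \<and> tb v = u}) \<le> W" for u
    using i W by (meson Suc_leI le_add1 le_trans less_trans not_less le_less_trans less_imp_le)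
  \<comment> \<open>The conditional either writes the source block or leaves a correct entry. In
    both cases the array becomes \<open>T\<close>, so the rest of the body is evaluated without a
    case distinction.\<close>
  define T where "T = (\<lambda>v. if v = i then tb i else snd s ''tb'' v)"
  let ?c = "Cond (Less (N 0) (Get ''tb'' (V ''i''))) Skip (Put ''tb'' (V ''i'') (Plus (V ''n'') (N 1)))"
  have c1: "sem ?c s = (fst s, (snd s)(''tb'' := T))"
  proof (cases "\<exists>u. (u, i) \<in> set es")
    case True
    then have "snd s ''tb'' i = tb i" using tb[OF i] by simp
    moreover from this have "T = snd s ''tb''" by (auto simp: T_def)
    ultimately show ?thesis using tb_bounds(1)[OF i] by (simp add: i_def[symmetric] fun_upd_idem)
  next
    case False
    then have "snd s ''tb'' i = 0" using tb[OF i] by simp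
    moreover have "T = (snd s ''tb'')(i := Suc n)" using src[OF False] by (auto simp: T_def)
    ultimately show ?thesis by (simp add: i_def[symmetric] n)
  qed
  have c2: "fits W ?c s" using W i by (simp add: n i_def[symmetric])
  have Ti: "T i = tb i" by (simp add: T_def)
  define A where "A = (snd s)(''tb'' := T, ''cnt'' := (snd s ''cnt'')(tb i := Suc (snd s ''cnt'' (tb i))),
        ''next'' := (snd s ''next'')(i := snd s ''first'' (hb i)),
        ''first'' := (snd s ''first'')(hb i := Suc i))"
  have sem: "sem list_body s = ((fst s)(''i'' := Suc i),
      A)"
    unfolding list_body_def seqs_simps sem.simps(4) c1
    by (simp add: i_def[symmetric] Ti hb[OF i] fun_upd_twist A_def)
  have "fits W list_body s"
    unfolding list_body_def seqs_simps fits.simps(4) c1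
    using c2 i W tb_bounds(2)[OF i] hb_le[OF i] cnt_le[of "tb i"] word_state_bounds[OF w]
    by (simp add: i_def[symmetric] Ti hb[OF i] cnt)
  moreover have "list_inv (k - 1) (sem list_body s)"
    unfolding list_inv_def sem fst_conv snd_conv
  proof (intro conjI allI impI)
    show "((fst s)(''i'' := Suc i)) ''n'' = n" using n by simp
    show "zero_arrays {''done'', ''st''} ((fst s)(''i'' := Suc i),
      A)"
      using zero by (simp add: zero_arrays_def A_def)
    show "k - 1 + ((fst s)(''i'' := Suc i)) ''i'' = n" using k i by simp
  next
    fix u
    have "{v. v < Suc i \<and> tb v = u} = (if u = tb i then insert i else id) {v. v < i \<and> tb v = u}"
      by (auto simp: less_Suc_eq)
    then show "A ''cnt'' u =
      card {v. v < ((fst s)(''i'' := Suc i)) ''i'' \<and> tb v = u}"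
      by (simp add: cnt A_def)
  next
    fix y
    obtain ls where ls: "chain (snd s ''next'') (snd s ''first'' y) ls" "distinct ls"
      "set ls = {v. v < i \<and> hb v = y}" using lists by blast
    have "chain ((snd s ''next'')(i := snd s ''first'' (hb i))) (((snd s ''first'')(hb i := Suc i)) y)
        (if y = hb i then i # ls else ls)"
      using ls by auto
    moreover have "distinct (if y = hb i then i # ls else ls)" using ls by auto
    moreover have "set (if y = hb i then i # ls else ls) = {v. v < Suc i \<and> hb v = y}"
      using ls(3) by (auto simp: less_Suc_eq)
    ultimately show "\<exists>ls. chain (A ''next'')
        (A ''first'' y) ls \<and> distinct ls \<and>
        set ls = {v. v < ((fst s)(''i'' := Suc i)) ''i'' \<and> hb v = y}"
      by (intro exI[of _ "if y = hb i then i # ls else ls"]) (simp add: A_def)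
  qed (use hb tb i in \<open>auto simp: A_def T_def less_Suc_eq\<close>)
  ultimately show ?thesis by simp
qed

lemma run_list:
  assumes "after_tail s" "word_state W s" "n + length es + 10 \<le> W"
  shows "runs W (loop (Assign ''i'' (N 0)) (below ''n'') list_body) s
    (5 * loop_cost (Assign ''i'' (N 0)) (below ''n'') list_body * (n + length es)) after_list"
proof (rule runs_loop[where k = n and I = list_inv])
  show "while_free list_body" by (simp add: com_defs)
  have "\<exists>ls. chain nx 0 ls \<and> distinct ls \<and> ls = []" for nx by simp
  then show "list_inv n (sem (Assign ''i'' (N 0)) s)"
    using assms(1) by (simp add: list_inv_def after_tail_def zero_arrays_def)
next
  fix k s assume *: "word_state W s" "list_inv k s" "bval (below ''n'') s"
  then have "fst s ''i'' < n" "k + fst s ''i'' = n" by (auto simp: com_defs list_inv_def)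
  with list_step[OF *(1,2)] assms(3) show "fits W list_body s \<and> (\<exists>k'<k. list_inv k' (sem list_body s))"
    by (intro conjI exI[of _ "k - 1"]) auto
next
  fix k s assume "list_inv k s" "\<not> bval (below ''n'') s"
  moreover from this have i: "fst s ''i'' = n" by (simp add: com_defs list_inv_def)
  ultimately show "after_list s"
    unfolding after_list_def list_inv_def i by simp
qed (use assms n_pos in \<open>simp_all add: com_defs\<close>)

end

section \<open>Correctness of the loop that orders the blocks\<close>

context block_input
begin

definition static :: "state \<Rightarrow> bool" where
  "static s \<longleftrightarrow> fst s ''n'' = n \<and> zero_arrays {''st''} s \<and>
     (\<forall>v < n. snd s ''hb'' v = hb v \<and> snd s ''tb'' v = tb v) \<and>
     (\<forall>u. snd s ''cnt'' u = card {v. v < n \<and> tb v = u}) \<and>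
     (\<forall>y. \<exists>ls. chain (snd s ''next'') (snd s ''first'' y) ls \<and> distinct ls \<and> set ls = {v. v < n \<and> hb v = y})"

text \<open>Every turn visits one of at most \<open>n + 2\<close> blocks or emits one of
  \<open>n\<close> arcs, which explains the variant \<open>k\<close>.\<close>

definition kahn_inv :: "nat \<Rightarrow> state \<Rightarrow> bool" where
  "kahn_inv k s \<longleftrightarrow> static s \<and> (\<exists>Q E R. kahn (fst s ''qh'') Q E R (snd s ''done'') \<and>
     fst s ''qt'' = length Q \<and> fst s ''k'' = length E \<and>
     (\<forall>i < length Q. snd s ''nq'' i = Q ! i) \<and> (\<forall>i < length E. snd s ''q'' i = E ! i) \<and>
     chain (snd s ''next'') (fst s ''e'') R \<and>
     k = (n + 2 - fst s ''qh'') + (n - length E))"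

lemma kahn_step:
  assumes w: "word_state W s" and inv: "kahn_inv k s" and b: "bval kahn_guard s" and W: "n + 10 \<le> W"
  shows "fits W kahn_body s \<and> (\<exists>k' < k. kahn_inv k' (sem kahn_body s))"
proof -
  obtain Q E R where st: "static s" and k: "kahn (fst s ''qh'') Q E R (snd s ''done'')"
    and qt: "fst s ''qt'' = length Q" and kE: "fst s ''k'' = length E"
    and nq: "\<And>i. i < length Q \<Longrightarrow> snd s ''nq'' i = Q ! i"
    and q: "\<And>i. i < length E \<Longrightarrow> snd s ''q'' i = E ! i"
    and chain: "chain (snd s ''next'') (fst s ''e'') R"
    and kk: "k = (n + 2 - fst s ''qh'') + (n - length E)"
    using inv unfolding kahn_inv_def by blast
  have n: "fst s ''n'' = n" and tb: "\<And>v. v < n \<Longrightarrow> snd s ''tb'' v = tb v"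
    and cnt: "\<And>u. snd s ''cnt'' u = card {v. v < n \<and> tb v = u}"
    and lists: "\<And>y. \<exists>ls. chain (snd s ''next'') (snd s ''first'' y) ls \<and> distinct ls \<and>
      set ls = {v. v < n \<and> hb v = y}"
    using st unfolding static_def by blast+
  note len = kahn_E(3,4)[OF k]
  show ?thesis
  proof (cases R)
    case Nil
    then have e: "fst s ''e'' = 0" using chain by simp
    with b have qh: "fst s ''qh'' < length Q" using qt by (simp add: kahn_guard_def)
    from lists[of "Q ! fst s ''qh''"] obtain ls where
      ls: "chain (snd s ''next'') (snd s ''first'' (Q ! fst s ''qh'')) ls" "distinct ls"
        "set ls = {v. v < n \<and> hb v = Q ! fst s ''qh''}" by blast
    have sem: "sem kahn_body s = ((fst s)(''e'' := snd s ''first'' (Q ! fst s ''qh''), ''qh'' := Suc (fst s ''qh'')), snd s)"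
      using e nq[OF qh] by (simp add: kahn_body_def)
    have "fits W kahn_body s"
      using e nq[OF qh] qh len W word_state_bounds[OF w] by (simp add: kahn_body_def)
    moreover have "static (sem kahn_body s)" using st unfolding static_def sem by (simp add: zero_arrays_def)
    moreover have "kahn (Suc (fst s ''qh'')) Q E ls (snd s ''done'')"
      using kahn_pop[OF k[unfolded Nil] qh ls(2,3)] .
    ultimately have "fits W kahn_body s \<and>
        kahn_inv ((n + 2 - Suc (fst s ''qh'')) + (n - length E)) (sem kahn_body s)"
      unfolding kahn_inv_def
      by (intro conjI exI[of _ Q] exI[of _ E] exI[of _ ls]) (simp_all add: sem qt kE nq q ls(1))
    moreover have "(n + 2 - Suc (fst s ''qh'')) + (n - length E) < k" unfolding kk using qh len by simp
    ultimately show ?thesis by blast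
  next
    case (Cons v R')
    then have e: "fst s ''e'' = Suc v" and chain': "chain (snd s ''next'') (snd s ''next'' v) R'"
      using chain by auto
    have vn: "v < n" using kahn_E(2)[OF k] Cons by simp
    define u where "u = tb v"
    define Q' where "Q' = (if Suc (snd s ''done'' u) = card {v. v < n \<and> tb v = u} then Q @ [u] else Q)"
    note k' = kahn_emit[OF k[unfolded Cons] u_def Q'_def]
    have tbv: "snd s ''tb'' v = u" using tb[OF vn] by (simp add: u_def)
    have done_le: "snd s ''done'' u \<le> n"
    proof -
      have "snd s ''done'' u = card {x \<in> set E. tb x = u}" using kahn_count[OF k] by blast
      also have "\<dots> \<le> card {..<n}" using kahn_E(1)[OF k] by (intro card_mono) auto
      finally show ?thesis by simp
    qed
    have u_le: "u \<le> W" using tb_bounds(2)[OF vn] W by (simp add: u_def)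
    have sem: "sem kahn_body s = ((fst s)(''v'' := v, ''k'' := Suc (length E), ''u'' := u,
          ''qt'' := length Q', ''e'' := snd s ''next'' v),
        (snd s)(''q'' := (snd s ''q'')(length E := v), ''done'' := (snd s ''done'')(u := Suc (snd s ''done'' u)),
          ''nq'' := (if Q' = Q then snd s ''nq'' else (snd s ''nq'')(length Q := u))))"
      by (auto simp: kahn_body_def e tbv kE qt cnt Q'_def fun_eq_iff)
    have "fits W kahn_body s"
      using len Cons done_le u_le vn W word_state_bounds[OF w]
      by (simp add: kahn_body_def e tbv kE qt)
    moreover have "static (sem kahn_body s)" using st unfolding static_def sem by (simp add: zero_arrays_def)
    moreover have "\<forall>i < length Q'. snd (sem kahn_body s) ''nq'' i = Q' ! i"
      unfolding sem using nq by (auto simp: Q'_def nth_append less_Suc_eq)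
    moreover have "\<forall>i < length (E @ [v]). snd (sem kahn_body s) ''q'' i = (E @ [v]) ! i"
      unfolding sem using q by (auto simp: nth_append less_Suc_eq)
    ultimately have "fits W kahn_body s \<and>
        kahn_inv ((n + 2 - fst s ''qh'') + (n - length (E @ [v]))) (sem kahn_body s)"
      unfolding kahn_inv_def using k' chain'
      by (intro conjI exI[of _ Q'] exI[of _ "E @ [v]"] exI[of _ R']) (simp_all add: sem)
    moreover have "(n + 2 - fst s ''qh'') + (n - length (E @ [v])) < k" unfolding kk using len Cons by simp
    ultimately show ?thesis by blast
  qed
qed

definition after_kahn :: "state \<Rightarrow> bool" where
  "after_kahn s \<longleftrightarrow> static s \<and>
     (\<exists>vs pos. block_order n hb tb J L vs pos \<and> (\<forall>j < n. snd s ''q'' j = vs ! j))"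

lemma run_kahn:
  assumes "after_list s" "word_state W s" "n + length es + 10 \<le> W"
  shows "runs W (loop kahn_init_com kahn_guard kahn_body) s
    (5 * loop_cost kahn_init_com kahn_guard kahn_body * (n + length es)) after_kahn"
proof (rule runs_loop[where k = "2 * n + 2" and I = kahn_inv])
  show "while_free kahn_init_com" "while_free kahn_body" by (simp_all add: com_defs)
  show "word_state W s" by fact
  show "fits W kahn_init_com s" using assms(3) by (simp add: com_defs)
  have "snd s ''done'' = (\<lambda>_. 0)" using assms(1) by (auto simp: after_list_def zero_arrays_def)
  with kahn_init have "kahn 0 [0] [] [] (snd s ''done'')" by simp
  moreover have "static (sem kahn_init_com s)"
    using assms(1) unfolding after_list_def static_def by (simp add: kahn_init_com_def zero_arrays_def)
  ultimately show "kahn_inv (2 * n + 2) (sem kahn_init_com s)"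
    unfolding kahn_inv_def
    by (intro conjI exI[of _ "[0]"] exI[of _ "[]"]) (simp_all add: kahn_init_com_def)
  show "2 * n + 2 \<le> 4 * (n + length es)" "0 < n + length es" using n_pos by auto
next
  fix k s assume "word_state W s" "kahn_inv k s" "bval kahn_guard s"
  then show "fits W kahn_body s \<and> (\<exists>k'<k. kahn_inv k' (sem kahn_body s))"
    using kahn_step assms(3) by auto
next
  fix k s assume inv: "kahn_inv k s" and b: "\<not> bval kahn_guard s"
  obtain Q E R where st: "static s" and k: "kahn (fst s ''qh'') Q E R (snd s ''done'')"
    and qt: "fst s ''qt'' = length Q"
    and q: "\<And>i. i < length E \<Longrightarrow> snd s ''q'' i = E ! i"
    and chain: "chain (snd s ''next'') (fst s ''e'') R"
    using inv unfolding kahn_inv_def by blast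
  from b have "fst s ''e'' = 0" "fst s ''qt'' \<le> fst s ''qh''" by (auto simp: kahn_guard_def)
  with chain_pos[OF chain] qt kahn_queue(3)[OF k] have R: "R = []" "fst s ''qh'' = length Q" by auto
  from kahn_finish[OF k[unfolded R(1)] R(2)] obtain pos where o: "block_order n hb tb J L E pos" by blast
  from block_order.length_vs[OF o] q have "\<forall>j < n. snd s ''q'' j = E ! j" by simp
  with st o show "after_kahn s" unfolding after_kahn_def by blast
qed

end

section \<open>Correctness and amortized cost of the contraction loop\<close>

context block_order
begin

definition order_static :: "state \<Rightarrow> bool" where
  "order_static s \<longleftrightarrow> fst s ''n'' = n \<and> (\<forall>v < n. snd s ''hb'' v = hb v \<and> snd s ''tb'' v = tb v) \<and>
     (\<forall>j < n. snd s ''q'' j = vs ! j)"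

definition state_contracted ::
  "state \<Rightarrow> (nat \<times> nat \<times> label) multiset \<Rightarrow> nat set \<Rightarrow> nat set \<Rightarrow> nat set \<Rightarrow> bool" where
  "state_contracted s Z R Y S \<longleftrightarrow> order_static s \<and>
     (\<exists>X I. contracted (fst s ''i'') (fst s ''x'') Z R (snd s ''st'') (snd s ''ac'') (snd s ''cnt'')
       (snd s ''pa'') (snd s ''la'') Y S X I)"

text \<open>The variant is a potential with three units for each untreated arc and one for each tree
  node. Of the three units released by a fetch, one pays for a new tree node, one for the later turn
  that stops the moved arc, and one for the fetch itself; a contraction is paid by the tree node
  that it removes. The clause about \<open>pa\<close> and \<open>la\<close> says that the
  provisional parent is up to date.\<close>

definition resting :: "nat \<Rightarrow> state \<Rightarrow> bool" where
  "resting k s \<longleftrightarrow> fst s ''go'' = 0 \<and> (\<exists>Y S. state_contracted s {#} {} Y S \<and>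
     (fst s ''i'' < n \<longrightarrow> snd s ''pa'' (fst s ''x'') \<in> S \<and>
        snd s ''la'' (fst s ''x'') = snd s ''ac'' (snd s ''pa'' (fst s ''x''))) \<and>
     k = 3 * fst s ''i'' + card Y)"

definition moving :: "nat \<Rightarrow> state \<Rightarrow> bool" where
  "moving k s \<longleftrightarrow> fst s ''go'' = 1 \<and> fst s ''i'' < n \<and> fst s ''l'' < card labels \<and>
     (\<exists>Y S. state_contracted s {#(fst s ''w'', fst s ''x'', code_label (fst s ''l''))#} {} Y S \<and>
       fst s ''w'' \<in> insert src Y \<and> k = 3 * fst s ''i'' + card Y + 1)"

text \<open>Describes the middle of a turn, between \<open>place_com\<close> and
  \<open>move_com\<close>; hence the potential is still that of \<open>moving\<close>.\<close>

definition placed :: "nat \<Rightarrow> state \<Rightarrow> bool" where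
  "placed k s \<longleftrightarrow> fst s ''go'' = 1 \<and> fst s ''i'' < n \<and>
     (\<exists>Y S. state_contracted s {#} {fst s ''w''} Y S \<and> fst s ''w'' \<in> S \<and>
       k = 3 * fst s ''i'' + card Y + 1)"

lemma fetch_step:
  assumes w: "word_state W s" and inv: "resting k s" and i: "0 < fst s ''i''" and W: "card labels + 10 \<le> W"
  shows "fits W fetch_com s \<and> (\<exists>k' < k. moving k' (sem fetch_com s))"
proof -
  define i where "i = fst s ''i''"
  obtain Y S X I where st: "order_static s"
    and c: "contracted i (fst s ''x'') {#} {} (snd s ''st'') (snd s ''ac'') (snd s ''cnt'')
       (snd s ''pa'') (snd s ''la'') Y S X I"
    and r: "i < n \<Longrightarrow> snd s ''pa'' (fst s ''x'') \<in> S \<and>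
        snd s ''la'' (fst s ''x'') = snd s ''ac'' (snd s ''pa'' (fst s ''x''))"
    and k: "k = 3 * i + card Y"
    using inv unfolding resting_def state_contracted_def i_def by blast
  define v where "v = vs ! (i - 1)"
  have "i \<le> n" using c unfolding contracted_def by (elim conjE)
  then have i1: "i - 1 < n" using i by (simp add: i_def)
  have vn: "v < n" unfolding v_def by (rule vs_nth[OF i1])
  have arr: "snd s ''q'' (i - 1) = v" "snd s ''hb'' v = hb v" "snd s ''tb'' v = tb v"
    using st i1 vn unfolding order_static_def v_def by auto
  have sem: "sem fetch_com s = ((fst s)(''i'' := i - 1, ''v'' := v, ''x'' := hb v, ''w'' := tb v,
      ''l'' := label_code single_label, ''go'' := 1), snd s)"
    using arr by (simp add: fetch_com_def i_def[symmetric])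
  have "label_code single_label < card labels" using single_label_in by (rule label_code_less)
  then have "fits W fetch_com s"
    using W word_state_bounds[OF w] by (simp add: fetch_com_def)
  moreover from contracted_fetch[OF c i[folded i_def] r v_def] obtain Y' S' where
    c': "contracted (i - 1) (hb v) {#(tb v, hb v, single_label)#} {} (snd s ''st'') (snd s ''ac'') (snd s ''cnt'')
       (snd s ''pa'') (snd s ''la'') Y' S' X I" "tb v \<in> insert src Y'" "card Y' \<le> Suc (card Y)" by blast
  have "order_static (sem fetch_com s)" using st by (simp add: order_static_def sem)
  with c' have "state_contracted (sem fetch_com s) {#(tb v, hb v, single_label)#} {} Y' S'"
    unfolding state_contracted_def by (auto simp: sem)
  then have "moving (3 * (i - 1) + card Y' + 1) (sem fetch_com s)"
    unfolding moving_def using i1 single_label_in label_code_less[OF single_label_in] c'(2)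
    by (intro conjI exI[of _ Y'] exI[of _ S']) (simp_all add: sem)
  moreover have "3 * (i - 1) + card Y' + 1 < k"
    unfolding k using c'(3) i by (simp add: i_def)
  ultimately show ?thesis by blast
qed

lemma place_step:
  assumes w: "word_state W s" and inv: "moving k s" and W: "card labels + n + 10 \<le> W"
    and hb_le: "\<And>v. v < n \<Longrightarrow> hb v \<le> n"
  shows "fits W place_com s \<and> placed k (sem place_com s)"
proof -
  define x w l where "x = fst s ''x''" and "w = fst s ''w''" and "l = fst s ''l''"
  obtain Y S X I where st: "order_static s" and go: "fst s ''go'' = 1" "fst s ''i'' < n" "l < card labels"
    and c: "contracted (fst s ''i'') x {#(w, x, code_label l)#} {} (snd s ''st'') (snd s ''ac'') (snd s ''cnt'')
       (snd s ''pa'') (snd s ''la'') Y S X I"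
    and wY: "w \<in> insert src Y" and k: "k = 3 * fst s ''i'' + card Y + 1"
    using inv unfolding moving_def state_contracted_def x_def w_def l_def by blast
  have wS: "w \<in> S \<longleftrightarrow> snd s ''st'' w = Suc x"
  proof -
    from c have "\<forall>u \<in> insert src Y. u \<in> S \<longleftrightarrow> snd s ''st'' u = Suc x"
      unfolding contracted_def by (elim conjE)
    with wY show ?thesis by blast
  qed
  have "x = hb (vs ! fst s ''i'')" using c go(2) unfolding contracted_def by blast
  then have x_le: "x \<le> n" using hb_le[OF vs_nth[OF go(2)]] by simp
  show ?thesis
  proof (cases "w \<in> S")
    case True
    have ac: "snd s ''ac'' w < card labels" by (rule contracted_ac[OF c True])
    note pc = par_code(1)[OF ac go(3)]
    have sem: "sem place_com s = ((fst s)(''y'' := snd s ''ac'' w, ''z'' := par_code (snd s ''ac'' w) l),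
        (snd s)(''ac'' := (snd s ''ac'')(w := par_code (snd s ''ac'' w) l),
          ''cnt'' := (snd s ''cnt'')(w := snd s ''cnt'' w - 1)))"
      using True wS ac go(3) by (simp add: place_com_def x_def w_def l_def)
    have "fits W place_com s"
      using True wS ac go(3) pc W word_state_bounds[OF w] by (simp add: place_com_def x_def w_def l_def)
    moreover from contracted_place_old[OF c True go(3)] obtain X' where
      c': "contracted (fst s ''i'') x {#} {w} (snd s ''st'') ((snd s ''ac'')(w := par_code (snd s ''ac'' w) l))
         ((snd s ''cnt'')(w := snd s ''cnt'' w - 1)) (snd s ''pa'') (snd s ''la'') Y S X' I" by blast
    have "order_static (sem place_com s)" using st by (simp add: order_static_def sem)
    with c' have "state_contracted (sem place_com s) {#} {w} Y S"
      unfolding state_contracted_def by (auto simp: sem x_def)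
    then have "placed k (sem place_com s)"
      unfolding placed_def using go k True
      by (intro conjI exI[of _ Y] exI[of _ S]) (simp_all add: sem w_def)
    ultimately show ?thesis by simp
  next
    case False
    have sem: "sem place_com s = (fst s, (snd s)(''ac'' := (snd s ''ac'')(w := l),
          ''st'' := (snd s ''st'')(w := Suc x)))"
      using False wS by (simp add: place_com_def x_def w_def l_def)
    have "fits W place_com s"
      using False wS x_le W word_state_bounds[OF w] by (simp add: place_com_def x_def w_def l_def)
    moreover note c' = contracted_place_new[OF c wY False go(3,2)]
    have "order_static (sem place_com s)" using st by (simp add: order_static_def sem)
    with c' have "state_contracted (sem place_com s) {#} {w} Y (insert w S)"
      unfolding state_contracted_def by (auto simp: sem x_def)
    then have "placed k (sem place_com s)"
      unfolding placed_def using go k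
      by (intro conjI exI[of _ Y] exI[of _ "insert w S"]) (simp_all add: sem w_def)
    ultimately show ?thesis by simp
  qed
qed

lemma move_step:
  assumes w: "word_state W s" and inv: "placed k s" and W: "card labels + n + 10 \<le> W"
  shows "fits W move_com s \<and> (\<exists>k' < k. moving k' (sem move_com s) \<or> resting k' (sem move_com s))"
proof -
  define x w where "x = fst s ''x''" and "w = fst s ''w''"
  obtain Y S X I where st: "order_static s" and go: "fst s ''go'' = 1" "fst s ''i'' < n"
    and c: "contracted (fst s ''i'') x {#} {w} (snd s ''st'') (snd s ''ac'') (snd s ''cnt'')
       (snd s ''pa'') (snd s ''la'') Y S X I"
    and wS: "w \<in> S" and k: "k = 3 * fst s ''i'' + card Y + 1"
    using inv unfolding placed_def state_contracted_def x_def w_def by blast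
  have n: "fst s ''n'' = n" using st by (simp add: order_static_def)
  have ac: "snd s ''ac'' w < card labels" by (rule contracted_ac[OF c wS])
  show ?thesis
  proof (cases "w \<noteq> src \<and> snd s ''cnt'' w < 2")
    case True
    then have wY: "w \<in> Y" using contracted_S[OF c] wS by auto
    have la: "snd s ''la'' w < card labels" using c wY unfolding contracted_def by blast
    note sc = ser_code(1)[OF la ac]
    have sem: "sem move_com s = ((fst s)(''y'' := snd s ''la'' w, ''z'' := snd s ''ac'' w,
        ''l'' := ser_code (snd s ''la'' w) (snd s ''ac'' w), ''w'' := snd s ''pa'' w), snd s)"
      using True la ac by (simp add: move_com_def n w_def)
    have "fits W move_com s"
      using True la ac sc W word_state_bounds[OF w] by (simp add: move_com_def n w_def)
    moreover from contracted_step[OF c wS _ _ go(2)] True obtain X' where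
      c': "contracted (fst s ''i'') x {#(snd s ''pa'' w, x, code_label (ser_code (snd s ''la'' w) (snd s ''ac'' w)))#} {}
         (snd s ''st'') (snd s ''ac'') (snd s ''cnt'') (snd s ''pa'') (snd s ''la'') (Y - {w}) (S - {w}) X' (I - {w})"
        "snd s ''pa'' w \<in> insert src (Y - {w})" by blast
    have "order_static (sem move_com s)" using st by (simp add: order_static_def sem)
    with c'(1) have "state_contracted (sem move_com s)
        {#(snd s ''pa'' w, x, code_label (ser_code (snd s ''la'' w) (snd s ''ac'' w)))#} {} (Y - {w}) (S - {w})"
      unfolding state_contracted_def by (auto simp: sem x_def)
    then have "moving (3 * fst s ''i'' + card (Y - {w}) + 1) (sem move_com s)"
      unfolding moving_def using go sc c'(2)
      by (intro conjI exI[of _ "Y - {w}"] exI[of _ "S - {w}"]) (simp_all add: sem x_def)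
    moreover have "3 * fst s ''i'' + card (Y - {w}) + 1 < k"
      unfolding k using card_Diff1_less[OF contracted_finite(1)[OF c] wY] by simp
    ultimately show ?thesis by blast
  next
    case False
    then have w2: "w = src \<or> 2 \<le> snd s ''cnt'' w" by auto
    have sem: "sem move_com s = ((fst s)(''go'' := 0),
        (snd s)(''pa'' := (snd s ''pa'')(x := w), ''la'' := (snd s ''la'')(x := snd s ''ac'' w)))"
      using False by (auto simp: move_com_def n w_def x_def)
    have "fits W move_com s"
      using False word_state_bounds[OF w] by (auto simp: move_com_def n w_def)
    moreover note c' = contracted_stop[OF c wS w2 go(2)]
    have "order_static (sem move_com s)" using st by (simp add: order_static_def sem)
    with c' have "state_contracted (sem move_com s) {#} {} Y S"
      unfolding state_contracted_def by (auto simp: sem x_def)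
    then have "resting (3 * fst s ''i'' + card Y) (sem move_com s)"
      unfolding resting_def using wS
      by (intro conjI exI[of _ Y] exI[of _ S]) (simp_all add: sem x_def)
    moreover have "3 * fst s ''i'' + card Y < k" unfolding k by simp
    ultimately show ?thesis by blast
  qed
qed

lemma contract_step:
  assumes w: "word_state W s" and inv: "moving k s \<or> resting k s" and b: "bval contract_guard s"
    and W: "card labels + n + 10 \<le> W" and hb_le: "\<And>v. v < n \<Longrightarrow> hb v \<le> n"
  shows "fits W contract_body s \<and> (\<exists>k' < k. moving k' (sem contract_body s) \<or> resting k' (sem contract_body s))"
  using inv
proof
  assume m: "moving k s"
  then have go: "fst s ''go'' = 1" by (simp add: moving_def)
  from place_step[OF w m W hb_le] have p: "fits W place_com s" "placed k (sem place_com s)" by auto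
  have "word_state W (sem place_com s)"
    by (rule word_state_sem[OF _ p(1) w]) (simp add: place_com_def)
  from move_step[OF this p(2) W] show ?thesis using p(1) go by (simp add: contract_body_def)
next
  assume r: "resting k s"
  then have go: "fst s ''go'' = 0" by (simp add: resting_def)
  with b have "0 < fst s ''i''" by (simp add: contract_guard_def)
  moreover have "card labels + 10 \<le> W" using W by simp
  ultimately show ?thesis using fetch_step[OF w r] go by (auto simp: contract_body_def)
qed

definition after_contract :: "state \<Rightarrow> bool" where
  "after_contract s \<longleftrightarrow> snd s ''la'' 0 < card labels \<and> L = code_label (snd s ''la'' 0)"

lemma run_contract:
  assumes "order_static s" "zero_arrays {''st''} s" "\<And>u. snd s ''cnt'' u = card {v. v < n \<and> tb v = u}"
    and "word_state W s" "card labels + n + 10 \<le> W" "\<And>v. v < n \<Longrightarrow> hb v \<le> n" "0 < n"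
  shows "runs W (loop contract_init contract_guard contract_body) s
    (5 * loop_cost contract_init contract_guard contract_body * (n + m)) after_contract"
proof (rule runs_loop[where k = "3 * n" and I = "\<lambda>k s. moving k s \<or> resting k s"])
  show "while_free contract_init" "while_free contract_body" by (simp_all add: com_defs)
  show "word_state W s" by fact
  show "fits W contract_init s" using assms(1,5) by (simp add: com_defs order_static_def)
  have sem: "sem contract_init s = ((fst s)(''i'' := n, ''go'' := 0, ''x'' := 0), snd s)"
    using assms(1) by (simp add: contract_init_def order_static_def)
  have "order_static (sem contract_init s)" using assms(1) by (simp add: order_static_def sem)
  moreover have "contracted n 0 {#} {} (snd s ''st'') (snd s ''ac'') (snd s ''cnt'') (snd s ''pa'') (snd s ''la'')
      {} {} (vertex_arcs (mset_set {..<n})) J"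
    by (rule contracted_init) (use assms(2,3) in \<open>auto simp: zero_arrays_def\<close>)
  ultimately have "state_contracted (sem contract_init s) {#} {} {} {}"
    unfolding state_contracted_def by (auto simp: sem)
  then have "resting (3 * n) (sem contract_init s)"
    unfolding resting_def by (intro conjI exI[of _ "{}"]) (simp_all add: sem)
  then show "moving (3 * n) (sem contract_init s) \<or> resting (3 * n) (sem contract_init s)" ..
  show "3 * n \<le> 4 * (n + m)" "0 < n + m" using assms(7) by auto
next
  fix k s assume "word_state W s" "moving k s \<or> resting k s" "bval contract_guard s"
  then show "fits W contract_body s \<and>
      (\<exists>k'<k. moving k' (sem contract_body s) \<or> resting k' (sem contract_body s))"
    using contract_step assms(5,6) by blast
next
  fix k s assume inv: "moving k s \<or> resting k s" and "\<not> bval contract_guard s"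
  then have i: "fst s ''i'' = 0" "fst s ''go'' = 0" by (auto simp: contract_guard_def)
  with inv have "resting k s" by (auto simp: moving_def)
  then obtain Y S X I where
    c: "contracted 0 (fst s ''x'') {#} {} (snd s ''st'') (snd s ''ac'') (snd s ''cnt'')
       (snd s ''pa'') (snd s ''la'') Y S X I"
    and r: "snd s ''pa'' (fst s ''x'') \<in> S"
        "snd s ''la'' (fst s ''x'') = snd s ''ac'' (snd s ''pa'' (fst s ''x''))"
    using assms(7) unfolding resting_def state_contracted_def i by blast
  from contracted_finish[OF c assms(7) r] show "after_contract s" unfolding after_contract_def by simp
qed

end

section \<open>Composition of the phases and of their costs\<close>

lemma run_output:
  assumes "snd s ''la'' 0 < card labels" "word_state W s" "min_colors (code_label (snd s ''la'' 0)) \<le> W"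
  shows "runs W output_com s (max_cost output_com)
    (\<lambda>s'. fst s' ''result'' = min_colors (code_label (snd s ''la'' 0)))"
  by (rule runs_while_free) (use assms word_state_bounds[OF assms(2)] in \<open>simp_all add: output_com_def\<close>)

definition chromatic_cost :: nat where
  "chromatic_cost =
     5 * loop_cost (Assign ''i'' (N 0)) (below ''m'') head_body +
     (5 * loop_cost (Assign ''i'' (N 0)) (below ''m'') tail_body +
     (5 * loop_cost (Assign ''i'' (N 0)) (below ''n'') list_body +
     (5 * loop_cost kahn_init_com kahn_guard kahn_body +
     (5 * loop_cost contract_init contract_guard contract_body +
     (max_cost output_com + 1)))))"

lemma (in block_input) run_chromatic:
  assumes "input_ok s" "zero_arrays {''hb'', ''tb'', ''cnt'', ''done'', ''first'', ''st''} s"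
    and w: "word_state W s" and W: "n + length es + card labels + 10 \<le> W" and L: "min_colors L \<le> W"
  shows "runs W chromatic_com s (chromatic_cost * (n + length es)) (\<lambda>s. fst s ''result'' = min_colors L)"
proof -
  have W1: "n + length es + 10 \<le> W" "card labels + n + 10 \<le> W" using W by auto
  have contract: "runs W (loop contract_init contract_guard contract_body) s'
    (5 * loop_cost contract_init contract_guard contract_body * (n + length es))
    (\<lambda>s. snd s ''la'' 0 < card labels \<and> L = code_label (snd s ''la'' 0))"
    if "word_state W s'" "after_kahn s'" for s'
  proof -
    from that(2) obtain vs pos where o: "block_order n hb tb J L vs pos"
      and q: "\<forall>j < n. snd s' ''q'' j = vs ! j" and st: "static s'"
      unfolding after_kahn_def by blast
    interpret o: block_order n hb tb J L vs pos by (rule o)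
    have "o.order_static s'" using st q unfolding o.order_static_def static_def by blast
    moreover have "zero_arrays {''st''} s'" "\<And>u. snd s' ''cnt'' u = card {v. v < n \<and> tb v = u}"
      using st unfolding static_def by blast+
    ultimately show ?thesis
      using o.run_contract[OF _ _ _ that(1) W1(2) hb_le n_pos] unfolding o.after_contract_def by blast
  qed
  have out: "runs W (Seq output_com Skip) s' (max_cost output_com + 1) (\<lambda>s. fst s ''result'' = min_colors L)"
    if "word_state W s'" "snd s' ''la'' 0 < card labels \<and> L = code_label (snd s' ''la'' 0)" for s'
  proof (rule runs_Seq)
    show "runs W output_com s' (max_cost output_com) (\<lambda>s. fst s ''result'' = min_colors L)"
      using run_output[of s' W] that L by simp
    show "runs W Skip s'' 1 (\<lambda>s. fst s ''result'' = min_colors L)"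
      if "word_state W s''" "fst s'' ''result'' = min_colors L" for s''
      using runs_while_free[of Skip W s'' "\<lambda>s. fst s ''result'' = min_colors L"] that by simp
  qed
  have "runs W chromatic_com s
     (5 * loop_cost (Assign ''i'' (N 0)) (below ''m'') head_body * (n + length es) +
     (5 * loop_cost (Assign ''i'' (N 0)) (below ''m'') tail_body * (n + length es) +
     (5 * loop_cost (Assign ''i'' (N 0)) (below ''n'') list_body * (n + length es) +
     (5 * loop_cost kahn_init_com kahn_guard kahn_body * (n + length es) +
     (5 * loop_cost contract_init contract_guard contract_body * (n + length es) +
     (max_cost output_com + 1)))))) (\<lambda>s. fst s ''result'' = min_colors L)"
    unfolding chromatic_com_def seqs_simps
    by (rule runs_Seq[OF run_head[OF assms(1,2) w W1(1)]], rule runs_Seq[OF run_tail[OF _ _ W1(1)]],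
        assumption, assumption, rule runs_Seq[OF run_list[OF _ _ W1(1)]], assumption, assumption,
        rule runs_Seq[OF run_kahn[OF _ _ W1(1)]], assumption, assumption,
        rule runs_Seq[OF contract], assumption, assumption, rule out)
  moreover have "(max_cost output_com + 1) * 1 \<le> (max_cost output_com + 1) * (n + length es)"
    by (intro mult_le_mono2) (use n_pos in simp)
  then have "5 * loop_cost (Assign ''i'' (N 0)) (below ''m'') head_body * (n + length es) +
     (5 * loop_cost (Assign ''i'' (N 0)) (below ''m'') tail_body * (n + length es) +
     (5 * loop_cost (Assign ''i'' (N 0)) (below ''n'') list_body * (n + length es) +
     (5 * loop_cost kahn_init_com kahn_guard kahn_body * (n + length es) +
     (5 * loop_cost contract_init contract_guard contract_body * (n + length es) +
     (max_cost output_com + 1))))) \<le> chromatic_cost * (n + length es)"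
    unfolding chromatic_cost_def add_mult_distrib mult_1_right by (intro add_left_mono)
  ultimately show ?thesis by (rule runs_mono)
qed

text \<open>The numbering \<open>f\<close> behind the input also names the blocks, so the names can
  be read off the list of arcs. The terminals \<open>Suc n\<close> and \<open>0\<close> are
  admissible because inner names are successors of numbers below \<open>n\<close>.\<close>

lemma block_input_represents:
  assumes "msp_digraph G" and f: "bij_betw f (pverts G) {0..<n}"
    and es: "set es = (\<lambda>(u, v). (f u, f v)) ` parcs G"
  shows "\<exists>hb tb J. block_input n hb tb J (hom_label G) es"
proof -
  define g where "g = inv_into (pverts G) f"
  have inj: "inj_on f (pverts G)" and img: "f ` pverts G = {..<n}"
    using f by (auto simp: bij_betw_def atLeast0LessThan)
  have gf: "g (f v) = v" if "v \<in> pverts G" for v unfolding g_def using inj that by (rule inv_into_f_f)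
  have fg: "f (g u) = u" "g u \<in> pverts G" if "u < n" for u
    using that img unfolding g_def by (auto intro: f_inv_into_f inv_into_into)
  have fin: "finite (pverts G)" and arcs: "parcs G \<subseteq> pverts G \<times> pverts G"
    using finite_msp[OF assms(1)] by auto
  have f_less: "f v < n" if "v \<in> pverts G" for v using that img by blast
  have ends: "{Suc n, 0} \<inter> Suc ` f ` (pverts G - sources G) = {}" using f_less by fastforce
  from ttsp_block_graph[OF assms(1) inj _ ends] obtain J where
    J: "sp.ttsp (block_graph f (Suc n) 0 G) J (Suc n) 0 (hom_label G)" by auto
  define hb where "hb u = head_block f 0 G (g u)" for u
  define tb where "tb u = tail_block f (Suc n) G (g u)" for u
  have "mset_set {..<n} = image_mset f (mset_set (pverts G))"
    unfolding img[symmetric] using inj by (rule image_mset_mset_set[symmetric])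
  then have "image_mset (\<lambda>v. (tb v, hb v, single_label)) (mset_set {..<n}) =
      image_mset (\<lambda>v. (tb (f v), hb (f v), single_label)) (mset_set (pverts G))"
    by (simp only: multiset.map_comp comp_def)
  also have "\<dots> = block_graph f (Suc n) 0 G"
    unfolding block_graph_def using fin by (intro image_mset_cong) (simp add: hb_def tb_def gf)
  finally have "image_mset (\<lambda>v. (tb v, hb v, single_label)) (mset_set {..<n}) = block_graph f (Suc n) 0 G" .
  with J have t: "sp.ttsp (image_mset (\<lambda>v. (tb v, hb v, single_label)) (mset_set {..<n})) J (Suc n) 0 (hom_label G)"
    by simp
  have arc_iff: "(u, v) \<in> set es \<longleftrightarrow> (g u, g v) \<in> parcs G" if "u < n" "v < n" for u v
  proof
    assume "(u, v) \<in> set es"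
    then obtain a b where ab: "(a, b) \<in> parcs G" "u = f a" "v = f b" unfolding es by auto
    with arcs gf show "(g u, g v) \<in> parcs G" by auto
  next
    assume "(g u, g v) \<in> parcs G"
    then have "(f (g u), f (g v)) \<in> set es" unfolding es by force
    then show "(u, v) \<in> set es" using fg that by simp
  qed
  have es_sub: "set es \<subseteq> {..<n} \<times> {..<n}" unfolding es using arcs f_less by auto
  have "block_input n hb tb J (hom_label G) es"
  proof
    show "sp.ttsp (image_mset (\<lambda>v. (tb v, hb v, single_label)) (mset_set {..<n})) J (Suc n) 0 (hom_label G)"
      by (rule t)
    show "0 < n"
      using sources_sinks_nonempty[OF assms(1)] sources_sinks_subset[of G] f_less by (metis all_not_in_conv gr_zeroI not_less0 subsetD)
    show "set es \<subseteq> {..<n} \<times> {..<n}" by (rule es_sub)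
  next
    fix u assume u: "u < n"
    have succ: "{v. (u, v) \<in> set es} = f ` {w. (g u, w) \<in> parcs G}"
    proof (intro set_eqI iffI)
      fix v assume "v \<in> {v. (u, v) \<in> set es}"
      then have "v < n" "(g u, g v) \<in> parcs G" using es_sub arc_iff[OF u, of v] by auto
      then show "v \<in> f ` {w. (g u, w) \<in> parcs G}" using fg(1)[of v] by (metis imageI mem_Collect_eq)
    next
      fix v assume "v \<in> f ` {w. (g u, w) \<in> parcs G}"
      then obtain w where w: "(g u, w) \<in> parcs G" "v = f w" by auto
      then have "w \<in> pverts G" using arcs by auto
      then show "v \<in> {v. (u, v) \<in> set es}" using w arc_iff[OF u f_less[of w]] gf by simp
    qed
    show "hb u = Max (insert 0 (Suc ` {v. (u, v) \<in> set es}))"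
    proof (cases "g u \<in> sinks G")
      case True
      then have "{w. (g u, w) \<in> parcs G} = {}" using msp_sinks[OF assms(1)] by auto
      then show ?thesis unfolding succ hb_def head_block_def using True by simp
    next
      case False
      then have ne: "{w. (g u, w) \<in> parcs G} \<noteq> {}" using msp_sinks[OF assms(1)] fg(2)[OF u] by auto
      have "finite {w. (g u, w) \<in> parcs G}" using fin arcs by (auto intro: finite_subset[of _ "pverts G"])
      then show ?thesis unfolding succ hb_def head_block_def using False ne
        by (simp add: mono_Max_commute[OF mono_Suc] image_image)
    qed
  next
    fix u v assume uv: "(u, v) \<in> set es"
    then have "u < n" "v < n" using es_sub by auto
    with uv arc_iff have "(g u, g v) \<in> parcs G" by blast
    then show "tb v = hb u" unfolding tb_def hb_def head_block_def tail_block_def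
      using tail_block_arc[OF assms(1), of "g u" "g v" f] msp_sources[OF assms(1)] msp_sinks[OF assms(1)]
      by (auto simp: head_block_def tail_block_def)
  next
    fix v assume v: "v < n" and no: "\<And>u. (u, v) \<notin> set es"
    have "(x, g v) \<notin> parcs G" for x
    proof
      assume "(x, g v) \<in> parcs G"
      moreover from this have "x \<in> pverts G" using arcs by auto
      ultimately have "(f x, v) \<in> set es" using arc_iff[OF f_less[of x] v] gf by simp
      with no show False by blast
    qed
    then have "g v \<in> sources G" using msp_sources[OF assms(1)] fg(2)[OF v] by auto
    then show "tb v = Suc n" by (simp add: tb_def tail_block_def)
  qed
  then show ?thesis by blast
qed

theorem theorem5p11:
  shows "linear_time_computable (msp_digraph :: 'a pair_pre_digraph \<Rightarrow> bool)
           oriented_chromatic_number"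
  unfolding linear_time_computable_def
proof (rule exI[of _ chromatic_com], rule exI[of _ chromatic_cost], rule exI[of _ "card labels + 11"],
    rule exI[of _ 1], intro allI impI)
  fix G :: "'a pair_pre_digraph" and n es
  assume "msp_digraph G \<and> represents n es G"
  then obtain f where msp: "msp_digraph G" and f: "bij_betw f (pverts G) {0..<n}" and "distinct es"
    and es: "set es = (\<lambda>(u, v). (f u, f v)) ` parcs G" unfolding represents_def by blast
  from block_input_represents[OF msp f es] obtain hb tb J where
    "block_input n hb tb J (hom_label G) es" by blast
  then interpret block_input n hb tb J "hom_label G" es .
  have V: "card (pverts G) = n" using bij_betw_same_card[OF f] by simp
  have "inj_on (\<lambda>(u, v). (f u, f v)) (parcs G)"
    using bij_betw_imp_inj_on[OF f] finite_msp[OF msp] by (auto simp: inj_on_def)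
  then have E: "card (parcs G) = length es"
    using card_image[of "\<lambda>(u, v). (f u, f v)" "parcs G"] distinct_card[OF \<open>distinct es\<close>] es by simp
  \<comment> \<open>Since the graph has a vertex, \<open>n + length es\<close> is at least 1, and
    the additive constant \<open>card labels + 10\<close> is absorbed by the factor. The largest
    word is thus linear in the size of the input.\<close>
  define W where "W = (card labels + 11) * (n + length es) ^ 1"
  have W: "n + length es + card labels + 10 \<le> W"
  proof -
    have "(card labels + 10) * 1 \<le> (card labels + 10) * (n + length es)"
      using n_pos by (intro mult_le_mono2) simp
    then show ?thesis unfolding W_def by (simp add: algebra_simps)
  qed
  have ok: "input_ok (input_state n es)" by (simp add: input_ok_def input_state_def)
  have zero: "zero_arrays {''hb'', ''tb'', ''cnt'', ''done'', ''first'', ''st''} (input_state n es)"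
    by (simp add: zero_arrays_def input_state_def)
  have "fst (es ! i) \<le> W \<and> snd (es ! i) \<le> W" if "i < length es" for i
    using arc_bounds[OF that] W by linarith
  then have "word_state W (input_state n es)"
    using W by (auto simp: word_state_def input_state_def)
  moreover have "min_colors (hom_label G) \<le> W" using min_colors_le_7[OF msp] W by linarith
  ultimately have "runs W chromatic_com (input_state n es) (chromatic_cost * (n + length es))
      (\<lambda>s. fst s ''result'' = min_colors (hom_label G))"
    using run_chromatic[OF ok zero _ W] by blast
  then show "\<exists>t s. exec ((card labels + 11) * (card (pverts G) + card (parcs G)) ^ 1) chromatic_com (input_state n es) t s \<and>
       fst s ''result'' = oriented_chromatic_number G \<and>
       t \<le> chromatic_cost * (card (pverts G) + card (parcs G))"
    unfolding V E oriented_chromatic_number_msp[OF msp] runs_def W_def by blast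
qed

end
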